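(* Let $0<\delta\le\frac12$ and $\rho=1-(1-2\delta)^{1/2}$. Let $\Phi:\mathcal H\to\mathbb R$ be such that $\exp(-\Phi)$ is $\gamma$-integrable and such that for every $\kappa>0$ there is $M_\kappa$ with $$\phi(s):=\sup_{x\ne y\in B_s(0)}\frac{|\Phi(x)-\Phi(y)|}{\|x-y\|}\le M_\kappa e^{\kappa s}\qquad\text{for all } s>0.$$ Assume that there are $R>0$, $\alpha_l>-\infty$, $r>0$ and $a\in(\frac12,1)$ such that, with $r(s)=r s^a$, one has $r(s)\le\frac\rho2 s$ for all $s\ge R$ and for all $x\in\mathcal H\setminus B_R(0)$ $$\inf_{z\in B_{r(\|x\|)}((1-\rho)x)}\exp\bigl(-\Phi(z)+\Phi(x)\bigr)>\exp(\alpha_l).$$ Let either $V(x)=\|x\|^i$ with $i\in\mathbb N$ or $V(x)=\exp(v\|x\|)$ with $v>0$. Then $\mu$ is the unique invariant measure of the pCN kernel $\mathcal P$ on $\mathcal H$, and, for every $m$, $\mu_m$ is the unique invariant measure of the pCN kernel $\mathcal P_m$ on $P_m\mathcal H$. Moreover, define $$d(x,y)=1\wedge\inf_{T,\psi\in\mathsf A(T,x,y)}\frac1\epsilon\int_0^T\exp(\eta\|\psi(t)\|)\,dt,\qquad \tilde d(x,y)=\sqrt{d(x,y)\,(1+V(x)+V(y))}.$$ Then for $\eta>0$ sufficiently small and $\epsilon>0$ sufficiently small (depending on $\eta$) there exists $\tilde n\in\mathbb N$ (not depending on $m$) such that $$\tilde d(\nu_1\mathcal P^{\tilde n},\nu_2\mathcal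 P^{\tilde n})\le\tfrac12\tilde d(\nu_1,\nu_2)$$ for all probability measures $\nu_1,\nu_2$ on $\mathcal H$, and $$\tilde d(\nu_1\mathcal P_m^{\tilde n},\nu_2\mathcal P_m^{\tilde n})\le\tfrac12\tilde d(\nu_1,\nu_2)$$ for all $m\in\mathbb N$ and all probability measures $\nu_1,\nu_2$ on $P_m\mathcal H$.
   Context: $(\mathcal H,\langle\cdot,\cdot\rangle)$ is a separable Hilbert space with norm $\|\cdot\|$, $B_s(x)$ is the ball of radius $s$ centred at $x$, and $\gamma$ is a centred Gaussian measure on $\mathcal H$ with covariance operator $\mathcal C$. $(e_n)_{n\in\mathbb N}$ is an orthonormal basis of eigenvectors of $\mathcal C$ with eigenvalues $\lambda_n^2$, so that $\gamma$ is the law of $\sum_{i=1}^\infty\lambda_ie_i\xi_i$ with $\xi_i$ i.i.d. $\mathcal N(0,1)$. $P_m$ is the orthogonal projection onto the span of $e_1,\dots,e_m$, and $\gamma_m$ is the law of $\sum_{i=1}^m\lambda_ie_i\xi_i$. The target measures are $\mu(dx)=M\exp(-\Phi(x))\gamma(dx)$ on $\mathcal H$ and $\mu_m(dx)=M_m\exp(-\Phi(P_mx))\gamma_m(dx)$ on $P_m\mathcal H$, where $M,M_m$ are normalising constants. The pCN kernel $\mathcal P$ on $\mathcal H$ is the transition kernel of the following Markov chain: from $X_n$, draw $\xi\sim\gamma$ independently, set $p=(1-2\delta)^{1/2}X_n+\sqrt{2\delta}\,\xi=(1-\rho)X_n+\sqrt{2\delta}\,\xi$, and let $X_{n+1}=p$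 with probability $\alpha(X_n,p)$ and $X_{n+1}=X_n$ otherwise, where $\alpha(x,y)=1\wedge\exp(\Phi(x)-\Phi(y))$. The kernel $\mathcal P_m$ on $P_m\mathcal H$ is defined in the same way with $\xi\sim\gamma_m$. Path space: $\mathsf A(T,x,y)=\{\psi\in C^1([0,T],\mathcal H):\psi(0)=x,\ \psi(T)=y,\ \|\dot\psi\|=1\}$, $T\ge0$. For a symmetric lower semicontinuous function $\tilde d\ge0$ vanishing exactly on the diagonal, and probability measures $\nu_1,\nu_2$, $\tilde d(\nu_1,\nu_2)=\inf_{\pi}\int\tilde d(x,y)\,\pi(dx,dy)$, the infimum being over all couplings $\pi$ of $\nu_1$ and $\nu_2$. *)

theory Defs
  imports "HOL-Probability.Probability"
begin

section \<open>Gaussian measures and finite-dimensional approximations\<close>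

text \<open>
  Separable real Hilbert spaces are the types of sort
  \<open>{real_inner, complete_space, second_countable_topology}\<close>; for metric spaces, second
  countability is the same as separability.
\<close>

text \<open>The value \<open>\<sigma> = 0\<close> allows for degenerate directions.\<close>

definition centred_gaussian ::
    "'a::{real_inner, complete_space, second_countable_topology} measure \<Rightarrow> bool" where
  "centred_gaussian \<gamma> \<longleftrightarrow>
     \<gamma> \<in> space (prob_algebra borel) \<and>
     (\<forall>h. \<exists>\<sigma>\<ge>0. distr \<gamma> borel (\<lambda>x. h \<bullet> x) =
        (if \<sigma> = 0 then return borel 0
         else density lborel (\<lambda>t. ennreal (normal_density 0 \<sigma> t))))"

text \<open>For a centred measure; the mean is not subtracted.\<close>

definition covariance_operator ::
    "'a::{real_inner, complete_space, second_countable_topology} measure \<Rightarrow> ('a \<Rightarrow> 'a) \<Rightarrow> bool" where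
  "covariance_operator \<gamma> C \<longleftrightarrow>
     (\<forall>h k. C h \<bullet> k = (LINT x|\<gamma>. (h \<bullet> x) * (k \<bullet> x)))"

definition orthonormal_basis :: "(nat \<Rightarrow> 'a::real_inner) \<Rightarrow> bool" where
  "orthonormal_basis e \<longleftrightarrow>
     (\<forall>i j. e i \<bullet> e j = (if i = j then 1 else 0)) \<and>
     closure (span (range e)) = UNIV"

text \<open>
  Basis vectors are indexed from \<open>0\<close>, so that the first \<open>m\<close> of them are those with index \<open>i < m\<close>.
\<close>

definition proj :: "(nat \<Rightarrow> 'a::real_inner) \<Rightarrow> nat \<Rightarrow> 'a \<Rightarrow> 'a" where
  "proj e m x = (\<Sum>i<m. (e i \<bullet> x) *\<^sub>R e i)"

definition proj_space ::
    "(nat \<Rightarrow> 'a::{real_inner, complete_space, second_countable_topology}) \<Rightarrow> nat \<Rightarrow> 'a measure" where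
  "proj_space e m = restrict_space borel (range (proj e m))"

definition gaussian_proj ::
    "(nat \<Rightarrow> real) \<Rightarrow> (nat \<Rightarrow> 'a::{real_inner, complete_space, second_countable_topology}) \<Rightarrow>
     nat \<Rightarrow> 'a measure" where
  "gaussian_proj lam e m =
     distr (\<Pi>\<^sub>M i\<in>{..<m}. density lborel (\<lambda>t. ennreal (std_normal_density t)))
       (proj_space e m) (\<lambda>\<xi>. \<Sum>i<m. (lam i * \<xi> i) *\<^sub>R e i)"

definition target_measure :: "('a \<Rightarrow> real) \<Rightarrow> 'a measure \<Rightarrow> 'a measure" where
  "target_measure \<Phi> \<gamma> =
     density \<gamma> (\<lambda>x. ennreal (exp (- \<Phi> x) / (LINT y|\<gamma>. exp (- \<Phi> y))))"

text \<open>Extended-real valued, so that an unbounded difference quotient gives \<open>\<infinity>\<close>.\<close>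

definition local_lipschitz_const :: "('a::real_normed_vector \<Rightarrow> real) \<Rightarrow> real \<Rightarrow> ereal" where
  "local_lipschitz_const \<Phi> s =
     (SUP (x, y) \<in> {(x, y). x \<in> ball 0 s \<and> y \<in> ball 0 s \<and> x \<noteq> y}.
        ereal (\<bar>\<Phi> x - \<Phi> y\<bar> / norm (x - y)))"

section \<open>The pCN kernel\<close>

definition accept_prob :: "('a \<Rightarrow> real) \<Rightarrow> 'a \<Rightarrow> 'a \<Rightarrow> real" where
  "accept_prob \<Phi> x y = min 1 (exp (\<Phi> x - \<Phi> y))"

text \<open>
  The state space is that of the noise measure \<open>\<gamma>\<close>, so this covers both the chain on the whole
  Hilbert space and the chains on the ranges of the projections.
\<close>

definition pcn_kernel ::
    "real \<Rightarrow> ('a::real_vector \<Rightarrow> real) \<Rightarrow> 'a measure \<Rightarrow> 'a \<Rightarrow> 'a measure" where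
  "pcn_kernel \<delta> \<Phi> \<gamma> x =
     do {
       \<xi> \<leftarrow> \<gamma>;
       let p = sqrt (1 - 2 * \<delta>) *\<^sub>R x + sqrt (2 * \<delta>) *\<^sub>R \<xi>;
       accept \<leftarrow> measure_pmf (bernoulli_pmf (accept_prob \<Phi> x p));
       return \<gamma> (if accept then p else x)
     }"

definition kernel_iterate :: "('a \<Rightarrow> 'a measure) \<Rightarrow> nat \<Rightarrow> 'a measure \<Rightarrow> 'a measure" where
  "kernel_iterate K n \<nu> = ((\<lambda>\<nu>. \<nu> \<bind> K) ^^ n) \<nu>"

definition invariant_measure :: "'a measure \<Rightarrow> ('a \<Rightarrow> 'a measure) \<Rightarrow> 'a measure \<Rightarrow> bool" where
  "invariant_measure S K \<nu> \<longleftrightarrow> \<nu> \<in> space (prob_algebra S) \<and> \<nu> \<bind> K = \<nu>"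

definition unique_invariant_measure :: "'a measure \<Rightarrow> ('a \<Rightarrow> 'a measure) \<Rightarrow> 'a measure \<Rightarrow> bool" where
  "unique_invariant_measure S K \<mu> \<longleftrightarrow>
     invariant_measure S K \<mu> \<and> (\<forall>\<nu>. invariant_measure S K \<nu> \<longrightarrow> \<nu> = \<mu>)"

section \<open>Distances on the state space and on probability measures\<close>

text \<open>
  One-sided derivatives are taken at the end points. For \<open>T = 0\<close> the derivative condition is void
  and the constant path remains. Values outside \<open>[0,T]\<close> are irrelevant.
\<close>

definition path_space ::
    "real \<Rightarrow> 'a::real_normed_vector \<Rightarrow> 'a \<Rightarrow> (real \<Rightarrow> 'a) set" where
  "path_space T x y =
     {\<psi>. \<psi> 0 = x \<and> \<psi> T = y \<and>
        (\<exists>\<psi>'. continuous_on {0..T} \<psi>' \<and>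
           (\<forall>t\<in>{0..T}. (\<psi> has_vector_derivative \<psi>' t) (at t within {0..T}) \<and> norm (\<psi>' t) = 1))}"

definition path_dist :: "real \<Rightarrow> real \<Rightarrow> 'a::real_normed_vector \<Rightarrow> 'a \<Rightarrow> real" where
  "path_dist \<eta> \<epsilon> x y =
     min 1 (INF (T, \<psi>) \<in> {(T, \<psi>). 0 \<le> T \<and> \<psi> \<in> path_space T x y}.
              1 / \<epsilon> * integral {0..T} (\<lambda>t. exp (\<eta> * norm (\<psi> t))))"

definition weighted_dist ::
    "real \<Rightarrow> real \<Rightarrow> ('a::real_normed_vector \<Rightarrow> real) \<Rightarrow> 'a \<Rightarrow> 'a \<Rightarrow> real" where
  "weighted_dist \<eta> \<epsilon> V x y = sqrt (path_dist \<eta> \<epsilon> x y * (1 + V x + V y))"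

definition couplings :: "'a measure \<Rightarrow> 'a measure \<Rightarrow> ('a \<times> 'a) measure set" where
  "couplings \<nu>1 \<nu>2 =
     {\<pi> \<in> space (prob_algebra (\<nu>1 \<Otimes>\<^sub>M \<nu>2)). distr \<pi> \<nu>1 fst = \<nu>1 \<and> distr \<pi> \<nu>2 snd = \<nu>2}"

text \<open>May be infinite, since no moments of the measures are assumed.\<close>

definition transport_cost ::
    "('a \<Rightarrow> 'a \<Rightarrow> real) \<Rightarrow> 'a measure \<Rightarrow> 'a measure \<Rightarrow> ennreal" where
  "transport_cost D \<nu>1 \<nu>2 =
     (INF \<pi> \<in> couplings \<nu>1 \<nu>2. \<integral>\<^sup>+ (x, y). ennreal (D x y) \<partial>\<pi>)"

end

theory Submission
  imports Defs
begin

text \<open>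
  Two copies of the chain are driven by the same noise and the same uniform variable for the
  acceptance decision. If both copies accept, their distance shrinks by the factor \<open>1 - \<rho>\<close> up to the
  weight \<open>exp (\<eta> * norm \<xi>)\<close>, whose mean is close to \<open>1\<close> for small \<open>\<eta>\<close>; if both reject, it is unchanged;
  and they disagree with probability at most a constant times \<open>\<epsilon> * d(x, y)\<close>, because \<open>\<Phi>\<close> is locally
  Lipschitz with a constant that the weight in \<open>d\<close> absorbs. Together with the drift of \<open>V\<close>
  and the contraction on bounded sets, the weak Harris argument gives the claim for a suitable
  number of steps. All constants depend on the noise only through its exponential moments, which
  for \<open>\<gamma>\<^sub>m\<close>, the image of \<open>\<gamma>\<close> under the projection, are bounded by those of \<open>\<gamma>\<close>.

  The path distance need not be measurable: for non-measurable functions the nonnegative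
  integral is a lower integral, and the upper bounds that the argument needs hold for it as well.
\<close>

section \<open>Lower integrals and the uniqueness theorem for characteristic functionals\<close>

text \<open>Lower integrals are superadditive, which is the wrong direction for upper bounds, and
  Cauchy-Schwarz, the usual way to separate \<open>d\<close> from the Lyapunov weight under the
  square root, is not at hand. AM-GM with a free weight replaces it: the root is bounded by a
  multiple of \<open>d\<close> plus an affine function of the Lyapunov part, which is measurable and
  can be split off, and the weight is optimised for the bounds after all steps. The other obstacle
  is uniformity in \<open>m\<close>, settled by the order of the choices: noise radius, acceptance
  probabilities, drift rate and radius of the bounded set come before \<open>\<eta>\<close>; the
  Lipschitz constant of the acceptance probability depends on \<open>\<eta>\<close>;
  \<open>\<epsilon>\<close> is chosen against it, and the numbers of steps come last. None of them
  sees more of the noise than a common bound \<open>E\<close> on its exponential moments.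
  Characteristic functionals serve three times: they identify the projected noise, they give the
  symmetry of state and proposal, and they conclude the uniqueness of invariant measures.\<close>

lemma nn_integral_leI_measurable:
  assumes "\<And>g. g \<in> borel_measurable M \<Longrightarrow> (\<And>x. x \<in> space M \<Longrightarrow> g x \<le> f x) \<Longrightarrow> (\<integral>\<^sup>+x. g x \<partial>M) \<le> c"
  shows "(\<integral>\<^sup>+x. f x \<partial>M) \<le> c"
  unfolding nn_integral_def
proof (rule SUP_least)
  fix g assume g: "g \<in> {g. simple_function M g \<and> g \<le> f}"
  then have "(\<integral>\<^sup>+x. g x \<partial>M) \<le> c"
    by (intro assms) (auto dest: borel_measurable_simple_function simp: le_fun_def)
  with g show "integral\<^sup>S M g \<le> c" by (simp add: nn_integral_eq_simple_integral)
qed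

text \<open>A measurable minorant on the image pulls back along \<open>g\<close> to a minorant of
  the composition. Only this inequality can be expected: minorants on \<open>M\<close> that do not
  factor through \<open>g\<close> may be larger.\<close>

lemma nn_integral_distr_le:
  assumes [measurable]: "g \<in> M \<rightarrow>\<^sub>M N"
  shows "(\<integral>\<^sup>+x. f x \<partial>distr M N g) \<le> (\<integral>\<^sup>+x. f (g x) \<partial>M)"
proof (rule nn_integral_leI_measurable)
  fix h assume [measurable]: "h \<in> borel_measurable (distr M N g)"
    and h: "\<And>x. x \<in> space (distr M N g) \<Longrightarrow> h x \<le> f x"
  have "(\<integral>\<^sup>+x. h x \<partial>distr M N g) = (\<integral>\<^sup>+x. h (g x) \<partial>M)"
    by (rule nn_integral_distr) auto
  also have "\<dots> \<le> (\<integral>\<^sup>+x. f (g x) \<partial>M)"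
    using h assms[THEN measurable_space] by (intro nn_integral_mono) auto
  finally show "(\<integral>\<^sup>+x. h x \<partial>distr M N g) \<le> (\<integral>\<^sup>+x. f (g x) \<partial>M)" .
qed

text \<open>The argument for images, applied to mixtures: a measurable minorant of \<open>f\<close>
  is integrated exactly, and the inner lower integral of \<open>f\<close>, which need not be
  measurable in \<open>x\<close>, dominates pointwise.\<close>

lemma nn_integral_bind_le:
  assumes K: "K \<in> M \<rightarrow>\<^sub>M subprob_algebra N" and "space M \<noteq> {}"
  shows "(\<integral>\<^sup>+x. f x \<partial>(M \<bind> K)) \<le> (\<integral>\<^sup>+x. \<integral>\<^sup>+y. f y \<partial>K x \<partial>M)"
proof (rule nn_integral_leI_measurable)
  have s: "sets (M \<bind> K) = sets N" using assms by (rule sets_bind_measurable)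
  fix h assume "h \<in> borel_measurable (M \<bind> K)"
    and h: "\<And>x. x \<in> space (M \<bind> K) \<Longrightarrow> h x \<le> f x"
  then have m: "h \<in> borel_measurable N" using s by (simp cong: measurable_cong_sets)
  have "(\<integral>\<^sup>+x. h x \<partial>(M \<bind> K)) = (\<integral>\<^sup>+x. \<integral>\<^sup>+y. h y \<partial>K x \<partial>M)"
    by (rule nn_integral_bind[OF m K])
  also have "\<dots> \<le> (\<integral>\<^sup>+x. \<integral>\<^sup>+y. f y \<partial>K x \<partial>M)"
  proof (intro nn_integral_mono h)
    fix x y assume "x \<in> space M" "y \<in> space (K x)"
    then show "y \<in> space (M \<bind> K)"
      using sets_eq_imp_space_eq[OF s] sets_eq_imp_space_eq[OF sets_kernel[OF K]] by auto
  qed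
  finally show "(\<integral>\<^sup>+x. h x \<partial>(M \<bind> K)) \<le> \<dots>" .
qed

lemma nn_integral_cmult_le:
  assumes "0 \<le> c"
  shows "(\<integral>\<^sup>+x. ennreal c * f x \<partial>M) \<le> ennreal c * (\<integral>\<^sup>+x. f x \<partial>M)"
proof (cases "c = 0")
  case True
  then show ?thesis by simp
next
  case False
  then have c: "c > 0" using assms by simp
  have i: "ennreal (1/c) * (ennreal c * y) = y" "ennreal c * (ennreal (1/c) * y) = y" for y
    using c by (simp_all add: mult.assoc[symmetric] ennreal_mult[symmetric])
  show ?thesis
  proof (rule nn_integral_leI_measurable)
    fix h assume [measurable]: "h \<in> borel_measurable M"
      and h: "\<And>x. x \<in> space M \<Longrightarrow> h x \<le> ennreal c * f x"
    have "(\<integral>\<^sup>+x. ennreal (1/c) * h x \<partial>M) \<le> (\<integral>\<^sup>+x. f x \<partial>M)"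
    proof (rule nn_integral_mono)
      fix x assume "x \<in> space M"
      from mult_left_mono[OF h[OF this], of "ennreal (1/c)"] show "ennreal (1/c) * h x \<le> f x"
        by (simp add: i)
    qed
    then have "ennreal (1/c) * (\<integral>\<^sup>+x. h x \<partial>M) \<le> (\<integral>\<^sup>+x. f x \<partial>M)"
      by (simp add: nn_integral_cmult)
    from mult_left_mono[OF this, of "ennreal c"] show "(\<integral>\<^sup>+x. h x \<partial>M) \<le> ennreal c * (\<integral>\<^sup>+x. f x \<partial>M)"
      by (simp add: i)
  qed
qed

text \<open>If \<open>h\<close> is a measurable minorant of \<open>f + g\<close>, then
  \<open>h - g\<close> is one of \<open>f\<close>, because \<open>g\<close> is measurable and
  finite. This form of subadditivity is the one through which the non-measurable distance is
  handled.\<close>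

lemma nn_integral_add_le:
  assumes [measurable]: "g \<in> borel_measurable M" and fin: "\<And>x. x \<in> space M \<Longrightarrow> g x \<noteq> \<top>"
  shows "(\<integral>\<^sup>+x. f x + g x \<partial>M) \<le> (\<integral>\<^sup>+x. f x \<partial>M) + (\<integral>\<^sup>+x. g x \<partial>M)"
proof (rule nn_integral_leI_measurable)
  fix h assume [measurable]: "h \<in> borel_measurable M"
    and h: "\<And>x. x \<in> space M \<Longrightarrow> h x \<le> f x + g x"
  have "(\<integral>\<^sup>+x. h x \<partial>M) \<le> (\<integral>\<^sup>+x. (h x - g x) + g x \<partial>M)"
    by (intro nn_integral_mono) (metis add.commute add_diff_inverse_ennreal diff_add_self_ennreal linear order.refl le_iff_add)
  also have "\<dots> = (\<integral>\<^sup>+x. h x - g x \<partial>M) + (\<integral>\<^sup>+x. g x \<partial>M)"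
    by (rule nn_integral_add) auto
  also have "(\<integral>\<^sup>+x. h x - g x \<partial>M) \<le> (\<integral>\<^sup>+x. f x \<partial>M)"
    using h fin by (intro nn_integral_mono) (simp add: ennreal_minus_le_iff add.commute)
  finally show "(\<integral>\<^sup>+x. h x \<partial>M) \<le> (\<integral>\<^sup>+x. f x \<partial>M) + (\<integral>\<^sup>+x. g x \<partial>M)" by simp
qed

section \<open>Cylinder sets generate the Borel sets of a separable inner product space\<close>

lemma cball_eq_halfspaces:
  fixes z :: "'b::real_inner"
  assumes D: "\<And>U. open U \<Longrightarrow> U \<noteq> {} \<Longrightarrow> \<exists>d\<in>D. d \<in> U" and "0 \<le> r"
  shows "cball z r = (\<Inter>d\<in>D. {x. d \<bullet> x \<le> d \<bullet> z + r * norm d})"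
proof (intro set_eqI iffI)
  fix x assume x: "x \<in> cball z r"
  show "x \<in> (\<Inter>d\<in>D. {x. d \<bullet> x \<le> d \<bullet> z + r * norm d})"
  proof (intro INT_I CollectI)
    fix d
    have "d \<bullet> (x - z) \<le> norm d * norm (x - z)" by (rule norm_cauchy_schwarz)
    also have "\<dots> \<le> norm d * r" using x by (intro mult_left_mono) (auto simp: dist_norm norm_minus_commute)
    finally show "d \<bullet> x \<le> d \<bullet> z + r * norm d" by (simp add: inner_diff_right mult.commute)
  qed
next
  fix x assume x: "x \<in> (\<Inter>d\<in>D. {x. d \<bullet> x \<le> d \<bullet> z + r * norm d})"
  show "x \<in> cball z r"
  proof (rule ccontr)
    assume "x \<notin> cball z r"
    then have n: "norm (x - z) > r" by (simp add: dist_norm norm_minus_commute)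
    \<comment> \<open>Outside the ball the vector \<open>x - z\<close> itself separates strictly.
      Strict separation is an open condition on the normal vector, so some member of the dense set
      satisfies it as well.\<close>
    let ?U = "{d. d \<bullet> (x - z) > r * norm d}"
    have "open ?U" by (intro open_Collect_less continuous_intros)
    moreover have "x - z \<in> ?U"
      using n assms(2) by (simp add: dot_square_norm power2_eq_square)
         (metis mult_strict_right_mono order_le_less_trans)
    ultimately obtain d where "d \<in> D" "d \<in> ?U" using D by blast
    with x show False by (auto simp: inner_diff_right)
  qed
qed

text \<open>Constraints are kept in a list: intersection becomes concatenation, and cylinder
  probabilities can be compared by adding one constraint at a time.\<close>

definition cylinder :: "('b::real_inner \<times> real set) list \<Rightarrow> 'b set" where
  "cylinder L = {x. \<forall>(h, A) \<in> set L. h \<bullet> x \<in> A}"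

definition cylinders :: "'b::real_inner set set" where
  "cylinders = cylinder ` {L. snd ` set L \<subseteq> sets borel}"

lemma cylinder_measurable:
  assumes "snd ` set L \<subseteq> sets borel"
  shows "cylinder L \<in> sets (borel :: 'b::{real_inner, second_countable_topology} measure)"
  using assms
proof (induction L)
  case Nil
  then show ?case by (simp add: cylinder_def)
next
  case (Cons p L)
  obtain h A where p: "p = (h, A)" by fastforce
  have "cylinder (p # L) = ((\<lambda>x. h \<bullet> x) -` A \<inter> space borel) \<inter> cylinder L"
    by (auto simp: cylinder_def p)
  moreover have "(\<lambda>x. h \<bullet> x) -` A \<inter> space borel \<in> sets borel"
    using Cons.prems p by (intro measurable_sets[of _ borel borel]) auto
  ultimately show ?case using Cons by auto
qed

lemma Int_stable_cylinders: "Int_stable (cylinders :: 'b::real_inner set set)"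
proof (rule Int_stableI)
  fix a b :: "'b set" assume "a \<in> cylinders" "b \<in> cylinders"
  then obtain L K where "a = cylinder L" "b = cylinder K"
    "snd ` set L \<subseteq> sets borel" "snd ` set K \<subseteq> sets borel"
    by (auto simp: cylinders_def)
  then have "a \<inter> b = cylinder (L @ K)" "snd ` set (L @ K) \<subseteq> sets borel"
    by (auto simp: cylinder_def)
  then show "a \<inter> b \<in> cylinders" by (auto simp: cylinders_def)
qed

text \<open>Half-spaces are cylinders with a single constraint, closed balls are countable
  intersections of half-spaces with normals in a countable dense set, and open sets are countable
  unions of balls with centres in that set and rational radii.\<close>

lemma sigma_sets_cylinders:
  "sets (borel :: 'b::{real_inner, second_countable_topology} measure) = sigma_sets UNIV cylinders"
proof
  let ?S = "sigma_sets UNIV (cylinders :: 'b set set)"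
  interpret S: sigma_algebra UNIV ?S by (rule sigma_algebra_sigma_sets) auto
  obtain D :: "'b set" where D: "countable D" "\<And>U. open U \<Longrightarrow> U \<noteq> {} \<Longrightarrow> \<exists>d\<in>D. d \<in> U"
    using countable_dense_exists by metis
  have half: "{x. d \<bullet> x \<le> c} \<in> ?S" for d :: 'b and c
  proof -
    have "{x. d \<bullet> x \<le> c} = cylinder [(d, {..c})]" by (auto simp: cylinder_def)
    then show ?thesis by (auto intro!: sigma_sets.Basic simp: cylinders_def)
  qed
  have ne: "D \<noteq> {}" using D(2)[of UNIV] by auto
  have cb: "cball z r \<in> ?S" if "0 \<le> r" for z r
  proof -
    have "(\<Inter>d\<in>D. {x. d \<bullet> x \<le> d \<bullet> z + r * norm d}) \<in> ?S"
      using D(1) half by (intro S.countable_INT'') auto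
    then show ?thesis using cball_eq_halfspaces[OF D(2) that, of z] by simp
  qed
  have "U \<in> ?S" if "open U" for U
  proof -
    define I where "I = {p \<in> D \<times> (\<rat> \<inter> {0..}). cball (fst p) (snd p) \<subseteq> U}"
    have "countable I"
      unfolding I_def using D(1) countable_rat by (intro countable_Collect countable_SIGMA countable_Int1) auto
    have "U = (\<Union>p\<in>I. cball (fst p) (snd p))"
    proof (intro set_eqI iffI)
      fix x assume "x \<in> U"
      then obtain s where s: "s > 0" "ball x s \<subseteq> U" using \<open>open U\<close> open_contains_ball by blast
      obtain q where q: "q \<in> \<rat>" "0 < q" "q < s / 2" using Rats_dense_in_real[of 0 "s/2"] s by auto
      obtain d where d: "d \<in> D" "d \<in> ball x q" using D(2)[of "ball x q"] q by auto
      have "cball d q \<subseteq> ball x s"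
      proof
        fix y assume "y \<in> cball d q"
        then show "y \<in> ball x s" using d q dist_triangle[of x y d] by auto
      qed
      then have "(d, q) \<in> I" using s d q by (auto simp: I_def)
      then show "x \<in> (\<Union>p\<in>I. cball (fst p) (snd p))" using d by (force simp: dist_commute)
    qed (auto simp: I_def)
    also have "\<dots> \<in> ?S" using \<open>countable I\<close> cb by (intro S.countable_UN'') (auto simp: I_def)
    finally show ?thesis .
  qed
  then have "Collect open \<subseteq> ?S" by auto
  then have "sigma_sets UNIV (Collect open) \<subseteq> ?S" by (rule S.sigma_sets_subset)
  then show "sets borel \<subseteq> ?S" by (simp add: borel_def)
  show "?S \<subseteq> sets borel"
    using sets.sigma_sets_subset[of "cylinders :: 'b set set" borel] cylinder_measurable
    by (auto simp: cylinders_def)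
qed

section \<open>Characteristic functionals determine measures\<close>

definition char_fun :: "'b::real_inner measure \<Rightarrow> 'b \<Rightarrow> complex" where
  "char_fun M h = (CLINT x|M. iexp (h \<bullet> x))"

lemma char_fun_eq_cos:
  assumes "prob_space M" and [measurable_cong]: "sets M = sets (borel :: 'b::{real_inner, second_countable_topology} measure)"
  shows "char_fun M h = complex_of_real (LINT x|M. cos (h \<bullet> x)) + \<i> * complex_of_real (LINT x|M. sin (h \<bullet> x))"
proof -
  interpret prob_space M by fact
  have i: "integrable M (\<lambda>x. cos (h \<bullet> x))" "integrable M (\<lambda>x. sin (h \<bullet> x))"
    by (auto intro!: integrable_const_bound[where B=1])
  have "char_fun M h = (CLINT x|M. complex_of_real (cos (h \<bullet> x)) + \<i> * complex_of_real (sin (h \<bullet> x)))"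
    unfolding char_fun_def by (simp add: cis_conv_exp[symmetric] complex_eq_iff cis.code Complex_eq)
  also have "\<dots> = complex_of_real (LINT x|M. cos (h \<bullet> x)) + \<i> * complex_of_real (LINT x|M. sin (h \<bullet> x))"
    using i by simp
  finally show ?thesis .
qed

lemma real_distribution_distr:
  assumes "prob_space M" "f \<in> borel_measurable M"
  shows "real_distribution (distr M borel f)"
  using prob_space.prob_space_distr[OF assms] unfolding real_distribution_def real_distribution_axioms_def by simp


text \<open>The phase \<open>c\<close> makes the family of test functions closed under
  product-to-sum formulas, and the sine is contained in it as phase \<open>- pi / 2\<close>.\<close>

lemma integral_cos_eq_if_char_fun_eq:
  fixes M1 M2 :: "'b::{real_inner, second_countable_topology} measure"
  assumes M1: "prob_space M1" "sets M1 = sets borel" and M2: "prob_space M2" "sets M2 = sets borel"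
    and eq: "\<And>h. char_fun M1 h = char_fun M2 h"
  shows "(LINT x|M1. cos (t \<bullet> x + c)) = (LINT x|M2. cos (t \<bullet> x + c))"
proof -
  have e: "(LINT x|M1. cos (t \<bullet> x)) = (LINT x|M2. cos (t \<bullet> x))"
    "(LINT x|M1. sin (t \<bullet> x)) = (LINT x|M2. sin (t \<bullet> x))"
    using eq[of t] char_fun_eq_cos[OF M1] char_fun_eq_cos[OF M2] by (simp_all add: complex_eq_iff)
  have "(LINT x|M. cos (t \<bullet> x + c)) = (LINT x|M. cos (t \<bullet> x)) * cos c - (LINT x|M. sin (t \<bullet> x)) * sin c"
    if "prob_space M" "sets M = sets borel" for M :: "'b measure"
  proof -
    interpret prob_space M by fact
    note [measurable_cong] = that(2)
    have "integrable M (\<lambda>x. cos (t \<bullet> x))" "integrable M (\<lambda>x. sin (t \<bullet> x))"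
      by (auto intro!: integrable_const_bound[where B=1])
    then show ?thesis by (simp add: cos_add)
  qed
  from this[OF M1] this[OF M2] e show ?thesis by simp
qed

text \<open>Normalised by its mean, \<open>G\<close> is a probability density, and the hypotheses
  say that the images under \<open>X\<close> of the two reweighted measures have the same
  characteristic function; Levy's uniqueness theorem on the real line applies. The lower bound
  \<open>1\<close> keeps the normalising mean away from zero.\<close>

lemma distr_density_eq:
  fixes M1 M2 :: "'b measure" and G :: "'b \<Rightarrow> real"
  assumes P1: "prob_space M1" and P2: "prob_space M2"
    and [measurable]: "G \<in> borel_measurable M1" "G \<in> borel_measurable M2"
      "X \<in> borel_measurable M1" "X \<in> borel_measurable M2" "A \<in> sets borel"
    and b: "\<And>x. 1 \<le> G x" "\<And>x. G x \<le> B"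
    and c: "\<And>s. (LINT x|M1. G x * cos (s * X x)) = (LINT x|M2. G x * cos (s * X x))"
    and s: "\<And>s. (LINT x|M1. G x * sin (s * X x)) = (LINT x|M2. G x * sin (s * X x))"
  shows "(LINT x|M1. G x * indicator A (X x)) = (LINT x|M2. G x * indicator A (X x))"
proof -
  define m where "m = (LINT x|M1. G x)"
  \<comment> \<open>At frequency zero the cosine hypothesis says that both weighted measures have
    the same total mass.\<close>
  have m2: "m = (LINT x|M2. G x)" using c[of 0] by (simp add: m_def)
  have G0: "0 \<le> G x" for x using b(1)[of x] by simp
  have bnd: "\<bar>G x\<bar> \<le> B" for x using b[of x] by auto
  have intG: "integrable M G" if "prob_space M" "G \<in> borel_measurable M" for M
  proof -
    interpret prob_space M by fact
    show ?thesis using that(2) bnd by (intro integrable_const_bound[where B=B]) auto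
  qed
  have "1 \<le> m"
  proof -
    interpret prob_space M1 by fact
    have "(LINT x|M1. 1) \<le> m" unfolding m_def using b by (intro integral_mono intG P1) auto
    then show ?thesis by (simp add: prob_space)
  qed
  define N where "N M = distr (density M (\<lambda>x. ennreal (G x / m))) borel X" for M
  have intN: "(LINT y|N M. f y) = (LINT x|M. G x * f (X x)) / m" and rd: "real_distribution (N M)"
    if P: "prob_space M" and [measurable]: "G \<in> borel_measurable M" "X \<in> borel_measurable M" 
      and mm: "m = (LINT x|M. G x)" and [measurable]: "f \<in> borel_measurable borel" for M and f :: "real \<Rightarrow> real"
  proof -
    have "(LINT y|N M. f y) = (LINT x|density M (\<lambda>x. ennreal (G x / m)). f (X x))"
      unfolding N_def by (subst integral_distr) auto
    also have "\<dots> = (LINT x|M. (G x / m) *\<^sub>R f (X x))"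
      using \<open>1 \<le> m\<close> G0 by (intro integral_density) auto
    also have "\<dots> = (LINT x|M. G x * f (X x)) / m" by simp
    finally show "(LINT y|N M. f y) = (LINT x|M. G x * f (X x)) / m" .
    have "prob_space (density M (\<lambda>x. ennreal (G x / m)))"
    proof
      have "emeasure (density M (\<lambda>x. ennreal (G x / m))) (space M) = (\<integral>\<^sup>+x. ennreal (G x / m) \<partial>M)"
        by (subst emeasure_density) (auto intro!: nn_integral_cong)
      also have "\<dots> = ennreal (LINT x|M. G x / m)"
        using \<open>1 \<le> m\<close> G0 intG[OF P] by (intro nn_integral_eq_integral) auto
      also have "\<dots> = 1" using mm \<open>1 \<le> m\<close> by simp
      finally show "emeasure (density M (\<lambda>x. ennreal (G x / m))) (space (density M (\<lambda>x. ennreal (G x / m)))) = 1" by simp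
    qed
    then show "real_distribution (N M)" unfolding N_def by (rule real_distribution_distr) simp
  qed
  have rd1: "real_distribution (N M1)" and rd2: "real_distribution (N M2)"
    by (rule rd[OF P1 assms(3,5) m_def borel_measurable_const], rule rd[OF P2 assms(4,6) m2 borel_measurable_const])
  note intN1 = intN[OF P1 assms(3,5) m_def] and intN2 = intN[OF P2 assms(4,6) m2]
  have "char (N M1) = char (N M2)"
  proof
    fix t
    have ch: "char M t = complex_of_real (LINT x|M. cos (t * x)) + \<i> * complex_of_real (LINT x|M. sin (t * x))"
      if "real_distribution M" for M
    proof -
      interpret real_distribution M by fact
      show ?thesis using char_fun_eq_cos[of M t] prob_space_axioms by (simp add: char_fun_def char_def)
    qed
    show "char (N M1) t = char (N M2) t"
      unfolding ch[OF rd1] ch[OF rd2] using c s by (simp add: intN1 intN2)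
  qed
  then have "N M1 = N M2" by (rule Levy_uniqueness[OF rd1 rd2])
  then have "(LINT y|N M1. indicator A y :: real) = (LINT y|N M2. indicator A y)" by simp
  then have "(LINT x|M1. G x * indicator A (X x)) / m = (LINT x|M2. G x * indicator A (X x)) / m"
    by (simp only: intN1[OF borel_measurable_indicator[OF assms(7)]] intN2[OF borel_measurable_indicator[OF assms(7)]])
  then show ?thesis using \<open>1 \<le> m\<close> by simp
qed

text \<open>The oscillating factor is what makes the induction on the constraints possible: testing
  the new constraint with a cosine only changes frequency and phase in the induction hypothesis,
  after which the one-dimensional uniqueness theorem replaces that cosine by an indicator.\<close>

lemma cylinder_integral_cos_eq:
  fixes M1 M2 :: "'b::{real_inner, second_countable_topology} measure"
  assumes M1: "prob_space M1" "sets M1 = sets borel" and M2: "prob_space M2" "sets M2 = sets borel"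
    and eq: "\<And>h. char_fun M1 h = char_fun M2 h" and L: "snd ` set L \<subseteq> sets borel"
  shows "(LINT x|M1. indicator (cylinder L) x * cos (t \<bullet> x + c)) = (LINT x|M2. indicator (cylinder L) x * cos (t \<bullet> x + c))"
  using L
proof (induction L arbitrary: t c)
  case Nil
  then show ?case using integral_cos_eq_if_char_fun_eq[OF M1 M2 eq] by (simp add: cylinder_def)
next
  case (Cons p L)
  obtain h A where p: "p = (h, A)" by fastforce
  note [measurable_cong] = M1(2) M2(2)
  have [measurable]: "cylinder L \<in> sets borel" "A \<in> sets borel"
    using Cons.prems p by (auto intro!: cylinder_measurable)
  have IH: "(LINT x|M1. indicator (cylinder L) x * cos (t \<bullet> x + c)) = (LINT x|M2. indicator (cylinder L) x * cos (t \<bullet> x + c))" for t c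
    using Cons by auto
  define g where "g x = indicator (cylinder L) x * cos (t \<bullet> x + c)" for x
  have [measurable]: "g \<in> borel_measurable borel" unfolding g_def by simp
  have gb: "\<bar>g x\<bar> \<le> 1" for x by (simp add: g_def indicator_def)
  have int: "integrable M (\<lambda>x. g x * f x)" "integrable M f"
    if "M = M1 \<or> M = M2" "f \<in> borel_measurable borel" "\<And>x. \<bar>f x\<bar> \<le> (1::real)" for M f
  proof -
    from that interpret prob_space M using M1 M2 by auto
    have [measurable_cong]: "sets M = sets borel" using that(1) M1 M2 by auto
    note [measurable] = that(2)
    show "integrable M (\<lambda>x. g x * f x)" "integrable M f"
      using gb that(3) by (auto intro!: integrable_const_bound[where B=1] AE_I2 mult_le_one simp: abs_mult)
  qed
  have cosint: "(LINT x|M1. cos (t \<bullet> x + c)) = (LINT x|M2. cos (t \<bullet> x + c))" for t c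
    using integral_cos_eq_if_char_fun_eq[OF M1 M2 eq] .
  have cosL: "integrable M (\<lambda>x. indicator (cylinder L) x * cos (t \<bullet> x + c))" if "M = M1 \<or> M = M2" for t c M
    by (rule int(2)[OF that]) (auto simp: indicator_def)
  \<comment> \<open>The product of two cosines is half the sum of the cosines of sum and difference;
    both summands are again of the form treated by the induction hypothesis.\<close>
  have gc: "g x * cos (s * (h \<bullet> x) + b) = (indicator (cylinder L) x * cos ((t + s *\<^sub>R h) \<bullet> x + (c + b)) +
      indicator (cylinder L) x * cos ((t - s *\<^sub>R h) \<bullet> x + (c - b))) / 2" for s x b
  proof -
    have "cos (t \<bullet> x + c) * cos (s * (h \<bullet> x) + b) = (cos ((t + s *\<^sub>R h) \<bullet> x + (c + b)) + cos ((t - s *\<^sub>R h) \<bullet> x + (c - b))) / 2"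
      unfolding cos_times_cos by (simp add: inner_add_left inner_diff_left algebra_simps)
    then show ?thesis by (auto simp: g_def indicator_def)
  qed
  have G: "(LINT x|M1. g x * cos (s * (h \<bullet> x) + b)) = (LINT x|M2. g x * cos (s * (h \<bullet> x) + b))" for s b
    unfolding gc using cosL by (simp add: IH)
  have add2: "(LINT x|M. (g x + 2) * f x) = (LINT x|M. g x * f x) + 2 * (LINT x|M. f x)"
    if "M = M1 \<or> M = M2" "f \<in> borel_measurable borel" "\<And>x. \<bar>f x\<bar> \<le> (1::real)" for M f
    using int[OF that] by (simp add: distrib_right)
  \<comment> \<open>The weight \<open>g\<close> changes sign. Adding \<open>2\<close> moves it into
    the interval from \<open>1\<close> to \<open>3\<close>, where it can serve as a density; the
    contribution of the constant is subtracted at the end.\<close>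
  have G2: "(LINT x|M1. (g x + 2) * cos (s * (h \<bullet> x) + b)) = (LINT x|M2. (g x + 2) * cos (s * (h \<bullet> x) + b))" for s b
    using G[of s b] cosint[of "s *\<^sub>R h" b] by (subst (1 2) add2) auto
  have sin_cos: "sin y = cos (y + (- pi / 2))" for y :: real by (simp add: cos_diff)
  have g1: "1 \<le> g x + 2" "g x + 2 \<le> 3" for x using gb[of x] by linarith+
  have "(LINT x|M1. (g x + 2) * indicator A (h \<bullet> x)) = (LINT x|M2. (g x + 2) * indicator A (h \<bullet> x))"
  proof (rule distr_density_eq[where B=3, OF M1(1) M2(1)])
    show "(LINT x|M1. (g x + 2) * cos (s * (h \<bullet> x))) = (LINT x|M2. (g x + 2) * cos (s * (h \<bullet> x)))" for s
      using G2[of s 0] by simp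
    show "(LINT x|M1. (g x + 2) * sin (s * (h \<bullet> x))) = (LINT x|M2. (g x + 2) * sin (s * (h \<bullet> x)))" for s
      unfolding sin_cos by (rule G2)
  qed (use g1 in auto)
  moreover have "(LINT x|M1. 1 * indicator A (h \<bullet> x)) = (LINT x|M2. 1 * indicator A (h \<bullet> x) :: real)"
  proof (rule distr_density_eq[where B=1, OF M1(1) M2(1)])
    show "(LINT x|M1. 1 * cos (s * (h \<bullet> x))) = (LINT x|M2. 1 * cos (s * (h \<bullet> x)))" for s
      using cosint[of "s *\<^sub>R h" 0] by simp
    show "(LINT x|M1. 1 * sin (s * (h \<bullet> x))) = (LINT x|M2. 1 * sin (s * (h \<bullet> x)))" for s
      unfolding sin_cos using cosint[of "s *\<^sub>R h" "- pi / 2"] by simp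
  qed auto
  ultimately have "(LINT x|M1. g x * indicator A (h \<bullet> x)) = (LINT x|M2. g x * indicator A (h \<bullet> x))"
    by (subst (asm) (1 2) add2) auto
  moreover have "indicator (cylinder (p # L)) x * cos (t \<bullet> x + c) = g x * indicator A (h \<bullet> x)" for x
    by (auto simp: cylinder_def p g_def indicator_def)
  ultimately show ?case by simp
qed

text \<open>Cylinders form an intersection-stable generator, and the cylinder identity with zero
  frequency and zero phase is equality of their probabilities. The sort also admits product types,
  as needed for the joint law of state and proposal.\<close>

theorem char_fun_uniqueness:
  fixes M1 M2 :: "'b::{real_inner, second_countable_topology} measure"
  assumes M1: "prob_space M1" "sets M1 = sets borel" and M2: "prob_space M2" "sets M2 = sets borel"
    and eq: "\<And>h. char_fun M1 h = char_fun M2 h"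
  shows "M1 = M2"
proof (rule measure_eqI_generator_eq[OF Int_stable_cylinders, where \<Omega>=UNIV and A="\<lambda>_. UNIV"])
  interpret M1: prob_space M1 by fact
  interpret M2: prob_space M2 by fact
  show "sets M1 = sigma_sets UNIV cylinders" "sets M2 = sigma_sets UNIV cylinders"
    using M1 M2 sigma_sets_cylinders by auto
  fix X :: "'b set" assume "X \<in> cylinders"
  then obtain L where L: "X = cylinder L" "snd ` set L \<subseteq> sets borel" by (auto simp: cylinders_def)
  have [measurable]: "X \<in> sets borel" using L cylinder_measurable by auto
  have "measure M1 X = measure M2 X"
    using cylinder_integral_cos_eq[OF M1 M2 eq L(2), of 0 0] L(1)
      sets_eq_imp_space_eq[OF M1(2)] sets_eq_imp_space_eq[OF M2(2)] by simp
  then show "emeasure M1 X = emeasure M2 X"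
    by (simp add: M1.emeasure_eq_measure M2.emeasure_eq_measure)
next
  show "range (\<lambda>_. UNIV) \<subseteq> (cylinders :: 'b set set)"
    by (auto simp: cylinders_def image_iff cylinder_def intro!: exI[of _ "[]"])
  fix i :: nat
  interpret M1: prob_space M1 by fact
  show "emeasure M1 UNIV \<noteq> \<infinity>" by simp
qed auto

section \<open>Gaussian measures on Hilbert space\<close>

lemma proj_coord:
  assumes "orthonormal_basis e"
  shows "e i \<bullet> proj e m x = (if i < m then e i \<bullet> x else 0)"
proof -
  have "e i \<bullet> proj e m x = (\<Sum>j<m. (e j \<bullet> x) * (if i = j then 1 else 0))"
    using assms by (simp add: proj_def inner_sum_right orthonormal_basis_def)
  also have "\<dots> = (\<Sum>j<m. if i = j then e j \<bullet> x else 0)" by (intro sum.cong) auto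
  finally show ?thesis by simp
qed

lemma proj_idem: "orthonormal_basis e \<Longrightarrow> proj e m (proj e m x) = proj e m x"
  by (simp add: proj_def[of e m "proj e m x"] proj_coord) (simp add: proj_def)

lemma linear_proj: "linear (proj e m)"
  by (rule linearI) (simp_all add: proj_def inner_add_right scaleR_add_left sum.distrib scaleR_sum_right)

lemma inner_proj_left: "proj e m x \<bullet> y = (\<Sum>i<m. (e i \<bullet> x) * (e i \<bullet> y))"
  by (simp add: proj_def inner_sum_left)

lemma inner_proj_commute: "x \<bullet> proj e m y = proj e m x \<bullet> y"
  by (subst inner_commute) (simp add: inner_proj_left mult.commute)

lemma norm_proj_square:
  assumes "orthonormal_basis e"
  shows "(norm (proj e m x))\<^sup>2 = (\<Sum>i<m. (e i \<bullet> x)\<^sup>2)"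
  unfolding power2_norm_eq_inner inner_proj_left
  by (intro sum.cong) (auto simp: proj_coord[OF assms] power2_eq_square)

lemma norm_proj_le:
  assumes "orthonormal_basis e"
  shows "norm (proj e m x) \<le> norm x"
proof -
  have "(norm (proj e m x))\<^sup>2 = proj e m x \<bullet> x"
    unfolding norm_proj_square[OF assms] inner_proj_left by (simp add: power2_eq_square)
  also have "\<dots> \<le> norm (proj e m x) * norm x" by (rule norm_cauchy_schwarz)
  finally show ?thesis by (cases "norm (proj e m x) = 0") (auto simp: power2_eq_square)
qed

lemma range_proj:
  assumes "orthonormal_basis e"
  shows "range (proj e m) = {x. proj e m x = x}"
  using proj_idem[OF assms] by (auto simp: image_iff) metis

lemma continuous_on_proj [continuous_intros]:
  "continuous_on A f \<Longrightarrow> continuous_on A (\<lambda>x. proj e m (f x))"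
  unfolding proj_def by (intro continuous_intros)

lemma proj_measurable [measurable]:
  "proj e m \<in> borel_measurable (borel :: 'a::{real_inner, second_countable_topology} measure)"
  by (intro borel_measurable_continuous_onI continuous_intros)

lemma closed_range_proj:
  assumes "orthonormal_basis e"
  shows "closed (range (proj e m))"
  unfolding range_proj[OF assms] by (intro closed_Collect_eq continuous_intros)

text \<open>Every vector in the span of the basis is eventually fixed by the projections. Since they
  do not increase the norm, convergence extends to the closure, which is the whole space.\<close>

lemma proj_tendsto:
  assumes e: "orthonormal_basis e"
  shows "(\<lambda>m. proj e m x) \<longlonglongrightarrow> x"
proof (rule LIMSEQ_I)
  fix r :: real assume "0 < r"
  have ev: "\<exists>M. \<forall>m\<ge>M. proj e m y = y" if "y \<in> span (range e)" for y
    using that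
  proof (induction rule: span_induct)
    case base
    show ?case
    proof (rule subspaceI)
      show "0 \<in> {x. \<exists>M. \<forall>m\<ge>M. proj e m x = x}" by (auto simp: proj_def)
    next
      fix x y assume "x \<in> {x. \<exists>M. \<forall>m\<ge>M. proj e m x = x}" "y \<in> {x. \<exists>M. \<forall>m\<ge>M. proj e m x = x}"
      then obtain M N where "\<forall>m\<ge>M. proj e m x = x" "\<forall>m\<ge>N. proj e m y = y" by auto
      then have "\<forall>m\<ge>max M N. proj e m (x + y) = x + y" by (simp add: linear_add[OF linear_proj])
      then show "x + y \<in> {x. \<exists>M. \<forall>m\<ge>M. proj e m x = x}" by blast
    next
      fix c :: real and x assume "x \<in> {x. \<exists>M. \<forall>m\<ge>M. proj e m x = x}"
      then show "c *\<^sub>R x \<in> {x. \<exists>M. \<forall>m\<ge>M. proj e m x = x}"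
        by (auto simp: linear_cmul[OF linear_proj])
    qed
  next
    case (step y)
    then obtain i where i: "y = e i" by auto
    have "proj e m y = y" if "m \<ge> Suc i" for m
    proof -
      have "proj e m y = (\<Sum>j<m. if j = i then e j else 0)"
        unfolding proj_def i using e by (intro sum.cong) (auto simp: orthonormal_basis_def)
      then show ?thesis using that i by simp
    qed
    then show ?case by blast
  qed
  have "x \<in> closure (span (range e))" using e by (simp add: orthonormal_basis_def)
  then obtain y where y: "y \<in> span (range e)" "dist y x < r / 2"
    using \<open>0 < r\<close> by (auto simp: closure_approachable dest!: spec[of _ "r/2"])
  then obtain M where M: "\<forall>m\<ge>M. proj e m y = y" using ev by blast
  have "norm (proj e m x - x) < r" if "m \<ge> M" for m
  proof -
    have "proj e m x - x = proj e m (x - y) + (y - x)"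
      using M that by (simp add: linear_diff[OF linear_proj])
    then have "norm (proj e m x - x) \<le> norm (proj e m (x - y)) + norm (y - x)"
      by (metis norm_triangle_ineq)
    also have "norm (proj e m (x - y)) \<le> norm (x - y)" by (rule norm_proj_le[OF e])
    finally show ?thesis using y(2) by (simp add: dist_norm norm_minus_commute)
  qed
  then show "\<exists>M. \<forall>m\<ge>M. norm (proj e m x - x) < r" by blast
qed

section \<open>Covariance form and one-dimensional marginals\<close>

lemma covariance_symmetric: "covariance_operator \<gamma> C \<Longrightarrow> C h \<bullet> k = C k \<bullet> h"
  by (simp add: covariance_operator_def mult.commute)

text \<open>The covariance is given through its pairing with vectors, so additivity in the argument
  of \<open>C\<close> has to be derived: it is read off in the second slot of the inner product and
  transferred by symmetry.\<close>

lemma covariance_quadratic: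
  assumes "covariance_operator \<gamma> C"
  shows "C (h + c *\<^sub>R k) \<bullet> (h + c *\<^sub>R k) = C h \<bullet> h + 2 * c * (C h \<bullet> k) + c\<^sup>2 * (C k \<bullet> k)"
  using covariance_symmetric[OF assms, of "h + c *\<^sub>R k" h] covariance_symmetric[OF assms, of "h + c *\<^sub>R k" k]
    covariance_symmetric[OF assms, of k h]
  by (simp add: inner_add_right power2_eq_square algebra_simps)

lemma covariance_proj:
  assumes cov: "covariance_operator \<gamma> C" and e: "orthonormal_basis e"
    and eigen: "\<And>n. C (e n) = (lam n)\<^sup>2 *\<^sub>R e n"
  shows "C (proj e m h) \<bullet> proj e m h = (\<Sum>i<m. (lam i)\<^sup>2 * (e i \<bullet> h)\<^sup>2)"
proof -
  have "C (proj e m h) \<bullet> proj e m h = (\<Sum>i<m. (e i \<bullet> h) * (C (proj e m h) \<bullet> e i))"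
    by (subst (2) proj_def) (simp add: inner_sum_right)
  also have "\<dots> = (\<Sum>i<m. (e i \<bullet> h) * (C (e i) \<bullet> proj e m h))"
    using covariance_symmetric[OF cov] by simp
  also have "\<dots> = (\<Sum>i<m. (lam i)\<^sup>2 * (e i \<bullet> h)\<^sup>2)"
    by (intro sum.cong) (auto simp: eigen proj_coord[OF e] power2_eq_square)
  finally show ?thesis .
qed

lemma normal_density_scale:
  assumes "0 < \<sigma>"
  shows "density lborel (\<lambda>t. ennreal (normal_density 0 \<sigma> t)) = distr std_normal_distribution borel (\<lambda>t. \<sigma> * t)"
proof -
  interpret prob_space std_normal_distribution
    using real_dist_normal_dist by (simp add: real_distribution_def)
  have "distributed std_normal_distribution lborel (\<lambda>x. x) (normal_density 0 1)"
    by (auto simp: distributed_def intro!: measure_eqI emeasure_distr[THEN trans])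
  from normal_density_affine[OF this _ , of \<sigma> 0] assms
  have "distributed std_normal_distribution lborel (\<lambda>x. \<sigma> * x) (normal_density 0 \<sigma>)" by simp
  then have "distr std_normal_distribution lborel (\<lambda>x. \<sigma> * x) = density lborel (normal_density 0 \<sigma>)"
    by (simp add: distributed_def)
  moreover have "distr std_normal_distribution lborel (\<lambda>x. \<sigma> * x) = distr std_normal_distribution borel (\<lambda>x. \<sigma> * x)"
    by (rule distr_cong) auto
  ultimately show ?thesis by simp
qed

lemma std_normal_second_moment: "(LINT t|std_normal_distribution. t\<^sup>2) = 1"
  using std_normal_distribution_even_moments(1)[of 1] by simp

lemma std_normal_fourth_moment: "(LINT t|std_normal_distribution. t ^ 4) = 3"
  using std_normal_distribution_even_moments(1)[of 2] by (simp add: fact_numeral)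

lemma prob_space_std_normal: "prob_space std_normal_distribution"
  using real_dist_normal_dist by (simp add: real_distribution_def)

lemma gaussian_prob:
  assumes "centred_gaussian \<gamma>"
  shows "prob_space \<gamma>" "sets \<gamma> = sets borel"
  using assms by (auto simp: centred_gaussian_def space_prob_algebra)

text \<open>The standard deviation provided by the Gaussian property is identified by the second
  moment. Writing the marginal as a scaled image of the standard normal law covers the degenerate
  case, in which the scale is zero.\<close>

lemma gaussian_marginal:
  assumes g: "centred_gaussian \<gamma>" and cov: "covariance_operator \<gamma> C"
  shows "distr \<gamma> borel (\<lambda>x. h \<bullet> x) = distr std_normal_distribution borel (\<lambda>t. sqrt (C h \<bullet> h) * t)"
    and "0 \<le> C h \<bullet> h"
proof -
  note [measurable_cong] = gaussian_prob(2)[OF g]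
  interpret N: prob_space std_normal_distribution by (rule prob_space_std_normal)
  obtain \<sigma> where \<sigma>: "\<sigma> \<ge> 0" and d: "distr \<gamma> borel (\<lambda>x. h \<bullet> x) =
        (if \<sigma> = 0 then return borel 0
         else density lborel (\<lambda>t. ennreal (normal_density 0 \<sigma> t)))"
    using g by (auto simp: centred_gaussian_def)
  have eq: "distr \<gamma> borel (\<lambda>x. h \<bullet> x) = distr std_normal_distribution borel (\<lambda>t. \<sigma> * t)"
  proof (cases "\<sigma> = 0")
    case True
    then show ?thesis unfolding d by (auto intro!: measure_eqI simp: emeasure_distr N.emeasure_space_1 indicator_def)
  next
    case False
    then show ?thesis unfolding d using normal_density_scale[of \<sigma>] \<sigma> by simp
  qed
  have "C h \<bullet> h = (LINT x|\<gamma>. (h \<bullet> x)\<^sup>2)" using cov by (simp add: covariance_operator_def power2_eq_square)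
  also have "\<dots> = (LINT y|distr \<gamma> borel (\<lambda>x. h \<bullet> x). y\<^sup>2)" by (subst integral_distr) auto
  also have "\<dots> = (LINT t|std_normal_distribution. \<sigma>\<^sup>2 * t\<^sup>2)"
    unfolding eq by (subst integral_distr) (auto simp: power_mult_distrib)
  also have "\<dots> = \<sigma>\<^sup>2" by (simp only: integral_mult_right_zero std_normal_second_moment mult_1_right)
  finally have "C h \<bullet> h = \<sigma>\<^sup>2" .
  then show "distr \<gamma> borel (\<lambda>x. h \<bullet> x) = distr std_normal_distribution borel (\<lambda>t. sqrt (C h \<bullet> h) * t)"
    and "0 \<le> C h \<bullet> h"
    using eq \<sigma> by simp_all
qed

lemma char_fun_gaussian:
  assumes g: "centred_gaussian \<gamma>" and cov: "covariance_operator \<gamma> C"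
  shows "char_fun \<gamma> h = complex_of_real (exp (- (C h \<bullet> h) / 2))"
proof -
  note [measurable_cong] = gaussian_prob(2)[OF g]
  have "char_fun \<gamma> h = (CLINT y|distr \<gamma> borel (\<lambda>x. h \<bullet> x). iexp y)"
    unfolding char_fun_def by (subst integral_distr) auto
  also have "\<dots> = char std_normal_distribution (sqrt (C h \<bullet> h))"
    unfolding gaussian_marginal(1)[OF g cov] char_def by (subst integral_distr) auto
  also have "\<dots> = complex_of_real (exp (- (C h \<bullet> h) / 2))"
    using gaussian_marginal(2)[OF g cov] by (simp add: char_std_normal_distribution)
  finally show ?thesis .
qed

section \<open>Law of the truncated series\<close>

lemma sets_proj_space:
  assumes "orthonormal_basis e"
  shows "A \<in> sets (proj_space e m) \<longleftrightarrow> A \<in> sets borel \<and> A \<subseteq> range (proj e m)"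
  unfolding proj_space_def
  by (subst sets_restrict_space_iff) (use closed_range_proj[OF assms] in \<open>auto intro!: borel_closed\<close>)

lemma proj_measurable_proj_space [measurable]: "proj e m \<in> borel \<rightarrow>\<^sub>M proj_space e m"
  unfolding proj_space_def by (intro measurable_restrict_space2) auto

text \<open>The characteristic functional of the series factors over the independent coordinates;
  that of the image is the functional of \<open>\<gamma>\<close> at the projected argument, since
  the projection is self-adjoint. Both equal the exponential of minus half the truncated covariance
  form.\<close>

lemma gaussian_proj_eq_distr:
  assumes g: "centred_gaussian \<gamma>" and cov: "covariance_operator \<gamma> C" and e: "orthonormal_basis e"
    and eigen: "\<And>n. C (e n) = (lam n)\<^sup>2 *\<^sub>R e n"
  shows "gaussian_proj lam e m = distr \<gamma> (proj_space e m) (proj e m)"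
proof -
  note [measurable_cong] = gaussian_prob(2)[OF g]
  interpret N: prob_space std_normal_distribution by (rule prob_space_std_normal)
  interpret G: prob_space \<gamma> by (rule gaussian_prob(1)[OF g])
  interpret P: product_sigma_finite "\<lambda>_::nat. std_normal_distribution" ..
  let ?P = "\<Pi>\<^sub>M i\<in>{..<m}. std_normal_distribution"
  interpret P': prob_space ?P by (rule prob_space_PiM) unfold_locales
  let ?s = "\<lambda>\<xi>. \<Sum>i<m. (lam i * \<xi> i) *\<^sub>R e i"
  have s_range: "?s \<xi> \<in> range (proj e m)" for \<xi>
  proof -
    have "proj e m (?s \<xi>) = (\<Sum>i<m. (lam i * \<xi> i) *\<^sub>R e i)"
      unfolding proj_def inner_sum_right using e
      by (intro sum.cong) (auto simp: orthonormal_basis_def if_distrib[of "(*) _"] cong: if_cong)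
    then show ?thesis unfolding range_proj[OF e] by simp
  qed
  have [measurable]: "?s \<in> ?P \<rightarrow>\<^sub>M borel" by measurable
  have [measurable]: "?s \<in> ?P \<rightarrow>\<^sub>M proj_space e m"
    unfolding proj_space_def using s_range by (intro measurable_restrict_space2) auto
  have eq: "distr ?P borel ?s = distr \<gamma> borel (proj e m)"
  proof (rule char_fun_uniqueness)
    show "prob_space (distr ?P borel ?s)" by (rule P'.prob_space_distr) simp
    show "prob_space (distr \<gamma> borel (proj e m))" by (rule G.prob_space_distr) simp
    fix h :: 'a
    have "char_fun (distr ?P borel ?s) h = (CLINT \<xi>|?P. iexp (h \<bullet> ?s \<xi>))"
      unfolding char_fun_def by (subst integral_distr) auto
    also have "\<dots> = (CLINT \<xi>|?P. (\<Prod>i<m. iexp (lam i * (h \<bullet> e i) * \<xi> i)))"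
      by (simp add: inner_sum_right exp_sum[symmetric] sum_distrib_left mult_ac)
    also have "\<dots> = (\<Prod>i<m. char std_normal_distribution (lam i * (h \<bullet> e i)))"
      unfolding char_def by (subst P.product_integral_prod) (auto intro!: N.integrable_iexp)
    also have "\<dots> = (\<Prod>i<m. complex_of_real (exp (- ((lam i)\<^sup>2 * (e i \<bullet> h)\<^sup>2) / 2)))"
      by (intro prod.cong) (simp_all add: char_std_normal_distribution power_mult_distrib inner_commute)
    also have "\<dots> = complex_of_real (exp (- (C (proj e m h) \<bullet> proj e m h) / 2))"
      unfolding covariance_proj[OF cov e eigen] of_real_prod[symmetric]
      by (simp add: exp_sum[symmetric] sum_negf sum_divide_distrib)
    also have "\<dots> = char_fun \<gamma> (proj e m h)" by (rule char_fun_gaussian[OF g cov, symmetric])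
    also have "\<dots> = char_fun (distr \<gamma> borel (proj e m)) h"
      unfolding char_fun_def by (subst integral_distr) (auto simp: inner_proj_commute)
    finally show "char_fun (distr ?P borel ?s) h = char_fun (distr \<gamma> borel (proj e m)) h" .
  qed auto
  \<comment> \<open>Equality has been shown on the Borel sets of the whole space. It restricts to
    \<open>proj_space e m\<close>, whose measurable sets are Borel because the range is
    closed.\<close>
  show ?thesis
  proof (rule measure_eqI)
    fix A assume "A \<in> sets (gaussian_proj lam e m)"
    then have A: "A \<in> sets (proj_space e m)" by (simp add: gaussian_proj_def)
    then have [measurable]: "A \<in> sets borel" using sets_proj_space[OF e] by auto
    have "emeasure (gaussian_proj lam e m) A = emeasure (distr ?P borel ?s) A"
      unfolding gaussian_proj_def using A by (simp add: emeasure_distr)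
    also have "\<dots> = emeasure (distr \<gamma> (proj_space e m) (proj e m)) A"
      unfolding eq using A by (simp add: emeasure_distr)
    finally show "emeasure (gaussian_proj lam e m) A = emeasure (distr \<gamma> (proj_space e m) (proj e m)) A" .
  qed (simp add: gaussian_proj_def)
qed


section \<open>Trace bound and Gaussian exponential moments\<close>

lemma integral_std_normal_exp_square:
  "(\<integral>\<^sup>+t. ennreal (exp (t\<^sup>2 / 4)) \<partial>std_normal_distribution) = ennreal (sqrt 2)"
proof -
  \<comment> \<open>Tilting by \<open>exp (t\<^sup>2 / 4)\<close> halves the exponent, which turns
    the standard normal density into that of variance \<open>2\<close>, up to the factor
    \<open>sqrt 2\<close>.\<close>
  have eq: "std_normal_density t * exp (t\<^sup>2 / 4) = sqrt 2 * normal_density 0 (sqrt 2) t" for t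
    by (simp add: normal_density_def real_sqrt_mult exp_add[symmetric] field_simps)
  interpret prob_space "density lborel (normal_density 0 (sqrt 2))"
    by (rule prob_space_normal_density) simp
  have one: "(\<integral>\<^sup>+t. ennreal (normal_density 0 (sqrt 2) t) \<partial>lborel) = 1"
    using emeasure_space_1 by (simp add: emeasure_density)
  have "(\<integral>\<^sup>+t. ennreal (exp (t\<^sup>2 / 4)) \<partial>std_normal_distribution)
      = (\<integral>\<^sup>+t. ennreal (sqrt 2) * ennreal (normal_density 0 (sqrt 2) t) \<partial>lborel)"
    by (subst nn_integral_density) (auto simp: ennreal_mult[symmetric] eq)
  also have "\<dots> = ennreal (sqrt 2)" by (subst nn_integral_cmult) (auto simp: one)
  finally show ?thesis .
qed

text \<open>Cauchy-Schwarz with weights for which each quotient \<open>(y i) ^ 4 / w i\<close> has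
  mean at most \<open>3 * w i\<close> when \<open>y i\<close> is centred Gaussian with variance at
  most \<open>w i\<close>.\<close>

lemma sum_square_le_weighted:
  fixes y w :: "nat \<Rightarrow> real"
  assumes "\<And>i. 0 < w i"
  shows "(\<Sum>i<n. (y i)\<^sup>2)\<^sup>2 \<le> (\<Sum>i<n. w i) * (\<Sum>i<n. (y i) ^ 4 / w i)"
proof -
  have "(\<Sum>i<n. (y i)\<^sup>2)\<^sup>2 = (\<Sum>i<n. sqrt (w i) * ((y i)\<^sup>2 / sqrt (w i)))\<^sup>2"
    using assms by (simp add: less_imp_neq[symmetric])
  also have "\<dots> \<le> (\<Sum>i<n. (sqrt (w i))\<^sup>2) * (\<Sum>i<n. ((y i)\<^sup>2 / sqrt (w i))\<^sup>2)"
    by (rule Cauchy_Schwarz_ineq_sum)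
  also have "\<dots> = (\<Sum>i<n. w i) * (\<Sum>i<n. (y i) ^ 4 / w i)"
    using assms by (simp add: power_divide less_imp_le power_mult[symmetric])
  finally show ?thesis .
qed

text \<open>
  Adding \<open>2\<^sup>-\<^sup>i\<close> to the eigenvalues avoids a case distinction for degenerate directions.
\<close>

lemma gaussian_trace_bounded:
  assumes g: "centred_gaussian \<gamma>" and cov: "covariance_operator \<gamma> C" and e: "orthonormal_basis e"
    and eigen: "\<And>n. C (e n) = (lam n)\<^sup>2 *\<^sub>R e n"
  shows "\<exists>L>0. \<forall>n. (\<Sum>i<n. (lam i)\<^sup>2 + (1 / 2) ^ i) \<le> L"
proof -
  note [measurable_cong] = gaussian_prob(2)[OF g]
  interpret prob_space \<gamma> by (rule gaussian_prob(1)[OF g])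
  interpret N: prob_space std_normal_distribution by (rule prob_space_std_normal)
  define w where "w i = (lam i)\<^sup>2 + (1 / 2) ^ i" for i
  have w0: "0 < w i" for i by (simp add: w_def add_nonneg_pos)
  have lw: "(lam i)\<^sup>2 \<le> w i" for i by (simp add: w_def)
  have ei: "C (e i) \<bullet> e i = (lam i)\<^sup>2" for i using e by (simp add: eigen orthonormal_basis_def)
  have marg: "distr \<gamma> borel (\<lambda>x. e i \<bullet> x) = distr std_normal_distribution borel (\<lambda>t. \<bar>lam i\<bar> * t)" for i
    using gaussian_marginal(1)[OF g cov, of "e i"] by (simp add: ei)
  have mom: "integrable \<gamma> (\<lambda>x. (e i \<bullet> x) ^ (2 * k))"
      "(LINT x|\<gamma>. (e i \<bullet> x) ^ (2 * k)) = (lam i) ^ (2 * k) * (LINT t|std_normal_distribution. t ^ (2 * k))" for i k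
  proof -
    have "integrable (distr std_normal_distribution borel (\<lambda>t. \<bar>lam i\<bar> * t)) (\<lambda>y. y ^ (2 * k))"
      using std_normal_distribution_even_moments(2)[of k]
      by (subst integrable_distr_eq) (auto simp: power_mult_distrib)
    then show "integrable \<gamma> (\<lambda>x. (e i \<bullet> x) ^ (2 * k))"
      unfolding marg[symmetric] by (subst (asm) integrable_distr_eq) auto
    have "(LINT x|\<gamma>. (e i \<bullet> x) ^ (2 * k)) = (LINT y|distr \<gamma> borel (\<lambda>x. e i \<bullet> x). y ^ (2 * k))"
      by (subst integral_distr) auto
    also have "\<dots> = (lam i) ^ (2 * k) * (LINT t|std_normal_distribution. t ^ (2 * k))"
      unfolding marg by (subst integral_distr) (auto simp: power_mult_distrib power_even_abs)
    finally show "(LINT x|\<gamma>. (e i \<bullet> x) ^ (2 * k)) = \<dots>" .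
  qed
  have m2: "integrable \<gamma> (\<lambda>x. (e i \<bullet> x)\<^sup>2)" "(LINT x|\<gamma>. (e i \<bullet> x)\<^sup>2) = (lam i)\<^sup>2" for i
    using mom[of i 1] std_normal_second_moment by simp_all
  have m4: "integrable \<gamma> (\<lambda>x. (e i \<bullet> x) ^ 4)" "(LINT x|\<gamma>. (e i \<bullet> x) ^ 4) = 3 * (lam i) ^ 4" for i
    using mom[of i 2] std_normal_fourth_moment by simp_all
  \<comment> \<open>The norm is finite at every point, so its tail probabilities vanish. That the
    measure lives on the Hilbert space itself is what forces the trace to be finite; the marginals
    alone would not.\<close>
  have "(\<lambda>k. prob {x \<in> space \<gamma>. real k < (norm x)\<^sup>2}) \<longlonglongrightarrow> prob (\<Inter>k. {x \<in> space \<gamma>. real k < (norm x)\<^sup>2})"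
    by (intro finite_Lim_measure_decseq) (auto simp: decseq_def)
  also have "(\<Inter>k. {x \<in> space \<gamma>. real k < (norm x)\<^sup>2}) = {}"
    by auto (meson reals_Archimedean2 less_asym)
  finally have lim: "(\<lambda>k. prob {x \<in> space \<gamma>. real k < (norm x)\<^sup>2}) \<longlonglongrightarrow> 0" by simp
  obtain k where k: "prob {x \<in> space \<gamma>. real k < (norm x)\<^sup>2} < 1 / 12"
    using order_tendstoD(2)[OF lim, of "1 / 12"] by (auto simp: eventually_sequentially)
  have "(\<Sum>i<n. w i) \<le> 2 * real k + 4" for n
  proof (cases "n = 0")
    case False
    define W where "W = (\<Sum>i<n. w i)"
    have W: "0 < W" unfolding W_def using False w0 by (intro sum_pos) auto
    let ?S = "\<lambda>x. \<Sum>i<n. (e i \<bullet> x)\<^sup>2"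
    let ?A = "{x \<in> space \<gamma>. real k < (norm x)\<^sup>2}"
    \<comment> \<open>On the tail event, AM-GM and the weighted Cauchy-Schwarz inequality bound the
      sum; off it, Bessel's inequality does. In expectation the second and the third term contribute
      at most \<open>W / 4\<close> each, by the fourth moment \<open>3 * (lam i) ^ 4\<close> and by
      the tail probability \<open>1 / 12\<close>, so that \<open>W / 2\<close> can be absorbed on
      the left-hand side.\<close>
    have pt: "?S x \<le> real k + (\<Sum>i<n. (e i \<bullet> x) ^ 4 / w i) / 12 + 3 * W * indicator ?A x"
      if "x \<in> space \<gamma>" for x
    proof (cases "x \<in> ?A")
      case True
      have "12 * W * ?S x \<le> (?S x)\<^sup>2 + 36 * W\<^sup>2"
        using zero_le_power2[of "?S x - 6 * W"] by (simp add: power2_diff algebra_simps)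
      also have "\<dots> \<le> W * (\<Sum>i<n. (e i \<bullet> x) ^ 4 / w i) + 36 * W\<^sup>2"
        unfolding W_def using sum_square_le_weighted[of w "\<lambda>i. e i \<bullet> x" n] w0 by simp
      finally have "W * (12 * ?S x) \<le> W * ((\<Sum>i<n. (e i \<bullet> x) ^ 4 / w i) + 36 * W)"
        by (simp add: power2_eq_square algebra_simps)
      then have "12 * ?S x \<le> (\<Sum>i<n. (e i \<bullet> x) ^ 4 / w i) + 36 * W" using W by simp
      then show ?thesis using True by simp
    next
      case False
      have "?S x = (norm (proj e n x))\<^sup>2" by (simp add: norm_proj_square[OF e])
      also have "\<dots> \<le> (norm x)\<^sup>2" using norm_proj_le[OF e] by (intro power_mono) auto
      finally have "?S x \<le> real k" using False that by auto
      moreover have "0 \<le> (\<Sum>i<n. (e i \<bullet> x) ^ 4 / w i)" using w0 by (intro sum_nonneg) (simp add: less_imp_le)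
      ultimately show ?thesis using False by simp
    qed
    define F where "F x = (\<Sum>i<n. (e i \<bullet> x) ^ 4 / w i)" for x
    have iF: "integrable \<gamma> F" "(LINT x|\<gamma>. F x) = (\<Sum>i<n. 3 * (lam i) ^ 4 / w i)"
      unfolding F_def[abs_def] by (auto intro!: Bochner_Integration.integrable_sum integrable_divide_zero m4 simp: integral_sum m4)
    have iA: "integrable \<gamma> (indicator ?A :: _ \<Rightarrow> real)" by (auto intro!: integrable_real_indicator simp: less_top[symmetric])
    have "(\<Sum>i<n. (lam i)\<^sup>2) = (LINT x|\<gamma>. ?S x)" using m2 by simp
    also have "\<dots> \<le> (LINT x|\<gamma>. real k + F x / 12 + 3 * W * indicator ?A x)"
      by (rule integral_mono[OF _ _ pt[folded F_def]]) (use m2 iF(1) iA in auto)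
    also have "\<dots> = real k + (\<Sum>i<n. 3 * (lam i) ^ 4 / w i) / 12 + 3 * W * prob ?A"
      using iF iA by (simp add: prob_space)
    also have "(\<Sum>i<n. 3 * (lam i) ^ 4 / w i) \<le> (\<Sum>i<n. 3 * w i)"
    proof (intro sum_mono)
      fix i
      have "(lam i) ^ 4 = (lam i)\<^sup>2 * (lam i)\<^sup>2" by (simp add: power_numeral_reduce power2_eq_square)
      also have "\<dots> \<le> w i * w i" using lw w0 by (intro mult_mono) (auto simp: less_imp_le)
      finally show "3 * (lam i) ^ 4 / w i \<le> 3 * w i" using w0[of i] by (simp add: divide_simps)
    qed
    also have "(\<Sum>i<n. 3 * w i) = 3 * W" by (simp add: W_def sum_distrib_left)
    also have "3 * W * prob ?A \<le> 3 * W * (1 / 12)" using k W by (intro mult_left_mono) auto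
    finally have "(\<Sum>i<n. (lam i)\<^sup>2) \<le> real k + W / 2" by simp
    moreover have "W \<le> (\<Sum>i<n. (lam i)\<^sup>2) + 2"
    proof -
      have "(\<Sum>i<n. (1 / 2 :: real) ^ i) \<le> 2" using False
        by (subst sum_gp_strict) (auto simp: field_simps)
      then show ?thesis by (simp add: W_def w_def sum.distrib)
    qed
    ultimately show ?thesis by (simp add: W_def)
  qed simp
  then show ?thesis unfolding w_def by (intro exI[of _ "2 * real k + 4"]) auto
qed

text \<open>The numbers \<open>w i / W\<close> are convex weights, so Jensen's inequality for
  \<open>exp\<close> reduces the squared norm of a projection to single coordinates, where the
  integral is at most \<open>sqrt 2\<close>. Fatou's lemma removes the projection, and
  \<open>v * norm x \<le> v\<^sup>2 * L + (norm x)\<^sup>2 / (4 * L)\<close> passes from the square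
  to a linear exponent.\<close>

lemma gaussian_exp_moment:
  assumes g: "centred_gaussian \<gamma>" and cov: "covariance_operator \<gamma> C" and e: "orthonormal_basis e"
    and eigen: "\<And>n. C (e n) = (lam n)\<^sup>2 *\<^sub>R e n"
  shows "\<exists>L>0. \<forall>v. (\<integral>\<^sup>+x. ennreal (exp (v * norm x)) \<partial>\<gamma>) \<le> ennreal (2 * exp (v\<^sup>2 * L))"
proof -
  note [measurable_cong] = gaussian_prob(2)[OF g]
  interpret prob_space \<gamma> by (rule gaussian_prob(1)[OF g])
  define w where "w i = (lam i)\<^sup>2 + (1 / 2) ^ i" for i
  have w0: "0 < w i" for i by (simp add: w_def add_nonneg_pos)
  obtain L where L: "L > 0" "\<And>n. (\<Sum>i<n. w i) \<le> L"
    using gaussian_trace_bounded[OF g cov e eigen] unfolding w_def by auto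
  have ei: "C (e i) \<bullet> e i = (lam i)\<^sup>2" for i using e by (simp add: eigen orthonormal_basis_def)
  have one: "(\<integral>\<^sup>+x. ennreal (exp ((e i \<bullet> x)\<^sup>2 / (4 * w i))) \<partial>\<gamma>) \<le> ennreal (sqrt 2)" for i
  proof -
    have "(\<integral>\<^sup>+x. ennreal (exp ((e i \<bullet> x)\<^sup>2 / (4 * w i))) \<partial>\<gamma>)
        = (\<integral>\<^sup>+y. ennreal (exp (y\<^sup>2 / (4 * w i))) \<partial>distr \<gamma> borel (\<lambda>x. e i \<bullet> x))"
      by (subst nn_integral_distr) auto
    also have "\<dots> = (\<integral>\<^sup>+t. ennreal (exp ((\<bar>lam i\<bar> * t)\<^sup>2 / (4 * w i))) \<partial>std_normal_distribution)"
      using gaussian_marginal(1)[OF g cov, of "e i"]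
      by (simp add: ei nn_integral_distr)
    also have "\<dots> \<le> (\<integral>\<^sup>+t. ennreal (exp (t\<^sup>2 / 4)) \<partial>std_normal_distribution)"
    proof (intro nn_integral_mono ennreal_leI, unfold exp_le_cancel_iff)
      fix t :: real
      have "(lam i)\<^sup>2 * t\<^sup>2 \<le> w i * t\<^sup>2" by (intro mult_right_mono) (auto simp: w_def)
      then show "(\<bar>lam i\<bar> * t)\<^sup>2 / (4 * w i) \<le> t\<^sup>2 / 4"
        using w0[of i] by (simp add: power_mult_distrib divide_simps) (simp add: algebra_simps)
    qed
    finally show ?thesis unfolding integral_std_normal_exp_square .
  qed
  have fin: "(\<integral>\<^sup>+x. ennreal (exp ((norm (proj e n x))\<^sup>2 / (4 * L))) \<partial>\<gamma>) \<le> ennreal 2" if "n > 0" for n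
  proof -
    define W where "W = (\<Sum>i<n. w i)"
    have W: "0 < W" "W \<le> L" unfolding W_def using that w0 L by (auto intro!: sum_pos)
    have pt: "exp ((norm (proj e n x))\<^sup>2 / (4 * L)) \<le> (\<Sum>i<n. (w i / W) * exp ((e i \<bullet> x)\<^sup>2 / (4 * w i)))" for x
    proof -
      have "(norm (proj e n x))\<^sup>2 / (4 * L) \<le> (norm (proj e n x))\<^sup>2 / (4 * W)"
        using W by (intro divide_left_mono) auto
      also have "\<dots> = (\<Sum>i<n. (w i / W) *\<^sub>R ((e i \<bullet> x)\<^sup>2 / (4 * w i)))"
        unfolding norm_proj_square[OF e] sum_divide_distrib using w0
        by (intro sum.cong) (auto simp: less_imp_neq[symmetric])
      finally have "exp ((norm (proj e n x))\<^sup>2 / (4 * L)) \<le> exp (\<Sum>i<n. (w i / W) *\<^sub>R ((e i \<bullet> x)\<^sup>2 / (4 * w i)))"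
        by simp
      also have "\<dots> \<le> (\<Sum>i<n. (w i / W) * exp ((e i \<bullet> x)\<^sup>2 / (4 * w i)))"
        using that W w0 by (intro convex_on_sum[OF _ _ exp_convex])
          (auto simp: W_def sum_divide_distrib[symmetric] less_imp_le)
      finally show ?thesis .
    qed
    have "(\<integral>\<^sup>+x. ennreal (exp ((norm (proj e n x))\<^sup>2 / (4 * L))) \<partial>\<gamma>)
        \<le> (\<integral>\<^sup>+x. (\<Sum>i<n. ennreal (w i / W) * ennreal (exp ((e i \<bullet> x)\<^sup>2 / (4 * w i)))) \<partial>\<gamma>)"
      using pt W w0 by (intro nn_integral_mono)
        (auto simp: ennreal_mult[symmetric] less_imp_le sum_ennreal intro!: ennreal_leI)
    also have "\<dots> = (\<Sum>i<n. ennreal (w i / W) * (\<integral>\<^sup>+x. ennreal (exp ((e i \<bullet> x)\<^sup>2 / (4 * w i))) \<partial>\<gamma>))"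
      by (subst nn_integral_sum) (auto simp: nn_integral_cmult)
    also have "\<dots> \<le> (\<Sum>i<n. ennreal (w i / W) * ennreal (sqrt 2))"
      using one by (intro sum_mono mult_left_mono) auto
    also have "\<dots> = ennreal (\<Sum>i<n. w i / W * sqrt 2)"
      using W w0 by (subst sum_ennreal[symmetric]) (auto simp: ennreal_mult[symmetric] less_imp_le)
    also have "(\<Sum>i<n. w i / W * sqrt 2) = sqrt 2"
      using W by (simp add: sum_distrib_right[symmetric] sum_divide_distrib[symmetric] W_def[symmetric])
    also have "ennreal (sqrt 2) \<le> ennreal 2" by (intro ennreal_leI real_le_lsqrt) auto
    finally show ?thesis .
  qed
  have sq: "(\<integral>\<^sup>+x. ennreal (exp ((norm x)\<^sup>2 / (4 * L))) \<partial>\<gamma>) \<le> ennreal 2"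
  proof -
    \<comment> \<open>Shifted by one, because convex weights need at least one coordinate.\<close>
    have "(\<lambda>n. ennreal (exp ((norm (proj e (Suc n) x))\<^sup>2 / (4 * L)))) \<longlonglongrightarrow> ennreal (exp ((norm x)\<^sup>2 / (4 * L)))" for x
      using L(1) by (intro tendsto_intros LIMSEQ_Suc proj_tendsto[OF e]) auto
    then have "(\<integral>\<^sup>+x. ennreal (exp ((norm x)\<^sup>2 / (4 * L))) \<partial>\<gamma>)
        = (\<integral>\<^sup>+x. liminf (\<lambda>n. ennreal (exp ((norm (proj e (Suc n) x))\<^sup>2 / (4 * L)))) \<partial>\<gamma>)"
      by (intro nn_integral_cong lim_imp_Liminf[symmetric]) auto
    also have "\<dots> \<le> liminf (\<lambda>n. \<integral>\<^sup>+x. ennreal (exp ((norm (proj e (Suc n) x))\<^sup>2 / (4 * L))) \<partial>\<gamma>)"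
      by (rule nn_integral_liminf) auto
    also have "\<dots> \<le> liminf (\<lambda>n. ennreal 2)"
      using fin by (intro Liminf_mono always_eventually) auto
    also have "\<dots> = ennreal 2" by (simp add: Liminf_const)
    finally show ?thesis .
  qed
  show ?thesis
  proof (intro exI[of _ L] conjI allI L(1))
    fix v :: real
    have pt: "exp (v * norm x) \<le> exp (v\<^sup>2 * L) * exp ((norm x)\<^sup>2 / (4 * L))" for x :: 'a
    proof -
      have "0 \<le> (norm x - 2 * L * v)\<^sup>2 / (4 * L)" using L(1) by simp
      also have "\<dots> = v\<^sup>2 * L + (norm x)\<^sup>2 / (4 * L) - v * norm x"
        using L(1) by (simp add: power2_eq_square field_simps)
      finally show ?thesis by (simp add: exp_add[symmetric])
    qed
    have "(\<integral>\<^sup>+x. ennreal (exp (v * norm x)) \<partial>\<gamma>) \<le> (\<integral>\<^sup>+x. ennreal (exp (v\<^sup>2 * L)) * ennreal (exp ((norm x)\<^sup>2 / (4 * L))) \<partial>\<gamma>)"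
      using pt by (intro nn_integral_mono) (auto simp: ennreal_mult[symmetric] intro!: ennreal_leI)
    also have "\<dots> = ennreal (exp (v\<^sup>2 * L)) * (\<integral>\<^sup>+x. ennreal (exp ((norm x)\<^sup>2 / (4 * L))) \<partial>\<gamma>)"
      by (rule nn_integral_cmult) simp
    also have "\<dots> \<le> ennreal (exp (v\<^sup>2 * L)) * ennreal 2" using sq by (intro mult_left_mono) auto
    also have "\<dots> = ennreal (2 * exp (v\<^sup>2 * L))" by (subst ennreal_mult[symmetric]) (auto simp: mult.commute)
    finally show "(\<integral>\<^sup>+x. ennreal (exp (v * norm x)) \<partial>\<gamma>) \<le> ennreal (2 * exp (v\<^sup>2 * L))" .
  qed
qed

section \<open>The path distance\<close>

definition path_cost :: "real \<Rightarrow> real \<Rightarrow> (real \<Rightarrow> 'a::real_normed_vector) \<Rightarrow> real" where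
  "path_cost \<eta> T \<psi> = integral {0..T} (\<lambda>t. exp (\<eta> * norm (\<psi> t)))"

lemma path_dist_alt:
  "path_dist \<eta> \<epsilon> x y = min 1 (INF (T, \<psi>) \<in> {(T, \<psi>). 0 \<le> T \<and> \<psi> \<in> path_space T x y}. 1 / \<epsilon> * path_cost \<eta> T \<psi>)"
  by (simp add: path_dist_def path_cost_def)

lemma path_space_continuous:
  assumes "\<psi> \<in> path_space T x y"
  shows "continuous_on {0..T} \<psi>"
  using assms unfolding path_space_def
  by (auto simp: continuous_on_eq_continuous_within intro: has_vector_derivative_continuous)

lemma path_space_lipschitz:
  assumes "\<psi> \<in> path_space T x y" "s \<in> {0..T}" "t \<in> {0..T}"
  shows "norm (\<psi> s - \<psi> t) \<le> \<bar>s - t\<bar>"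
proof -
  obtain \<psi>' where d: "\<And>t. t \<in> {0..T} \<Longrightarrow> (\<psi> has_vector_derivative \<psi>' t) (at t within {0..T})" "\<And>t. t \<in> {0..T} \<Longrightarrow> norm (\<psi>' t) = 1"
    using assms(1) unfolding path_space_def by blast
  have "norm (\<psi> s - \<psi> t) \<le> 1 * norm (s - t)"
  proof (rule differentiable_bound[of "{0..T}" \<psi> "\<lambda>t h. h *\<^sub>R \<psi>' t"])
    show "(\<psi> has_derivative (\<lambda>h. h *\<^sub>R \<psi>' t)) (at t within {0..T})" if "t \<in> {0..T}" for t
      using d(1)[OF that] by (simp add: has_vector_derivative_def)
    show "onorm (\<lambda>h. h *\<^sub>R \<psi>' t) \<le> 1" if "t \<in> {0..T}" for t
      using d(2)[OF that] by (intro onorm_le) simp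
  qed (use assms in auto)
  then show ?thesis by simp
qed

lemma path_cost_integrable:
  assumes "\<psi> \<in> path_space T x y"
  shows "(\<lambda>t. exp (\<eta> * norm (\<psi> t))) integrable_on {0..T}"
  by (intro integrable_continuous_interval continuous_intros path_space_continuous[OF assms])

lemma path_cost_ge_const:
  assumes "\<psi> \<in> path_space T x y" "0 \<le> T" "\<And>t. t \<in> {0..T} \<Longrightarrow> c \<le> exp (\<eta> * norm (\<psi> t))"
  shows "T * c \<le> path_cost \<eta> T \<psi>"
proof -
  have "integral {0..T} (\<lambda>t. c) \<le> path_cost \<eta> T \<psi>"
    unfolding path_cost_def using assms(3) by (intro integral_le path_cost_integrable[OF assms(1)]) auto
  then show ?thesis using assms(2) by simp
qed

lemma path_cost_ge:
  assumes "\<psi> \<in> path_space T x y" "0 \<le> T" "0 \<le> \<eta>"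
  shows "T \<le> path_cost \<eta> T \<psi>" "norm (x - y) \<le> T" "0 \<le> path_cost \<eta> T \<psi>"
proof -
  show "T \<le> path_cost \<eta> T \<psi>" using path_cost_ge_const[OF assms(1,2), of 1 \<eta>] assms(3) by simp
  then show "0 \<le> path_cost \<eta> T \<psi>" using assms(2) by simp
  show "norm (x - y) \<le> T"
    using path_space_lipschitz[OF assms(1), of 0 T] assms by (auto simp: path_space_def)
qed

text \<open>For \<open>T = 0\<close> the derivative condition still asks for some unit vector.\<close>

lemma segment_path:
  fixes x y u :: "'a::real_normed_vector"
  assumes "norm u = 1"
  shows "\<exists>\<psi> \<in> path_space (norm (x - y)) x y. \<forall>t\<in>{0..norm (x - y)}. norm (\<psi> t) \<le> max (norm x) (norm y)"
proof -
  define T where "T = norm (x - y)"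
  define w where "w = (if x = y then u else (1 / T) *\<^sub>R (y - x))"
  have w1: "norm w = 1" using assms by (auto simp: w_def T_def norm_minus_commute)
  have Tw: "T *\<^sub>R w = y - x" by (auto simp: w_def T_def)
  have "(\<lambda>t. x + t *\<^sub>R w) \<in> path_space T x y"
    unfolding path_space_def using w1 Tw
    by (auto intro!: exI[of _ "\<lambda>_. w"] derivative_eq_intros)
  moreover have "norm (x + t *\<^sub>R w) \<le> max (norm x) (norm y)" if t: "t \<in> {0..T}" for t
  proof (cases "T = 0")
    case False
    then have T: "T > 0" by (simp add: T_def)
    have tw: "t *\<^sub>R w = (t / T) *\<^sub>R (y - x)" using T by (simp add: Tw[symmetric])
    have "x + t *\<^sub>R w = (1 - t / T) *\<^sub>R x + (t / T) *\<^sub>R y" unfolding tw by (simp add: algebra_simps)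
    also have "norm \<dots> \<le> (1 - t / T) * norm x + (t / T) * norm y"
      using t T by (intro norm_triangle_le) (auto simp: divide_le_eq)
    also have "\<dots> \<le> max (norm x) (norm y)"
      using t T by (intro convex_bound_le) (auto simp: divide_le_eq)
    finally show ?thesis .
  qed (use t in auto)
  ultimately show ?thesis unfolding T_def by (intro bexI[of _ "\<lambda>t. x + t *\<^sub>R w"] ballI) (simp_all add: T_def)
qed

lemma path_dist_bdd_below:
  assumes "0 \<le> \<eta>" "0 < \<epsilon>"
  shows "bdd_below ((\<lambda>(T, \<psi>). 1 / \<epsilon> * path_cost \<eta> T \<psi>) ` {(T, \<psi>). 0 \<le> T \<and> \<psi> \<in> path_space T x y})"
proof (rule bdd_belowI[of _ 0], clarify)
  fix T and \<psi> :: "real \<Rightarrow> 'a" assume "0 \<le> T" "\<psi> \<in> path_space T x y"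
  then show "0 \<le> 1 / \<epsilon> * path_cost \<eta> T \<psi>" using path_cost_ge(3)[of \<psi> T x y \<eta>] assms by simp
qed

lemma path_dist_le:
  assumes "0 \<le> \<eta>" "0 < \<epsilon>" "0 \<le> T" "\<psi> \<in> path_space T x y"
  shows "path_dist \<eta> \<epsilon> x y \<le> 1 / \<epsilon> * path_cost \<eta> T \<psi>"
  unfolding path_dist_alt
  using cINF_lower[OF path_dist_bdd_below[OF assms(1,2)], of "(T, \<psi>)"] assms by (simp add: min.coboundedI2)

lemma path_dist_le_1: "path_dist \<eta> \<epsilon> x y \<le> 1"
  by (simp add: path_dist_def)

text \<open>A unit vector makes every set of paths non-empty, also for equal end points, so that the
  infimum in \<open>path_dist\<close> is taken over a non-empty set and can be bounded from
  below.\<close>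

context
  fixes \<eta> \<epsilon> :: real and u :: "'a::real_normed_vector"
  assumes eta: "0 \<le> \<eta>" and eps: "0 < \<epsilon>" and u: "norm u = 1"
begin

lemma path_dist_geI:
  fixes x y :: 'a
  assumes "\<And>T \<psi>. 0 \<le> T \<Longrightarrow> \<psi> \<in> path_space T x y \<Longrightarrow> c \<le> 1 / \<epsilon> * path_cost \<eta> T \<psi>" "c \<le> 1"
  shows "c \<le> path_dist \<eta> \<epsilon> x y"
  unfolding path_dist_alt min.bounded_iff
proof (intro conjI cINF_greatest)
  show "{(T, \<psi>). 0 \<le> T \<and> \<psi> \<in> path_space T x y} \<noteq> {}"
  proof -
    from segment_path[OF u, of x y] obtain \<psi> where "\<psi> \<in> path_space (norm (x - y)) x y" by (rule bexE)
    then have "(norm (x - y), \<psi>) \<in> {(T, \<psi>). 0 \<le> T \<and> \<psi> \<in> path_space T x y}" by simp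
    then show ?thesis by (metis empty_iff)
  qed
qed (use assms in auto)

lemma path_dist_nonneg: "0 \<le> path_dist \<eta> \<epsilon> x (y :: 'a)"
proof (rule path_dist_geI)
  fix T and \<psi> :: "real \<Rightarrow> 'a" assume "0 \<le> T" "\<psi> \<in> path_space T x y"
  then show "0 \<le> 1 / \<epsilon> * path_cost \<eta> T \<psi>" using path_cost_ge(3)[of \<psi> T x y \<eta>] eta eps by simp
qed simp

lemma path_dist_segment:
  fixes x y :: 'a
  shows "path_dist \<eta> \<epsilon> x y \<le> 1 / \<epsilon> * (norm (x - y) * exp (\<eta> * max (norm x) (norm y)))"
proof -
  obtain \<psi> where \<psi>: "\<psi> \<in> path_space (norm (x - y)) x y" "\<forall>t\<in>{0..norm (x - y)}. norm (\<psi> t) \<le> max (norm x) (norm y)"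
    using segment_path[OF u, of x y] by (rule bexE)
  have "path_cost \<eta> (norm (x - y)) \<psi> \<le> integral {0..norm (x - y)} (\<lambda>t. exp (\<eta> * max (norm x) (norm y)))"
    unfolding path_cost_def using \<psi>(2) eta
    by (intro integral_le path_cost_integrable[OF \<psi>(1)]) (auto intro!: mult_left_mono)
  then have "path_cost \<eta> (norm (x - y)) \<psi> \<le> norm (x - y) * exp (\<eta> * max (norm x) (norm y))" by simp
  then show ?thesis
    using path_dist_le[OF eta eps _ \<psi>(1)] eps
    by (intro order_trans[OF path_dist_le[OF eta eps _ \<psi>(1)]] mult_left_mono) auto
qed

text \<open>A path of length at least \<open>1\<close> already costs at least
  \<open>1 / \<epsilon> \<ge> 1\<close>. A shorter one stays within distance \<open>1\<close> of
  both end points, so its norm never drops below the larger of their norms minus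
  \<open>1\<close>.\<close>

lemma path_dist_lower:
  fixes x y :: 'a
  assumes "\<epsilon> \<le> 1"
  shows "min 1 (1 / \<epsilon> * (norm (x - y) * exp (\<eta> * (max (norm x) (norm y) - 1)))) \<le> path_dist \<eta> \<epsilon> x y"
proof (rule path_dist_geI)
  fix T and \<psi> :: "real \<Rightarrow> 'a" assume T: "0 \<le> T" and \<psi>: "\<psi> \<in> path_space T x y"
  let ?m = "max (norm x) (norm y)"
  show "min 1 (1 / \<epsilon> * (norm (x - y) * exp (\<eta> * (?m - 1)))) \<le> 1 / \<epsilon> * path_cost \<eta> T \<psi>"
  proof (cases "1 \<le> T")
    case True
    then have "\<epsilon> \<le> path_cost \<eta> T \<psi>" using path_cost_ge(1)[OF \<psi> T eta] assms by simp
    then show ?thesis using eps by (simp add: min.coboundedI1)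
  next
    case False
    have "exp (\<eta> * (?m - 1)) \<le> exp (\<eta> * norm (\<psi> t))" if t: "t \<in> {0..T}" for t
    proof -
      have "norm (\<psi> 0 - \<psi> t) \<le> 1" "norm (\<psi> T - \<psi> t) \<le> 1"
        using path_space_lipschitz[OF \<psi>, of 0 t] path_space_lipschitz[OF \<psi>, of T t] t T False by auto
      then have "norm x - norm (\<psi> t) \<le> 1" "norm y - norm (\<psi> t) \<le> 1"
        using \<psi> norm_triangle_ineq2[of x "\<psi> t"] norm_triangle_ineq2[of y "\<psi> t"] by (auto simp: path_space_def)
      then show ?thesis using eta by (auto intro!: mult_left_mono)
    qed
    from path_cost_ge_const[OF \<psi> T this]
    have "T * exp (\<eta> * (?m - 1)) \<le> path_cost \<eta> T \<psi>" .
    moreover have "norm (x - y) * exp (\<eta> * (?m - 1)) \<le> T * exp (\<eta> * (?m - 1))"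
      using path_cost_ge(2)[OF \<psi> T eta] by (intro mult_right_mono) auto
    ultimately have "norm (x - y) * exp (\<eta> * (?m - 1)) \<le> path_cost \<eta> T \<psi>" by linarith
    then show ?thesis using eps by (intro min.coboundedI2 mult_left_mono) auto
  qed
qed simp

lemma path_dist_ge_norm:
  fixes x y :: 'a
  assumes "\<epsilon> \<le> 1"
  shows "min 1 (norm (x - y)) \<le> path_dist \<eta> \<epsilon> x y"
proof (rule path_dist_geI)
  fix T and \<psi> :: "real \<Rightarrow> 'a" assume T: "0 \<le> T" and \<psi>: "\<psi> \<in> path_space T x y"
  have "norm (x - y) \<le> path_cost \<eta> T \<psi>" using path_cost_ge[OF \<psi> T eta] by simp
  also have "\<dots> \<le> 1 / \<epsilon> * path_cost \<eta> T \<psi>"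
    using path_cost_ge(3)[OF \<psi> T eta] assms eps by (simp add: le_divide_eq mult_left_le)
  finally show "min 1 (norm (x - y)) \<le> 1 / \<epsilon> * path_cost \<eta> T \<psi>" by simp
qed simp

text \<open>The cap of the lower bound is inactive below \<open>1\<close>. The factor
  \<open>\<epsilon>\<close> gained here makes the probability of different decisions a small
  multiple of the distance.\<close>

lemma norm_le_path_dist:
  fixes x y :: 'a
  assumes "\<epsilon> \<le> 1" "path_dist \<eta> \<epsilon> x y < 1"
  shows "norm (x - y) * exp (\<eta> * max (norm x) (norm y)) \<le> \<epsilon> * exp \<eta> * path_dist \<eta> \<epsilon> x y"
proof -
  have "1 / \<epsilon> * (norm (x - y) * exp (\<eta> * (max (norm x) (norm y) - 1))) \<le> path_dist \<eta> \<epsilon> x y"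
    using path_dist_lower[OF assms(1), of x y] assms(2) by auto
  then have "norm (x - y) * exp (\<eta> * max (norm x) (norm y)) * (1 / (\<epsilon> * exp \<eta>)) \<le> path_dist \<eta> \<epsilon> x y"
    by (simp add: right_diff_distrib exp_diff mult_ac)
  then show ?thesis using eps by (simp add: divide_simps mult_ac)
qed

text \<open>A path is carried along by the affine map and reparametrised to unit speed: its length
  is multiplied by \<open>c\<close>, and its norm grows by at most \<open>norm z\<close> because
  \<open>c \<le> 1\<close>. The distance must be below \<open>1\<close>, since a capped value gives
  no upper bound on path costs.\<close>

lemma path_dist_affine:
  fixes x y z :: 'a
  assumes c: "0 \<le> c" "c \<le> 1" and less: "path_dist \<eta> \<epsilon> x y < 1"
  shows "path_dist \<eta> \<epsilon> (c *\<^sub>R x + z) (c *\<^sub>R y + z) \<le> c * exp (\<eta> * norm z) * path_dist \<eta> \<epsilon> x y"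
proof (cases "c = 0")
  case True
  have "path_dist \<eta> \<epsilon> z z \<le> 0" using path_dist_segment[of z z] by simp
  then show ?thesis using True by simp
next
  case False
  with c have c0: "0 < c" by simp
  let ?d = "path_dist \<eta> \<epsilon> (c *\<^sub>R x + z) (c *\<^sub>R y + z)"
  have key: "?d \<le> c * exp (\<eta> * norm z) * (1 / \<epsilon> * path_cost \<eta> T \<psi>)"
    if T: "0 \<le> T" and \<psi>: "\<psi> \<in> path_space T x y" for T \<psi>
  proof -
    obtain \<psi>' where d: "continuous_on {0..T} \<psi>'" "\<And>t. t \<in> {0..T} \<Longrightarrow> (\<psi> has_vector_derivative \<psi>' t) (at t within {0..T})" "\<And>t. t \<in> {0..T} \<Longrightarrow> norm (\<psi>' t) = 1"
      and b: "\<psi> 0 = x" "\<psi> T = y"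
      using \<psi> unfolding path_space_def by blast
    define \<theta> where "\<theta> t = c *\<^sub>R \<psi> (t / c) + z" for t
    have im: "(\<lambda>t. t / c) ` {0..c * T} = {0..T}"
      using c0 by (auto simp: image_iff field_simps intro!: bexI[of _ "c * _"])
    have "\<theta> \<in> path_space (c * T) (c *\<^sub>R x + z) (c *\<^sub>R y + z)"
      unfolding path_space_def mem_Collect_eq
    proof (intro conjI exI[of _ "\<lambda>t. \<psi>' (t / c)"] ballI)
      show "\<theta> 0 = c *\<^sub>R x + z" "\<theta> (c * T) = c *\<^sub>R y + z" using c0 b by (auto simp: \<theta>_def)
      show "continuous_on {0..c * T} (\<lambda>t. \<psi>' (t / c))"
        by (rule continuous_on_compose2[OF d(1)]) (use im c0 in \<open>auto intro!: continuous_intros\<close>)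
      fix t assume t: "t \<in> {0..c * T}"
      then have tc: "t / c \<in> {0..T}" using im by blast
      then show "norm (\<psi>' (t / c)) = 1" by (rule d(3))
      have "((\<lambda>t. t / c) has_vector_derivative (1 / c)) (at t within {0..c * T})"
        using c0 by (auto intro!: derivative_eq_intros)
      moreover have "(\<psi> has_vector_derivative \<psi>' (t / c)) (at (t / c) within (\<lambda>t. t / c) ` {0..c * T})"
        using d(2)[OF tc] by (simp add: im)
      ultimately have "(\<psi> \<circ> (\<lambda>t. t / c) has_vector_derivative (1 / c) *\<^sub>R \<psi>' (t / c)) (at t within {0..c * T})"
        by (rule vector_diff_chain_within)
      then have "((\<lambda>t. c *\<^sub>R \<psi> (t / c) + z) has_vector_derivative c *\<^sub>R ((1 / c) *\<^sub>R \<psi>' (t / c))) (at t within {0..c * T})"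
        by (auto intro!: derivative_eq_intros simp: o_def)
      then show "(\<theta> has_vector_derivative \<psi>' (t / c)) (at t within {0..c * T})"
        using c0 by (simp add: \<theta>_def[abs_def])
    qed
    then have \<theta>: "\<theta> \<in> path_space (c * T) (c *\<^sub>R x + z) (c *\<^sub>R y + z)" .
    have "path_cost \<eta> (c * T) \<theta> \<le> integral {0..c * T} (\<lambda>t. exp (\<eta> * norm z) * exp (\<eta> * norm (\<psi> (t / c))))"
      unfolding path_cost_def
    proof (rule integral_le)
      show "(\<lambda>t. exp (\<eta> * norm z) * exp (\<eta> * norm (\<psi> (t / c)))) integrable_on {0..c * T}"
        by (intro integrable_continuous_interval continuous_intros continuous_on_compose2[OF path_space_continuous[OF \<psi>]])
          (use im c0 in \<open>auto intro!: continuous_intros\<close>)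
      fix t
      have "norm (\<theta> t) \<le> c * norm (\<psi> (t / c)) + norm z"
        unfolding \<theta>_def using c0 by (intro norm_triangle_le) simp
      also have "\<dots> \<le> norm (\<psi> (t / c)) + norm z" using c by (simp add: mult_left_le_one_le)
      finally show "exp (\<eta> * norm (\<theta> t)) \<le> exp (\<eta> * norm z) * exp (\<eta> * norm (\<psi> (t / c)))"
        using mult_left_mono[OF _ eta] by (fastforce simp: exp_add[symmetric] distrib_left[symmetric] add.commute)
    qed (rule path_cost_integrable[OF \<theta>])
    also have "\<dots> = exp (\<eta> * norm z) * integral {0..c * T} (\<lambda>t. exp (\<eta> * norm (\<psi> (t / c))))"
      by simp
    also have "integral {0..c * T} (\<lambda>t. exp (\<eta> * norm (\<psi> (t / c)))) = c * path_cost \<eta> T \<psi>"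
    proof -
      have "((\<lambda>t. exp (\<eta> * norm (\<psi> t))) has_integral path_cost \<eta> T \<psi>) {0..T}"
        unfolding path_cost_def using path_cost_integrable[OF \<psi>] by (rule integrable_integral)
      then have "((\<lambda>t. exp (\<eta> * norm (\<psi> t))) has_integral path_cost \<eta> T \<psi>) (cbox 0 T)" by simp
      from has_integral_affinity[OF this, of "1 / c" 0] c0
      have "((\<lambda>t. exp (\<eta> * norm (\<psi> (t / c)))) has_integral c * path_cost \<eta> T \<psi>) ((\<lambda>t. c * t) ` {0..T})"
        by simp
      also have "(\<lambda>t. c * t) ` {0..T} = {0..c * T}"
        using c0 T by simp
      finally show ?thesis by (rule integral_unique)
    qed
    finally have "path_cost \<eta> (c * T) \<theta> \<le> exp (\<eta> * norm z) * (c * path_cost \<eta> T \<psi>)" .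
    then have "1 / \<epsilon> * path_cost \<eta> (c * T) \<theta> \<le> 1 / \<epsilon> * (exp (\<eta> * norm z) * (c * path_cost \<eta> T \<psi>))"
      using eps by (intro mult_left_mono) auto
    moreover have "?d \<le> 1 / \<epsilon> * path_cost \<eta> (c * T) \<theta>"
      using c0 T by (intro path_dist_le[OF eta eps _ \<theta>]) auto
    ultimately show ?thesis by (simp add: mult_ac)
  qed
  \<comment> \<open>The rule for lower bounds asks for a constant at most \<open>1\<close>; the
    minimum is then resolved by the assumption that the distance is below \<open>1\<close>.\<close>
  have "min 1 (?d / (c * exp (\<eta> * norm z))) \<le> path_dist \<eta> \<epsilon> x y"
  proof (rule path_dist_geI)
    fix T and \<psi> :: "real \<Rightarrow> 'a" assume "0 \<le> T" "\<psi> \<in> path_space T x y"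
    from key[OF this] have "?d / (c * exp (\<eta> * norm z)) \<le> 1 / \<epsilon> * path_cost \<eta> T \<psi>"
      using c0 by (simp add: divide_le_eq mult.commute)
    then show "min 1 (?d / (c * exp (\<eta> * norm z))) \<le> 1 / \<epsilon> * path_cost \<eta> T \<psi>" by simp
  qed simp
  then show ?thesis using less c0 by (auto simp: min_le_iff_disj divide_le_eq mult.commute)
qed

end

section \<open>The potential and the Lyapunov function\<close>

lemma min_one_exp_lipschitz: "\<bar>min 1 (exp s) - min 1 (exp t)\<bar> \<le> \<bar>s - t\<bar>" for s t :: real
proof -
  have *: "\<bar>min 1 (exp s) - min 1 (exp t)\<bar> \<le> t - s" if "s \<le> t" for s t :: real
  proof (cases "s \<ge> 0")
    case False
    have "min 1 (exp t) \<le> exp (min 0 t)" by (auto simp: min_def)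
    moreover have "exp (min 0 t) - exp s \<le> min 0 t - s"
    proof -
      have "1 - exp (s - min 0 t) \<le> min 0 t - s" using exp_ge_add_one_self[of "s - min 0 t"] by linarith
      then have "exp (min 0 t) * (1 - exp (s - min 0 t)) \<le> 1 * (min 0 t - s)"
        using False that by (intro mult_mono) auto
      then show ?thesis by (simp add: right_diff_distrib exp_add[symmetric])
    qed
    moreover have "min 1 (exp s) = exp s" "exp s \<le> exp t" "exp s \<le> 1" using False that by auto
    ultimately show ?thesis by (auto simp: min_def split: if_splits)
  qed (use that in \<open>auto simp: min_def\<close>)
  show ?thesis using *[of s t] *[of t s] by (cases "s \<le> t") auto
qed

text \<open>Only hypotheses that do not involve a noise measure are collected, so that the constants
  derived here exist before any state space is fixed.\<close>

locale pcn_potential =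
  fixes \<Phi> :: "'a::{real_inner, complete_space, second_countable_topology} \<Rightarrow> real"
    and \<delta> \<rho> R \<alpha>\<^sub>l r a :: real
  assumes delta: "0 < \<delta>" "\<delta> \<le> 1 / 2"
    and rho: "\<rho> = 1 - sqrt (1 - 2 * \<delta>)"
    and lipschitz: "\<And>\<kappa>. \<kappa> > 0 \<Longrightarrow>
      \<exists>M. \<forall>s>0. local_lipschitz_const \<Phi> s \<le> ereal (M * exp (\<kappa> * s))"
    and R: "R > 0"
    and r: "r > 0"
    and a: "0 < a"
    and r_le: "\<And>s. s \<ge> R \<Longrightarrow> r * s powr a \<le> \<rho> / 2 * s"
    and acceptance: "\<And>x. x \<notin> ball 0 R \<Longrightarrow>
      (INF z \<in> ball ((1 - \<rho>) *\<^sub>R x) (r * norm x powr a). exp (- \<Phi> z + \<Phi> x)) > exp \<alpha>\<^sub>l"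
begin

lemma rho_bounds: "0 < \<rho>" "\<rho> \<le> 1"
  using delta by (auto simp: rho real_sqrt_lt_1_iff)

lemma sqrt_eq: "sqrt (1 - 2 * \<delta>) = 1 - \<rho>" by (simp add: rho)

lemma lipschitz_bound:
  assumes "\<kappa> > 0"
  obtains M where "0 \<le> M" "\<And>s x y. norm x < s \<Longrightarrow> norm y < s \<Longrightarrow> \<bar>\<Phi> x - \<Phi> y\<bar> \<le> M * exp (\<kappa> * s) * norm (x - y)"
proof -
  obtain M where M: "\<And>s. s > 0 \<Longrightarrow> local_lipschitz_const \<Phi> s \<le> ereal (M * exp (\<kappa> * s))"
    using lipschitz[OF assms] by blast
  have "\<bar>\<Phi> x - \<Phi> y\<bar> \<le> max 0 M * exp (\<kappa> * s) * norm (x - y)" if n: "norm x < s" "norm y < s" for s x y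
  proof (cases "x = y")
    case False
    have "s > 0" using n(1) norm_ge_zero[of x] by linarith
    have "ereal (\<bar>\<Phi> x - \<Phi> y\<bar> / norm (x - y)) \<le> local_lipschitz_const \<Phi> s"
      unfolding local_lipschitz_const_def using n False
      by (intro SUP_upper2[of "(x, y)"]) auto
    also have "\<dots> \<le> ereal (M * exp (\<kappa> * s))" by (rule M[OF \<open>s > 0\<close>])
    finally have "\<bar>\<Phi> x - \<Phi> y\<bar> \<le> M * exp (\<kappa> * s) * norm (x - y)"
      using False by (simp add: divide_le_eq)
    also have "\<dots> \<le> max 0 M * exp (\<kappa> * s) * norm (x - y)" by (intro mult_right_mono) auto
    finally show ?thesis .
  qed simp
  then show ?thesis using that[of "max 0 M"] by simp
qed

lemma continuous_potential: "continuous_on UNIV \<Phi>"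
proof -
  obtain M where M: "0 \<le> M" "\<And>s x y. norm x < s \<Longrightarrow> norm y < s \<Longrightarrow> \<bar>\<Phi> x - \<Phi> y\<bar> \<le> M * exp (1 * s) * norm (x - y)"
    using lipschitz_bound[of 1] by auto
  have "isCont \<Phi> x" for x
  proof -
    let ?s = "norm x + 1"
    have "(M * exp ?s)-lipschitz_on (ball 0 ?s) \<Phi>"
      using M by (intro lipschitz_onI) (auto simp: dist_norm)
    then have "continuous_on (ball 0 ?s) \<Phi>" by (rule lipschitz_on_continuous_on)
    then show ?thesis by (simp add: continuous_on_eq_continuous_at)
  qed
  then show ?thesis by (simp add: continuous_at_imp_continuous_on)
qed

lemma potential_measurable [measurable]: "\<Phi> \<in> borel_measurable borel"
  by (rule borel_measurable_continuous_onI[OF continuous_potential])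

lemma acceptance_at:
  assumes "norm x \<ge> R" "norm (z - (1 - \<rho>) *\<^sub>R x) < r * norm x powr a"
  shows "exp \<alpha>\<^sub>l < exp (\<Phi> x - \<Phi> z)"
proof -
  have "exp \<alpha>\<^sub>l < (INF z \<in> ball ((1 - \<rho>) *\<^sub>R x) (r * norm x powr a). exp (- \<Phi> z + \<Phi> x))"
    using assms(1) by (intro acceptance) auto
  also have "\<dots> \<le> exp (- \<Phi> z + \<Phi> x)"
    using assms(2) by (intro cINF_lower bdd_belowI[of _ 0]) (auto simp: dist_norm norm_minus_commute)
  finally show ?thesis by (simp add: algebra_simps)
qed

text \<open>As \<open>a > 0\<close>, the admissible radii are unbounded. Hence a proposal whose
  noise has norm at most \<open>k\<close> falls into the acceptance ball of every sufficiently
  distant state; \<open>b\<close> is the point at which \<open>r * s powr a\<close> reaches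
  \<open>\<bar>k\<bar> + 1\<close>.\<close>

lemma radius_exceeds:
  obtains R1 where "R1 \<ge> 1" "R1 \<ge> R" "\<And>s. s \<ge> R1 \<Longrightarrow> k < r * s powr a"
proof -
  define b where "b = ((\<bar>k\<bar> + 1) / r) powr (1 / a)"
  have "k < r * s powr a" if "s \<ge> max (max 1 R) b" for s
  proof -
    have "(\<bar>k\<bar> + 1) / r = b powr a" using a r by (simp add: b_def powr_powr)
    also have "\<dots> \<le> s powr a" using that a by (intro powr_mono2) (auto simp: b_def)
    finally show ?thesis using r by (simp add: divide_le_eq mult.commute)
  qed
  then show ?thesis using that[of "max (max 1 R) b"] by auto
qed

text \<open>Inside the acceptance ball the bound \<open>exp \<alpha>\<^sub>l\<close> is in force,
  and since its radius is at most \<open>\<rho> / 2\<close> times the norm, the noise uses up at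
  most half of the gain \<open>\<rho>\<close> of the contraction.\<close>

lemma accept_prob_far:
  obtains R1 where "R1 \<ge> 1"
    "\<And>x z. norm x \<ge> R1 \<Longrightarrow> norm (z - (1 - \<rho>) *\<^sub>R x) \<le> k \<Longrightarrow>
      min 1 (exp \<alpha>\<^sub>l) \<le> accept_prob \<Phi> x z \<and> norm z \<le> (1 - \<rho> / 2) * norm x"
proof -
  obtain R1 where R1: "R1 \<ge> 1" "R1 \<ge> R" "\<And>s. s \<ge> R1 \<Longrightarrow> k < r * s powr a"
    using radius_exceeds by blast
  have "min 1 (exp \<alpha>\<^sub>l) \<le> accept_prob \<Phi> x z \<and> norm z \<le> (1 - \<rho> / 2) * norm x"
    if x: "norm x \<ge> R1" and z: "norm (z - (1 - \<rho>) *\<^sub>R x) \<le> k" for x z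
  proof
    have lt: "norm (z - (1 - \<rho>) *\<^sub>R x) < r * norm x powr a" using R1(3)[OF x] z by simp
    show "min 1 (exp \<alpha>\<^sub>l) \<le> accept_prob \<Phi> x z"
      using acceptance_at[OF _ lt] x R1 by (auto simp: accept_prob_def min_def)
    have "norm z \<le> norm ((1 - \<rho>) *\<^sub>R x) + norm (z - (1 - \<rho>) *\<^sub>R x)"
      using norm_triangle_ineq[of "(1 - \<rho>) *\<^sub>R x" "z - (1 - \<rho>) *\<^sub>R x"] by simp
    also have "\<dots> \<le> (1 - \<rho>) * norm x + \<rho> / 2 * norm x"
      using lt r_le[of "norm x"] x R1 rho_bounds by (intro add_mono) auto
    finally show "norm z \<le> (1 - \<rho> / 2) * norm x" by (simp add: algebra_simps)
  qed
  then show ?thesis using that R1 by blast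
qed

text \<open>Far out the acceptance hypothesis gives the bound; on the remaining ball the potential
  is Lipschitz and state and proposal have bounded distance. The result is independent of the state,
  which allows both copies to accept on one event.\<close>

lemma accept_prob_lower:
  obtains p where "0 < p" "p \<le> 1" "\<And>x z. norm (z - (1 - \<rho>) *\<^sub>R x) \<le> k \<Longrightarrow> p \<le> accept_prob \<Phi> x z"
proof -
  obtain R1 where R1: "R1 \<ge> 1" "\<And>x z. norm x \<ge> R1 \<Longrightarrow> norm (z - (1 - \<rho>) *\<^sub>R x) \<le> k \<Longrightarrow>
      min 1 (exp \<alpha>\<^sub>l) \<le> accept_prob \<Phi> x z \<and> norm z \<le> (1 - \<rho> / 2) * norm x"
    using accept_prob_far by blast
  obtain M where M: "0 \<le> M" "\<And>s x y. norm x < s \<Longrightarrow> norm y < s \<Longrightarrow> \<bar>\<Phi> x - \<Phi> y\<bar> \<le> M * exp (1 * s) * norm (x - y)"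
    using lipschitz_bound[of 1] by auto
  define s where "s = R1 + \<bar>k\<bar> + 1"
  define p where "p = min (min 1 (exp \<alpha>\<^sub>l)) (exp (- (M * exp s * (2 * s))))"
  have "p \<le> accept_prob \<Phi> x z" if z: "norm (z - (1 - \<rho>) *\<^sub>R x) \<le> k" for x z
  proof (cases "norm x \<ge> R1")
    case True
    then show ?thesis using R1(2)[OF True z] by (auto simp: p_def)
  next
    case False
    have "norm z \<le> norm ((1 - \<rho>) *\<^sub>R x) + norm (z - (1 - \<rho>) *\<^sub>R x)"
      using norm_triangle_ineq[of "(1 - \<rho>) *\<^sub>R x" "z - (1 - \<rho>) *\<^sub>R x"] by simp
    also have "norm ((1 - \<rho>) *\<^sub>R x) \<le> norm x" using rho_bounds by (simp add: mult_left_le_one_le)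
    finally have n: "norm z < s" "norm x < s" using False z by (auto simp: s_def)
    have "norm (x - z) \<le> 2 * s" using norm_triangle_ineq4[of x z] n by simp
    then have "M * exp s * norm (x - z) \<le> M * exp s * (2 * s)" using M(1) by (intro mult_left_mono) auto
    then have "- (M * exp s * (2 * s)) \<le> \<Phi> x - \<Phi> z" using M(2)[OF n(2) n(1)] by simp
    then have "exp (- (M * exp s * (2 * s))) \<le> exp (\<Phi> x - \<Phi> z)" by simp
    then have "p \<le> exp (\<Phi> x - \<Phi> z)" "p \<le> 1"
      by (auto simp: p_def min.coboundedI2 simp del: exp_le_cancel_iff)
    then show ?thesis by (simp add: accept_prob_def)
  qed
  moreover have "0 < p" "p \<le> 1" by (auto simp: p_def)
  ultimately show ?thesis using that by blast
qed

text \<open>The growth rate of the Lipschitz constant is taken equal to the exponent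
  \<open>\<eta>\<close> of the path weight, so that the factor depending on the states is exactly
  what the path distance controls. Both states and both proposals lie in one ball, whose radius
  splits into a part from the states and a part from the noise.\<close>

lemma accept_prob_diff:
  assumes "\<eta> > 0"
  obtains M where "0 \<le> M" "\<And>x y z. \<bar>accept_prob \<Phi> x ((1 - \<rho>) *\<^sub>R x + z) - accept_prob \<Phi> y ((1 - \<rho>) *\<^sub>R y + z)\<bar>
     \<le> M * (norm (x - y) * exp (\<eta> * max (norm x) (norm y))) * exp (\<eta> * norm z)"
proof -
  obtain M where M: "0 \<le> M" "\<And>s x y. norm x < s \<Longrightarrow> norm y < s \<Longrightarrow> \<bar>\<Phi> x - \<Phi> y\<bar> \<le> M * exp (\<eta> * s) * norm (x - y)"
    using lipschitz_bound[OF assms] by auto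
  have "\<bar>accept_prob \<Phi> x ((1 - \<rho>) *\<^sub>R x + z) - accept_prob \<Phi> y ((1 - \<rho>) *\<^sub>R y + z)\<bar>
     \<le> 2 * M * exp \<eta> * (norm (x - y) * exp (\<eta> * max (norm x) (norm y))) * exp (\<eta> * norm z)" for x y z
  proof -
    \<comment> \<open>The summand \<open>1\<close> makes the norm bounds strict, as the Lipschitz
      estimate refers to open balls; it produces the constant \<open>exp \<eta>\<close>.\<close>
    define s where "s = max (norm x) (norm y) + norm z + 1"
    let ?p = "\<lambda>x. (1 - \<rho>) *\<^sub>R x + z"
    have p: "norm (?p x) < s" if "norm x \<le> max (norm x') (norm y')" "s = max (norm x') (norm y') + norm z + 1" for x x' y'
    proof -
      have "norm (?p x) \<le> (1 - \<rho>) * norm x + norm z" using rho_bounds by (intro norm_triangle_le) simp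
      also have "(1 - \<rho>) * norm x \<le> norm x" using rho_bounds by (simp add: mult_left_le_one_le)
      finally show ?thesis using that by linarith
    qed
    have n: "norm x < s" "norm y < s" "norm (?p x) < s" "norm (?p y) < s"
      using p[of x x y] p[of y x y] norm_ge_zero[of z] unfolding s_def by linarith+
    have "norm (?p x - ?p y) = (1 - \<rho>) * norm (x - y)" using rho_bounds by (simp add: scaleR_diff_right[symmetric])
    also have "\<dots> \<le> norm (x - y)" using rho_bounds by (simp add: mult_left_le_one_le)
    finally have np: "norm (?p x - ?p y) \<le> norm (x - y)" .
    have "\<bar>accept_prob \<Phi> x (?p x) - accept_prob \<Phi> y (?p y)\<bar> \<le> \<bar>(\<Phi> x - \<Phi> (?p x)) - (\<Phi> y - \<Phi> (?p y))\<bar>"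
      unfolding accept_prob_def by (rule min_one_exp_lipschitz)
    also have "\<dots> \<le> \<bar>\<Phi> x - \<Phi> y\<bar> + \<bar>\<Phi> (?p x) - \<Phi> (?p y)\<bar>" by linarith
    also have "\<dots> \<le> M * exp (\<eta> * s) * norm (x - y) + M * exp (\<eta> * s) * norm (x - y)"
      using M(1) by (intro add_mono M(2)[OF n(1,2)] order_trans[OF M(2)[OF n(3,4)] mult_left_mono[OF np]]) auto
    also have "\<dots> = 2 * M * exp \<eta> * (norm (x - y) * exp (\<eta> * max (norm x) (norm y))) * exp (\<eta> * norm z)"
      by (simp add: s_def distrib_left exp_add)
    finally show ?thesis .
  qed
  then show ?thesis using that[of "2 * M * exp \<eta>"] M(1) by simp
qed

text \<open>
  Contracting a point to \<open>(1 - \<rho>) x\<close> costs at most \<open>\<alpha>\<^sub>l\<close> in \<open>\<Phi>\<close>, and boundedly many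
  contractions, compared with \<open>norm x\<close>, lead into \<open>B\<^sub>R(0)\<close>.
\<close>

lemma potential_lower:
  obtains A B where "\<And>x. - \<Phi> x \<le> A + B * norm x"
proof -
  obtain M where M: "0 \<le> M" "\<And>s x y. norm x < s \<Longrightarrow> norm y < s \<Longrightarrow> \<bar>\<Phi> x - \<Phi> y\<bar> \<le> M * exp (1 * s) * norm (x - y)"
    using lipschitz_bound[of 1] by auto
  define A where "A = \<bar>\<Phi> 0\<bar> + M * exp R * R"
  \<comment> \<open>With this slope, one contraction of a point outside the ball of radius
    \<open>R\<close> lowers \<open>B * norm x\<close> by at least
    \<open>\<bar>\<alpha>\<^sub>l\<bar>\<close>, which pays for the change of the potential.\<close>
  define B where "B = \<bar>\<alpha>\<^sub>l\<bar> / (\<rho> * R)"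
  have B: "0 \<le> B" using R rho_bounds by (simp add: B_def)
  have base: "- \<Phi> x \<le> A + B * norm x" if "norm x < R" for x
  proof -
    have "\<bar>\<Phi> x - \<Phi> 0\<bar> \<le> M * exp R * norm x" using M(2)[of x R 0] that R by simp
    also have "\<dots> \<le> M * exp R * R" using M(1) that by (intro mult_left_mono) auto
    finally show ?thesis using B by (simp add: A_def add_increasing2)
  qed
  have step: "- \<Phi> x \<le> A + B * norm x" if "(1 - \<rho>) ^ n * norm x < R" for n x
    using that
  proof (induction n arbitrary: x)
    case (Suc n)
    show ?case
    proof (cases "norm x < R")
      case False
      have "- \<Phi> ((1 - \<rho>) *\<^sub>R x) \<le> A + B * norm ((1 - \<rho>) *\<^sub>R x)"
        using Suc rho_bounds by (intro Suc.IH) (simp add: mult_ac)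
      moreover have "\<alpha>\<^sub>l < \<Phi> x - \<Phi> ((1 - \<rho>) *\<^sub>R x)"
      proof -
        have "0 < norm x" using False R by linarith
        then show ?thesis using acceptance_at[of x "(1 - \<rho>) *\<^sub>R x"] False r by simp
      qed
      moreover have "\<bar>\<alpha>\<^sub>l\<bar> \<le> B * \<rho> * norm x"
      proof -
        have "\<bar>\<alpha>\<^sub>l\<bar> = B * \<rho> * R" using R rho_bounds by (simp add: B_def)
        also have "\<dots> \<le> B * \<rho> * norm x" using False B rho_bounds by (intro mult_left_mono) auto
        finally show ?thesis .
      qed
      moreover have "B * norm ((1 - \<rho>) *\<^sub>R x) = B * norm x - B * \<rho> * norm x"
        using rho_bounds by (simp add: left_diff_distrib right_diff_distrib)
      ultimately show ?thesis by linarith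
    qed (rule base)
  qed (use base in simp)
  have "- \<Phi> x \<le> A + B * norm x" for x
  proof -
    have "(\<lambda>n. (1 - \<rho>) ^ n * norm x) \<longlonglongrightarrow> 0 * norm x"
      using rho_bounds by (intro tendsto_mult tendsto_const LIMSEQ_realpow_zero) auto
    then have "\<exists>n. (1 - \<rho>) ^ n * norm x < R"
      using order_tendstoD(2)[of _ "0 * norm x" sequentially R] R by (fastforce simp: eventually_sequentially)
    then show ?thesis using step by blast
  qed
  then show ?thesis using that by blast
qed

end

text \<open>Both choices of \<open>V\<close> are radial, and the drift argument needs only these
  properties of the radial part. Growth and contraction are required from radius \<open>1\<close>
  on, since a power cannot satisfy the growth bound near zero; coercivity turns a bound on
  \<open>V\<close> into a bounded set.\<close>

locale lyapunov_profile =
  fixes W :: "real \<Rightarrow> real" and v q \<rho> :: real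
  assumes profile_measurable [measurable]: "W \<in> borel_measurable borel"
    and profile_nonneg: "\<And>s. 0 \<le> s \<Longrightarrow> 0 \<le> W s"
    and profile_mono: "\<And>s t. 0 \<le> s \<Longrightarrow> s \<le> t \<Longrightarrow> W s \<le> W t"
    and profile_growth: "\<And>s t. 1 \<le> s \<Longrightarrow> 0 \<le> t \<Longrightarrow> W (s + t) \<le> W s * exp (v * t)"
    and profile_contract: "\<And>s. 1 \<le> s \<Longrightarrow> W ((1 - \<rho> / 2) * s) \<le> q * W s"
    and profile_coercive: "\<And>K. \<exists>s\<^sub>0. \<forall>s\<ge>0. W s \<le> K \<longrightarrow> s \<le> s\<^sub>0"
    and profile_const: "0 \<le> v" "0 \<le> q" "q < 1"

text \<open>For \<open>s \<ge> 1\<close> one has \<open>s + t \<le> s * exp t\<close>, so a power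
  grows at most exponentially with rate \<open>i\<close>; \<open>i \<ge> 1\<close> makes the
  contraction strict and the profile coercive.\<close>

lemma lyapunov_profile_power:
  assumes "0 < \<rho>" "\<rho> \<le> 1" "i \<ge> 1"
  shows "lyapunov_profile (\<lambda>s. s ^ i) (real i) ((1 - \<rho> / 2) ^ i) \<rho>"
proof
  fix s t :: real assume "1 \<le> s" "0 \<le> t"
  have "s + t \<le> s * (1 + t)" using \<open>1 \<le> s\<close> \<open>0 \<le> t\<close> by (simp add: distrib_left mult_le_cancel_right1)
  also have "\<dots> \<le> s * exp t" using \<open>1 \<le> s\<close> exp_ge_add_one_self[of t] by (intro mult_left_mono) auto
  finally have "(s + t) ^ i \<le> (s * exp t) ^ i" using \<open>1 \<le> s\<close> \<open>0 \<le> t\<close> by (intro power_mono) auto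
  then show "(s + t) ^ i \<le> s ^ i * exp (real i * t)" by (simp add: power_mult_distrib exp_of_nat_mult)
next
  fix K :: real
  have "s \<le> max 1 K" if "s ^ i \<le> K" for s :: real
  proof (cases "s \<le> 1")
    case False
    then have "s ^ 1 \<le> s ^ i" using assms by (intro power_increasing) auto
    then show ?thesis using that by simp
  qed simp
  then show "\<exists>s\<^sub>0. \<forall>s\<ge>0. s ^ i \<le> K \<longrightarrow> s \<le> s\<^sub>0" by blast
next
  have "(1 - \<rho> / 2) ^ i \<le> (1 - \<rho> / 2) ^ 1" using assms by (intro power_decreasing) auto
  then show "(1 - \<rho> / 2) ^ i < 1" using assms by simp
qed (use assms in \<open>auto intro: power_mono simp: power_mult_distrib\<close>)

text \<open>Contracting the radius gains the factor \<open>exp (- (v * \<rho> * s / 2))\<close>, and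
  the constant \<open>q\<close> is its value at the smallest radius considered,
  \<open>s = 1\<close>.\<close>

lemma lyapunov_profile_exp:
  assumes "0 < \<rho>" "\<rho> \<le> 1" "v > 0"
  shows "lyapunov_profile (\<lambda>s. exp (v * s)) v (exp (- (v * \<rho> / 2))) \<rho>"
proof
  fix s :: real assume "1 \<le> s"
  have "v * \<rho> / 2 * 1 \<le> v * \<rho> / 2 * s" using assms \<open>1 \<le> s\<close> by (intro mult_left_mono) auto
  then show "exp (v * ((1 - \<rho> / 2) * s)) \<le> exp (- (v * \<rho> / 2)) * exp (v * s)"
    by (simp add: exp_add[symmetric] algebra_simps)
next
  fix K :: real
  have "s \<le> K / v" if "exp (v * s) \<le> K" for s
  proof -
    have "v * s \<le> K" using exp_ge_add_one_self[of "v * s"] that by linarith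
    then show ?thesis using assms by (simp add: le_divide_eq mult.commute)
  qed
  then show "\<exists>s\<^sub>0. \<forall>s\<ge>0. exp (v * s) \<le> K \<longrightarrow> s \<le> s\<^sub>0" by blast
qed (use assms in \<open>auto simp: exp_add[symmetric] distrib_left\<close>)

section \<open>The synchronous coupling\<close>

text \<open>A uniform variable turns the random decision into a comparison with a threshold, and two
  copies with different acceptance probabilities can share it.\<close>

definition unif :: "real measure" where
  "unif = uniform_measure lborel {0..1}"

lemma sets_unif [simp, measurable_cong]: "sets unif = sets borel"
  by (simp add: unif_def)

lemma space_unif [simp]: "space unif = UNIV"
  by (simp add: unif_def)

lemma prob_space_unif: "prob_space unif"
  unfolding unif_def by (intro prob_space_uniform_measure) auto

lemma emeasure_unif:
  assumes [measurable]: "A \<in> sets borel"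
  shows "emeasure unif A = emeasure lborel ({0..1} \<inter> A)"
  unfolding unif_def by (subst emeasure_uniform_measure) (auto simp: divide_ennreal_def)

lemma emeasure_unif_atMost:
  assumes "0 \<le> p" "p \<le> 1"
  shows "emeasure unif {..p} = ennreal p"
proof -
  have "{0..1} \<inter> {..p} = {0..p}" using assms by auto
  then show ?thesis using assms by (simp add: emeasure_unif)
qed

lemma emeasure_unif_greaterThan:
  assumes "0 \<le> p" "p \<le> 1"
  shows "emeasure unif {p<..} = ennreal (1 - p)"
proof -
  have "{0..1} \<inter> {p<..} = {p<..1}" using assms by auto
  then show ?thesis using assms by (simp add: emeasure_unif)
qed

text \<open>The two decisions differ exactly when the uniform variable falls between the
  thresholds.\<close>

lemma emeasure_unif_between_le:
  assumes "0 \<le> p" "p \<le> 1" "0 \<le> q" "q \<le> 1"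
  shows "emeasure unif {u. (u \<le> p) \<noteq> (u \<le> q)} \<le> ennreal \<bar>p - q\<bar>"
proof -
  have "{u. (u \<le> p) \<noteq> (u \<le> q)} = {min p q<..max p q}" by auto
  moreover have "{0..1} \<inter> {min p q<..max p q} = {min p q<..max p q}" using assms by auto
  ultimately show ?thesis by (simp add: emeasure_unif)
qed

abbreviation pcn_proposal :: "real \<Rightarrow> 'a::real_vector \<Rightarrow> 'a \<Rightarrow> 'a" where
  "pcn_proposal \<delta> x \<xi> \<equiv> sqrt (1 - 2 * \<delta>) *\<^sub>R x + sqrt (2 * \<delta>) *\<^sub>R \<xi>"

definition pcn_step :: "real \<Rightarrow> ('a::real_vector \<Rightarrow> real) \<Rightarrow> 'a \<Rightarrow> 'a \<times> real \<Rightarrow> 'a" where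
  "pcn_step \<delta> \<Phi> x \<omega> = (let p = sqrt (1 - 2 * \<delta>) *\<^sub>R x + sqrt (2 * \<delta>) *\<^sub>R fst \<omega>
     in if snd \<omega> \<le> accept_prob \<Phi> x p then p else x)"

definition pcn_coupling :: "real \<Rightarrow> ('a::real_vector \<Rightarrow> real) \<Rightarrow> 'a measure \<Rightarrow> 'a \<times> 'a \<Rightarrow> ('a \<times> 'a) measure" where
  "pcn_coupling \<delta> \<Phi> \<gamma> z =
     distr (\<gamma> \<Otimes>\<^sub>M unif) (\<gamma> \<Otimes>\<^sub>M \<gamma>) (\<lambda>\<omega>. (pcn_step \<delta> \<Phi> (fst z) \<omega>, pcn_step \<delta> \<Phi> (snd z) \<omega>))"

lemma accept_prob_bounds [simp]: "0 \<le> accept_prob \<Phi> x y" "accept_prob \<Phi> x y \<le> 1"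
  by (auto simp: accept_prob_def)

text \<open>A closed subspace covers the whole space and the ranges of the projections. Closedness
  makes the measurable sets of the noise Borel, and linearity keeps proposals inside.\<close>

locale pcn_chain = pcn_potential \<Phi> \<delta> \<rho> R \<alpha>\<^sub>l r a
  for \<Phi> :: "'a::{real_inner, complete_space, second_countable_topology} \<Rightarrow> real"
    and \<delta> \<rho> R \<alpha>\<^sub>l r a :: real +
  fixes S :: "'a set" and \<gamma> :: "'a measure"
  assumes subspace: "subspace S" and closed: "closed S"
    and sets_noise: "sets \<gamma> = sets (restrict_space borel S)" and prob_noise: "prob_space \<gamma>"
begin

abbreviation "step \<equiv> pcn_step \<delta> \<Phi>"
abbreviation "transition \<equiv> pcn_kernel \<delta> \<Phi> \<gamma>"
abbreviation "coupling \<equiv> pcn_coupling \<delta> \<Phi> \<gamma>"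
abbreviation "driver \<equiv> \<gamma> \<Otimes>\<^sub>M unif"

sublocale noise: prob_space \<gamma> by (rule prob_noise)
sublocale unif: prob_space unif by (rule prob_space_unif)
sublocale noise_unif: pair_prob_space \<gamma> unif ..

lemma space_noise: "space \<gamma> = S"
  using sets_eq_imp_space_eq[OF sets_noise] by (simp add: space_restrict_space)

lemma sets_noise_iff: "A \<in> sets \<gamma> \<longleftrightarrow> A \<in> sets borel \<and> A \<subseteq> S"
  unfolding sets_noise by (subst sets_restrict_space_iff) (use closed in \<open>auto intro!: borel_closed\<close>)

lemma noise_to_borel: "f \<in> M \<rightarrow>\<^sub>M \<gamma> \<Longrightarrow> f \<in> M \<rightarrow>\<^sub>M borel"
  by (simp add: measurable_cong_sets[OF refl sets_noise] measurable_restrict_space2_iff)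

lemma noise_from_borel: "f \<in> borel \<rightarrow>\<^sub>M N \<Longrightarrow> f \<in> \<gamma> \<rightarrow>\<^sub>M N"
  by (simp add: measurable_cong_sets[OF sets_noise refl] measurable_restrict_space1)

lemma measurable_noiseI: "f \<in> M \<rightarrow>\<^sub>M borel \<Longrightarrow> (\<And>x. x \<in> space M \<Longrightarrow> f x \<in> S) \<Longrightarrow> f \<in> M \<rightarrow>\<^sub>M \<gamma>"
  by (subst measurable_cong_sets[OF refl sets_noise]) (auto intro: measurable_restrict_space2)

lemma norm_noise_measurable [measurable (raw)]:
  "f \<in> M \<rightarrow>\<^sub>M \<gamma> \<Longrightarrow> (\<lambda>x. norm (f x)) \<in> borel_measurable M"
  by (drule noise_to_borel) simp

lemma step_borel: "(\<lambda>(x, \<omega>). step x \<omega>) \<in> borel \<Otimes>\<^sub>M (borel \<Otimes>\<^sub>M borel) \<rightarrow>\<^sub>M borel"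
  unfolding pcn_step_def accept_prob_def Let_def by measurable

lemma step_in: "x \<in> S \<Longrightarrow> fst \<omega> \<in> S \<Longrightarrow> step x \<omega> \<in> S"
  using subspace by (auto simp: pcn_step_def Let_def intro: subspace_add subspace_scale)

lemma step_measurable [measurable (raw)]:
  assumes f: "f \<in> M \<rightarrow>\<^sub>M \<gamma>" and g: "g \<in> M \<rightarrow>\<^sub>M driver"
  shows "(\<lambda>x. step (f x) (g x)) \<in> M \<rightarrow>\<^sub>M \<gamma>"
proof (rule measurable_noiseI)
  have "(\<lambda>x. (f x, (fst (g x), snd (g x)))) \<in> M \<rightarrow>\<^sub>M borel \<Otimes>\<^sub>M (borel \<Otimes>\<^sub>M borel)"
  proof (intro measurable_Pair noise_to_borel f)
    show "(\<lambda>x. fst (g x)) \<in> M \<rightarrow>\<^sub>M \<gamma>" using g by measurable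
    show "(\<lambda>x. snd (g x)) \<in> M \<rightarrow>\<^sub>M borel"
      using measurable_compose[OF g measurable_snd] by (simp add: measurable_cong_sets[OF refl sets_unif])
  qed
  from measurable_compose[OF this step_borel] show "(\<lambda>x. step (f x) (g x)) \<in> M \<rightarrow>\<^sub>M borel" by simp
  fix x assume "x \<in> space M"
  then show "step (f x) (g x) \<in> S"
    using measurable_space[OF f, of x] measurable_space[OF g, of x]
    by (intro step_in) (auto simp: space_noise space_pair_measure mem_Times_iff)
qed

lemma proposal_in: "x \<in> S \<Longrightarrow> \<xi> \<in> S \<Longrightarrow> pcn_proposal \<delta> x \<xi> \<in> S"
  using subspace by (auto intro: subspace_add subspace_scale)

lemma emeasure_step:
  assumes x: "x \<in> S" and \<xi>: "\<xi> \<in> S"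
  shows "emeasure unif ((\<lambda>u. step x (\<xi>, u)) -` A)
    = ennreal (accept_prob \<Phi> x (pcn_proposal \<delta> x \<xi>)) * indicator A (pcn_proposal \<delta> x \<xi>)
      + ennreal (1 - accept_prob \<Phi> x (pcn_proposal \<delta> x \<xi>)) * indicator A x"
proof -
  let ?p = "pcn_proposal \<delta> x \<xi>"
  let ?a = "accept_prob \<Phi> x ?p"
  have "(\<lambda>u. step x (\<xi>, u)) -` A = {u. (if u \<le> ?a then ?p \<in> A else x \<in> A)}"
    by (auto simp: pcn_step_def Let_def)
  also have "\<dots> = (if ?p \<in> A then (if x \<in> A then UNIV else {..?a}) else (if x \<in> A then {?a<..} else {}))"
    by auto
  moreover have "ennreal ?a + ennreal (1 - ?a) = 1" by (subst ennreal_plus[symmetric]) auto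
  ultimately show ?thesis
    using unif.emeasure_space_1 by (auto simp: emeasure_unif_atMost emeasure_unif_greaterThan)
qed

text \<open>For fixed noise, a Bernoulli decision and a uniform threshold give the same two-point
  law; integrating over the noise then yields an image of the product measure by Fubini.\<close>

lemma transition_eq_distr:
  assumes x: "x \<in> S"
  shows "transition x = distr driver \<gamma> (step x)"
proof -
  have xs[measurable]: "x \<in> space \<gamma>" using x by (simp add: space_noise)
  let ?f = "\<lambda>\<xi>. measure_pmf (bernoulli_pmf (accept_prob \<Phi> x (pcn_proposal \<delta> x \<xi>))) \<bind> (\<lambda>c. return \<gamma> (if c then pcn_proposal \<delta> x \<xi> else x))"
  let ?g = "\<lambda>\<xi>. distr unif \<gamma> (\<lambda>u. step x (\<xi>, u))"
  have [measurable]: "(\<lambda>u. step x (\<xi>, u)) \<in> unif \<rightarrow>\<^sub>M \<gamma>" if "\<xi> \<in> space \<gamma>" for \<xi>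
    using that by measurable
  have fg: "?f \<xi> = ?g \<xi>" if \<xi>: "\<xi> \<in> space \<gamma>" for \<xi>
  proof (rule measure_eqI)
    let ?p = "pcn_proposal \<delta> x \<xi>"
    let ?a = "accept_prob \<Phi> x ?p"
    have ps: "?p \<in> space \<gamma>" using \<xi> x proposal_in by (simp add: space_noise)
    have K: "(\<lambda>c. return \<gamma> (if c then ?p else x)) \<in> measure_pmf (bernoulli_pmf ?a) \<rightarrow>\<^sub>M subprob_algebra \<gamma>"
      unfolding measurable_pmf_measure1 using ps xs by (auto simp: space_subprob_algebra prob_space_imp_subprob_space prob_space_return)
    show sets: "sets (?f \<xi>) = sets (?g \<xi>)"
      using sets_bind_measurable[OF K] by simp
    fix A assume "A \<in> sets (?f \<xi>)"
    then have A[measurable]: "A \<in> sets \<gamma>" using sets by simp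
    have "emeasure (?f \<xi>) A = (\<integral>\<^sup>+c. emeasure (return \<gamma> (if c then ?p else x)) A \<partial>measure_pmf (bernoulli_pmf ?a))"
      by (rule emeasure_bind[OF _ K A]) simp
    also have "\<dots> = ennreal ?a * indicator A ?p + ennreal (1 - ?a) * indicator A x"
      using ps xs A by (simp add: mult.commute)
    also have "\<dots> = emeasure unif ((\<lambda>u. step x (\<xi>, u)) -` A \<inter> space unif)"
      using emeasure_step[OF x, of \<xi> A] \<xi> by (simp add: space_noise)
    also have "\<dots> = emeasure (?g \<xi>) A" using \<xi> by (subst emeasure_distr) auto
    finally show "emeasure (?f \<xi>) A = emeasure (?g \<xi>) A" .
  qed
  have G: "?g \<in> \<gamma> \<rightarrow>\<^sub>M subprob_algebra \<gamma>"
  proof (rule measurable_distr2)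
    show "(\<lambda>(\<xi>, u). step x (\<xi>, u)) \<in> driver \<rightarrow>\<^sub>M \<gamma>" by measurable
    show "(\<lambda>\<xi>. unif) \<in> \<gamma> \<rightarrow>\<^sub>M subprob_algebra unif"
      using prob_space_unif by (intro measurable_const) (simp add: space_subprob_algebra prob_space_imp_subprob_space)
  qed
  have "transition x = \<gamma> \<bind> ?f" by (simp add: pcn_kernel_def Let_def)
  also have "\<dots> = \<gamma> \<bind> ?g" by (rule bind_cong[OF refl fg])
  also have "\<dots> = distr driver \<gamma> (step x)"
  proof (rule measure_eqI)
    show sets: "sets (\<gamma> \<bind> ?g) = sets (distr driver \<gamma> (step x))"
      using sets_bind_measurable[OF G noise.not_empty] by simp
    fix A assume "A \<in> sets (\<gamma> \<bind> ?g)"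
    then have A[measurable]: "A \<in> sets \<gamma>" using sets by simp
    have "emeasure (\<gamma> \<bind> ?g) A = (\<integral>\<^sup>+\<xi>. emeasure (?g \<xi>) A \<partial>\<gamma>)"
      by (rule emeasure_bind[OF noise.not_empty G A])
    also have "\<dots> = (\<integral>\<^sup>+\<xi>. emeasure unif (Pair \<xi> -` (step x -` A \<inter> space driver)) \<partial>\<gamma>)"
      by (intro nn_integral_cong, subst emeasure_distr)
        (auto simp: space_pair_measure intro!: arg_cong[where f="emeasure unif"])
    also have "\<dots> = emeasure driver (step x -` A \<inter> space driver)"
      by (rule unif.emeasure_pair_measure_alt[symmetric]) measurable
    also have "\<dots> = emeasure (distr driver \<gamma> (step x)) A"
      by (subst emeasure_distr) auto
    finally show "emeasure (\<gamma> \<bind> ?g) A = emeasure (distr driver \<gamma> (step x)) A" .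
  qed
  finally show ?thesis .
qed

lemma prob_noise_unif: "(\<lambda>_. driver) \<in> M \<rightarrow>\<^sub>M prob_algebra driver"
  using noise_unif.prob_space_axioms by (intro measurable_const) (simp add: space_prob_algebra)

lemma transition_measurable [measurable]: "transition \<in> \<gamma> \<rightarrow>\<^sub>M prob_algebra \<gamma>"
proof -
  have "(\<lambda>x. distr driver \<gamma> (step x)) \<in> \<gamma> \<rightarrow>\<^sub>M prob_algebra \<gamma>"
    by (rule measurable_distr_prob_space2[OF prob_noise_unif]) measurable
  then show ?thesis
    by (rule measurable_cong[THEN iffD1, rotated]) (simp add: transition_eq_distr space_noise)
qed

section \<open>The coupled kernel and its action on functions\<close>

lemma coupling_measurable [measurable]: "coupling \<in> \<gamma> \<Otimes>\<^sub>M \<gamma> \<rightarrow>\<^sub>M prob_algebra (\<gamma> \<Otimes>\<^sub>M \<gamma>)"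
  unfolding pcn_coupling_def[abs_def]
  by (rule measurable_distr_prob_space2[OF prob_noise_unif]) measurable

lemma distr_coupling:
  assumes "z \<in> space (\<gamma> \<Otimes>\<^sub>M \<gamma>)"
  shows "distr (coupling z) \<gamma> fst = transition (fst z)" "distr (coupling z) \<gamma> snd = transition (snd z)"
proof -
  have [measurable]: "fst z \<in> space \<gamma>" "snd z \<in> space \<gamma>" using assms by (auto simp: space_pair_measure)
  then have "fst z \<in> S" "snd z \<in> S" by (simp_all add: space_noise)
  then show "distr (coupling z) \<gamma> fst = transition (fst z)" "distr (coupling z) \<gamma> snd = transition (snd z)"
    unfolding pcn_coupling_def by (subst distr_distr; simp add: transition_eq_distr o_def)+
qed

lemma distr_bind_coupling:
  assumes \<pi>: "\<pi> \<in> space (prob_algebra (\<gamma> \<Otimes>\<^sub>M \<gamma>))"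
  shows "distr (\<pi> \<bind> coupling) \<gamma> fst = distr \<pi> \<gamma> fst \<bind> transition"
    and "distr (\<pi> \<bind> coupling) \<gamma> snd = distr \<pi> \<gamma> snd \<bind> transition"
proof -
  have [measurable_cong]: "sets \<pi> = sets (\<gamma> \<Otimes>\<^sub>M \<gamma>)" and "prob_space \<pi>" using \<pi> by (auto simp: space_prob_algebra)
  then interpret \<pi>: prob_space \<pi> by simp
  have sp: "space \<pi> = space (\<gamma> \<Otimes>\<^sub>M \<gamma>)" by (rule sets_eq_imp_space_eq) fact
  have Q: "coupling \<in> \<pi> \<rightarrow>\<^sub>M subprob_algebra (\<gamma> \<Otimes>\<^sub>M \<gamma>)" by (rule measurable_prob_algebraD) measurable
  have P: "transition \<in> \<gamma> \<rightarrow>\<^sub>M subprob_algebra \<gamma>" by (rule measurable_prob_algebraD) measurable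
  have "distr (\<pi> \<bind> coupling) \<gamma> fst = \<pi> \<bind> (\<lambda>z. distr (coupling z) \<gamma> fst)"
    by (rule distr_bind[OF Q \<pi>.not_empty]) simp
  also have "\<dots> = \<pi> \<bind> (\<lambda>z. transition (fst z))" by (rule bind_cong[OF refl]) (simp add: distr_coupling sp)
  also have "\<dots> = distr \<pi> \<gamma> fst \<bind> transition" by (rule bind_distr[OF _ P \<pi>.not_empty, symmetric]) simp
  finally show "distr (\<pi> \<bind> coupling) \<gamma> fst = distr \<pi> \<gamma> fst \<bind> transition" .
  have "distr (\<pi> \<bind> coupling) \<gamma> snd = \<pi> \<bind> (\<lambda>z. distr (coupling z) \<gamma> snd)"
    by (rule distr_bind[OF Q \<pi>.not_empty]) simp
  also have "\<dots> = \<pi> \<bind> (\<lambda>z. transition (snd z))" by (rule bind_cong[OF refl]) (simp add: distr_coupling sp)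
  also have "\<dots> = distr \<pi> \<gamma> snd \<bind> transition" by (rule bind_distr[OF _ P \<pi>.not_empty, symmetric]) simp
  finally show "distr (\<pi> \<bind> coupling) \<gamma> snd = distr \<pi> \<gamma> snd \<bind> transition" .
qed

lemma bind_coupling_in:
  assumes "\<pi> \<in> space (prob_algebra (\<gamma> \<Otimes>\<^sub>M \<gamma>))"
  shows "\<pi> \<bind> coupling \<in> space (prob_algebra (\<gamma> \<Otimes>\<^sub>M \<gamma>))"
  using prob_space_bind'[OF assms coupling_measurable] sets_bind'[OF assms coupling_measurable]
  by (simp add: space_prob_algebra)

lemma kernel_iterate_Suc: "kernel_iterate K (Suc n) \<nu> = kernel_iterate K n \<nu> \<bind> K"
  by (simp add: kernel_iterate_def)

lemma kernel_iterate_0: "kernel_iterate K 0 \<nu> = \<nu>"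
  by (simp add: kernel_iterate_def)

lemma kernel_iterate_coupling:
  assumes \<pi>: "\<pi> \<in> space (prob_algebra (\<gamma> \<Otimes>\<^sub>M \<gamma>))"
  shows "kernel_iterate coupling n \<pi> \<in> space (prob_algebra (\<gamma> \<Otimes>\<^sub>M \<gamma>))
    \<and> distr (kernel_iterate coupling n \<pi>) \<gamma> fst = kernel_iterate transition n (distr \<pi> \<gamma> fst)
    \<and> distr (kernel_iterate coupling n \<pi>) \<gamma> snd = kernel_iterate transition n (distr \<pi> \<gamma> snd)"
  by (induction n) (simp_all add: kernel_iterate_Suc kernel_iterate_0 \<pi> bind_coupling_in distr_bind_coupling)

text \<open>Defined on arbitrary functions as a lower integral, so that it can be iterated on the
  path distance although neither the distance nor the iterates are known to be measurable.\<close>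

definition pair_op :: "('a \<times> 'a \<Rightarrow> ennreal) \<Rightarrow> 'a \<times> 'a \<Rightarrow> ennreal" where
  "pair_op f z = (\<integral>\<^sup>+w. f w \<partial>coupling z)"

lemma space_coupling: "space (coupling z) = S \<times> S"
  by (simp add: pcn_coupling_def space_pair_measure space_noise)

lemma pair_op_mono: "(\<And>z. z \<in> S \<times> S \<Longrightarrow> f z \<le> g z) \<Longrightarrow> pair_op f z \<le> pair_op g z"
  unfolding pair_op_def by (intro nn_integral_mono) (simp add: space_coupling)

lemma pair_op_iter_mono: "(\<And>z. z \<in> S \<times> S \<Longrightarrow> f z \<le> g z) \<Longrightarrow> z \<in> S \<times> S \<Longrightarrow> (pair_op ^^ n) f z \<le> (pair_op ^^ n) g z"
  by (induction n arbitrary: z) (auto intro!: pair_op_mono)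

lemma pair_op_pow_Suc: "(pair_op ^^ Suc n) f z = pair_op ((pair_op ^^ n) f) z"
  by simp

lemma coupling_prob: "z \<in> S \<times> S \<Longrightarrow> prob_space (coupling z)"
  using measurable_space[OF coupling_measurable, of z] by (simp add: space_prob_algebra space_pair_measure space_noise)

lemma sets_coupling [measurable_cong]: "sets (coupling z) = sets (\<gamma> \<Otimes>\<^sub>M \<gamma>)"
  by (simp add: pcn_coupling_def)

lemma pair_op_pow_le_1:
  assumes "\<And>z. z \<in> S \<times> S \<Longrightarrow> f z \<le> 1" "z \<in> S \<times> S"
  shows "(pair_op ^^ n) f z \<le> 1"
  using assms(2)
proof (induction n arbitrary: z)
  case (Suc n)
  have "pair_op ((pair_op ^^ n) f) z \<le> pair_op (\<lambda>_. 1) z"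
    by (intro pair_op_mono Suc.IH)
  then show ?case
    using coupling_prob[OF Suc.prems] by (simp add: pair_op_def[of "\<lambda>_. 1"] prob_space.emeasure_space_1)
qed (use assms(1) in simp)

lemma pair_op_cmult: "0 \<le> c \<Longrightarrow> pair_op (\<lambda>z. ennreal c * f z) z \<le> ennreal c * pair_op f z"
  unfolding pair_op_def by (rule nn_integral_cmult_le)

lemma pair_op_step_le:
  assumes "z \<in> S \<times> S"
  shows "pair_op f z \<le> (\<integral>\<^sup>+\<omega>. f (step (fst z) \<omega>, step (snd z) \<omega>) \<partial>driver)"
proof -
  have [measurable]: "fst z \<in> space \<gamma>" "snd z \<in> space \<gamma>" using assms by (auto simp: space_noise)
  show ?thesis unfolding pair_op_def pcn_coupling_def by (rule nn_integral_distr_le) measurable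
qed

text \<open>Duality between moving the measure forward and the function backward; the last step of
  the iterate is the first to be transferred. With lower integrals it is an inequality, in the
  direction needed for upper bounds on costs.\<close>

lemma nn_integral_kernel_iterate_le:
  assumes \<pi>: "\<pi> \<in> space (prob_algebra (\<gamma> \<Otimes>\<^sub>M \<gamma>))"
  shows "(\<integral>\<^sup>+z. f z \<partial>kernel_iterate coupling n \<pi>) \<le> (\<integral>\<^sup>+z. (pair_op ^^ n) f z \<partial>\<pi>)"
proof (induction n arbitrary: f)
  case (Suc n)
  let ?K = "kernel_iterate coupling n \<pi>"
  have K: "?K \<in> space (prob_algebra (\<gamma> \<Otimes>\<^sub>M \<gamma>))" using kernel_iterate_coupling[OF \<pi>] by simp
  then have [measurable_cong]: "sets ?K = sets (\<gamma> \<Otimes>\<^sub>M \<gamma>)" and "prob_space ?K" by (auto simp: space_prob_algebra)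
  then interpret K: prob_space ?K by simp
  have "(\<integral>\<^sup>+z. f z \<partial>kernel_iterate coupling (Suc n) \<pi>) \<le> (\<integral>\<^sup>+z. pair_op f z \<partial>?K)"
    unfolding kernel_iterate_Suc pair_op_def
    by (rule nn_integral_bind_le[OF measurable_prob_algebraD K.not_empty]) measurable
  also have "\<dots> \<le> (\<integral>\<^sup>+z. (pair_op ^^ n) (pair_op f) z \<partial>\<pi>)" by (rule Suc)
  finally show ?case by (simp add: funpow_swap1)
qed (simp add: kernel_iterate_0)

text \<open>The coupled kernel carries every coupling of the initial measures to a coupling of the
  iterates, at no more than half the cost.\<close>

lemma transport_cost_le:
  assumes D: "\<And>z. z \<in> S \<times> S \<Longrightarrow> (pair_op ^^ n) (\<lambda>(x, y). ennreal (D x y)) z \<le> ennreal (1 / 2) * (\<lambda>(x, y). ennreal (D x y)) z"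
    and \<nu>: "\<nu>1 \<in> space (prob_algebra \<gamma>)" "\<nu>2 \<in> space (prob_algebra \<gamma>)"
  shows "transport_cost D (kernel_iterate transition n \<nu>1) (kernel_iterate transition n \<nu>2)
     \<le> 1 / 2 * transport_cost D \<nu>1 \<nu>2"
proof -
  have half: "ennreal (1 / 2) = 1 / 2" by (simp add: ennreal_divide_numeral[symmetric] del: ennreal_half)
  have two: "(2 :: ennreal) * (ennreal (1 / 2) * y) = y" "ennreal (1 / 2) * (2 * y) = y" for y
  proof -
    have "(2 :: ennreal) * ennreal (1 / 2) = 1"
      by (subst ennreal_numeral[symmetric], subst ennreal_mult[symmetric]) auto
    then show "(2 :: ennreal) * (ennreal (1 / 2) * y) = y" "ennreal (1 / 2) * (2 * y) = y"
      by (metis mult.assoc mult.commute mult_1_left)+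
  qed
  let ?f = "\<lambda>(x, y). ennreal (D x y)"
  have s: "sets \<nu>1 = sets \<gamma>" "sets \<nu>2 = sets \<gamma>" using \<nu> by (auto simp: space_prob_algebra)
  have itsets: "sets (kernel_iterate transition n \<nu>) = sets \<gamma>" if "\<nu> \<in> space (prob_algebra \<gamma>)" for \<nu>
  proof -
    have "kernel_iterate transition n \<nu> \<in> space (prob_algebra \<gamma>)"
    proof (induction n)
      case (Suc n)
      then show ?case
        using prob_space_bind'[OF Suc transition_measurable] sets_bind'[OF Suc transition_measurable]
        by (simp add: kernel_iterate_Suc space_prob_algebra)
    qed (simp add: kernel_iterate_0 that)
    then show ?thesis by (simp add: space_prob_algebra)
  qed
  note s' = itsets[OF \<nu>(1)] itsets[OF \<nu>(2)]
  \<comment> \<open>The factor is moved to the left so that the infimum over the initial couplings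
    stands alone and can be treated by its universal property.\<close>
  have "2 * transport_cost D (kernel_iterate transition n \<nu>1) (kernel_iterate transition n \<nu>2) \<le> transport_cost D \<nu>1 \<nu>2"
    unfolding transport_cost_def[of D \<nu>1 \<nu>2]
  proof (rule INF_greatest)
    fix \<pi> assume "\<pi> \<in> couplings \<nu>1 \<nu>2"
    then have \<pi>: "\<pi> \<in> space (prob_algebra (\<gamma> \<Otimes>\<^sub>M \<gamma>))" and m: "distr \<pi> \<gamma> fst = \<nu>1" "distr \<pi> \<gamma> snd = \<nu>2"
      unfolding couplings_def
      using distr_cong[OF refl s(1), of \<pi> fst fst] distr_cong[OF refl s(2), of \<pi> snd snd]
      by (auto simp: space_prob_algebra sets_pair_measure_cong[OF s])
    have "kernel_iterate coupling n \<pi> \<in> couplings (kernel_iterate transition n \<nu>1) (kernel_iterate transition n \<nu>2)"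
      unfolding couplings_def
      using kernel_iterate_coupling[OF \<pi>, of n] m
        distr_cong[OF refl s'(1), of "kernel_iterate coupling n \<pi>" fst fst] distr_cong[OF refl s'(2), of "kernel_iterate coupling n \<pi>" snd snd]
      by (auto simp: space_prob_algebra sets_pair_measure_cong[OF s'])
    then have "transport_cost D (kernel_iterate transition n \<nu>1) (kernel_iterate transition n \<nu>2) \<le> (\<integral>\<^sup>+z. ?f z \<partial>kernel_iterate coupling n \<pi>)"
      unfolding transport_cost_def by (rule INF_lower)
    also have "\<dots> \<le> (\<integral>\<^sup>+z. (pair_op ^^ n) ?f z \<partial>\<pi>)" by (rule nn_integral_kernel_iterate_le[OF \<pi>])
    also have "\<dots> \<le> (\<integral>\<^sup>+z. ennreal (1 / 2) * ?f z \<partial>\<pi>)"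
    proof (intro nn_integral_mono D)
      fix z assume "z \<in> space \<pi>"
      then show "z \<in> S \<times> S" using \<pi> sets_eq_imp_space_eq[of \<pi> "\<gamma> \<Otimes>\<^sub>M \<gamma>"]
        by (simp add: space_prob_algebra space_pair_measure space_noise)
    qed
    also have "\<dots> \<le> ennreal (1 / 2) * (\<integral>\<^sup>+z. ?f z \<partial>\<pi>)" by (rule nn_integral_cmult_le) simp
    finally have "2 * transport_cost D (kernel_iterate transition n \<nu>1) (kernel_iterate transition n \<nu>2) \<le> 2 * (ennreal (1 / 2) * (\<integral>\<^sup>+z. ?f z \<partial>\<pi>))"
      by (intro mult_left_mono) auto
    then show "2 * transport_cost D (kernel_iterate transition n \<nu>1) (kernel_iterate transition n \<nu>2) \<le> (\<integral>\<^sup>+z. ?f z \<partial>\<pi>)"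
      by (simp only: two)
  qed
  from mult_left_mono[OF this, of "ennreal (1 / 2)"]
  show ?thesis unfolding half[symmetric] by (simp only: two zero_le simp_thms)
qed

end

section \<open>The weak Harris theorem\<close>

context pcn_chain
begin

lemma pair_op_add_affine:
  assumes U[measurable]: "U \<in> borel_measurable (\<gamma> \<Otimes>\<^sub>M \<gamma>)" and U0: "\<And>z. z \<in> S \<times> S \<Longrightarrow> 0 \<le> U z"
    and UT: "\<And>z. z \<in> S \<times> S \<Longrightarrow> pair_op (\<lambda>z. ennreal (U z)) z \<le> ennreal (l * U z + K)"
    and st: "0 \<le> s" "0 \<le> t" "0 \<le> b" "0 \<le> l" "0 \<le> K" and z: "z \<in> S \<times> S"
  shows "pair_op (\<lambda>z. ennreal s * f z + ennreal (t * U z + b)) z \<le> ennreal s * pair_op f z + ennreal (t * (l * U z + K) + b)"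
proof -
  interpret prob_space "coupling z" by (rule coupling_prob[OF z])
  have "pair_op (\<lambda>z. ennreal s * f z + ennreal (t * U z + b)) z
      \<le> pair_op (\<lambda>z. ennreal s * f z) z + pair_op (\<lambda>z. ennreal (t * U z + b)) z"
    unfolding pair_op_def by (rule nn_integral_add_le) auto
  also have "pair_op (\<lambda>z. ennreal s * f z) z \<le> ennreal s * pair_op f z" by (rule pair_op_cmult) fact
  also have "pair_op (\<lambda>z. ennreal (t * U z + b)) z = (\<integral>\<^sup>+w. ennreal t * ennreal (U w) + ennreal b \<partial>coupling z)"
    unfolding pair_op_def using st U0
    by (intro nn_integral_cong) (simp add: space_coupling ennreal_mult)
  also have "\<dots> = ennreal t * pair_op (\<lambda>z. ennreal (U z)) z + ennreal b"
    unfolding pair_op_def by (subst nn_integral_add) (auto simp: nn_integral_cmult emeasure_space_1)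
  also have "\<dots> \<le> ennreal t * ennreal (l * U z + K) + ennreal b"
    using UT[OF z] by (intro add_mono mult_left_mono) auto
  also have "\<dots> = ennreal (t * (l * U z + K) + b)"
    using st U0[OF z] by (simp add: ennreal_mult)
  finally show ?thesis by (simp add: add_left_mono)
qed

text \<open>By the drift inequality affine functions of \<open>U\<close> are mapped below affine
  functions of \<open>U\<close>, so that the measurable part can be split off anew at every step and
  \<open>f\<close> is iterated on its own.\<close>

lemma pair_op_pow_affine:
  assumes U: "U \<in> borel_measurable (\<gamma> \<Otimes>\<^sub>M \<gamma>)" and U0: "\<And>z. z \<in> S \<times> S \<Longrightarrow> 0 \<le> U z"
    and UT: "\<And>z. z \<in> S \<times> S \<Longrightarrow> pair_op (\<lambda>z. ennreal (U z)) z \<le> ennreal (l * U z + K)"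
    and st: "0 \<le> s" "0 \<le> t" "0 \<le> b" "0 \<le> l" "0 \<le> K" and z: "z \<in> S \<times> S"
  shows "(pair_op ^^ n) (\<lambda>z. ennreal s * f z + ennreal (t * U z + b)) z
    \<le> ennreal s * (pair_op ^^ n) f z + ennreal (t * (l ^ n * U z + K * (\<Sum>j<n. l ^ j)) + b)"
  using z
proof (induction n arbitrary: z)
  case (Suc n)
  have c: "t * (l ^ n * w + K * (\<Sum>j<n. l ^ j)) + b = (t * l ^ n) * w + (t * K * (\<Sum>j<n. l ^ j) + b)" for w
    by (simp add: algebra_simps)
  have "(pair_op ^^ Suc n) (\<lambda>z. ennreal s * f z + ennreal (t * U z + b)) z
      \<le> pair_op (\<lambda>z. ennreal s * (pair_op ^^ n) f z + ennreal ((t * l ^ n) * U z + (t * K * (\<Sum>j<n. l ^ j) + b))) z"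
    unfolding pair_op_pow_Suc by (rule pair_op_mono) (use Suc.IH c in simp)
  also have "\<dots> \<le> ennreal s * pair_op ((pair_op ^^ n) f) z + ennreal ((t * l ^ n) * (l * U z + K) + (t * K * (\<Sum>j<n. l ^ j) + b))"
  proof (rule pair_op_add_affine[OF U U0 UT])
    have "0 \<le> (\<Sum>j<n. l ^ j)" using st by (intro sum_nonneg) auto
    then show "0 \<le> t * K * (\<Sum>j<n. l ^ j) + b" using st by simp
  qed (use st Suc.prems in auto)
  also have "(t * l ^ n) * (l * U z + K) + (t * K * (\<Sum>j<n. l ^ j) + b) = t * (l ^ Suc n * U z + K * (\<Sum>j<Suc n. l ^ j)) + b"
    by (simp add: algebra_simps)
  finally show ?case by simp
qed simp

lemma sqrt_mult_le_weighted:
  assumes "0 < \<sigma>" "0 \<le> x" "0 \<le> (y::real)"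
  shows "sqrt (x * y) \<le> \<sigma> / 2 * x + y / (2 * \<sigma>)"
proof (rule real_le_lsqrt)
  have "0 \<le> (\<sigma> / 2 * x - y / (2 * \<sigma>))\<^sup>2" by simp
  then show "x * y \<le> (\<sigma> / 2 * x + y / (2 * \<sigma>))\<^sup>2"
    using assms(1) by (simp add: power2_sum power2_diff)
qed (use assms in auto)

text \<open>Plays the part of Cauchy-Schwarz for the lower integral: under the iterated operator the
  two factors under the root may be bounded separately.\<close>

lemma pair_op_pow_sqrt:
  assumes U: "U \<in> borel_measurable (\<gamma> \<Otimes>\<^sub>M \<gamma>)" and U0: "\<And>z. z \<in> S \<times> S \<Longrightarrow> 0 \<le> U z"
    and UT: "\<And>z. z \<in> S \<times> S \<Longrightarrow> pair_op (\<lambda>z. ennreal (U z)) z \<le> ennreal (l * U z + K)"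
    and st: "0 \<le> \<beta>" "0 \<le> l" "0 \<le> K" and z: "z \<in> S \<times> S"
    and d0: "\<And>z. z \<in> S \<times> S \<Longrightarrow> 0 \<le> d z"
    and D: "0 < D" "(pair_op ^^ n) (\<lambda>z. ennreal (d z)) z \<le> ennreal D"
  shows "(pair_op ^^ n) (\<lambda>z. ennreal (sqrt (d z * (1 + \<beta> * U z)))) z
     \<le> ennreal (sqrt (D * (1 + \<beta> * (l ^ n * U z + K * (\<Sum>j<n. l ^ j)))))"
proof -
  define B where "B = 1 + \<beta> * (l ^ n * U z + K * (\<Sum>j<n. l ^ j))"
  have "B \<ge> 1" using st U0[OF z] by (auto simp: B_def intro!: mult_nonneg_nonneg add_nonneg_nonneg sum_nonneg)
  \<comment> \<open>This weight minimises \<open>\<sigma> / 2 * D + B / (2 * \<sigma>)\<close>; the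
    minimum is \<open>sqrt (D * B)\<close>. The choice requires \<open>D > 0\<close>.\<close>
  define \<sigma> where "\<sigma> = sqrt (B / D)"
  have \<sigma>: "\<sigma> > 0" using D(1) \<open>B \<ge> 1\<close> by (simp add: \<sigma>_def)
  have "(pair_op ^^ n) (\<lambda>z. ennreal (sqrt (d z * (1 + \<beta> * U z)))) z
    \<le> (pair_op ^^ n) (\<lambda>z. ennreal (\<sigma> / 2) * ennreal (d z) + ennreal ((\<beta> / (2 * \<sigma>)) * U z + 1 / (2 * \<sigma>))) z"
  proof (rule pair_op_iter_mono[OF _ z])
    fix w assume w: "w \<in> S \<times> S"
    have "sqrt (d w * (1 + \<beta> * U w)) \<le> \<sigma> / 2 * d w + (1 + \<beta> * U w) / (2 * \<sigma>)"
      using \<sigma> d0[OF w] U0[OF w] st by (intro sqrt_mult_le_weighted) auto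
    also have "\<dots> = \<sigma> / 2 * d w + ((\<beta> / (2 * \<sigma>)) * U w + 1 / (2 * \<sigma>))" by (simp add: add_divide_distrib)
    finally have "ennreal (sqrt (d w * (1 + \<beta> * U w))) \<le> ennreal (\<sigma> / 2 * d w + ((\<beta> / (2 * \<sigma>)) * U w + 1 / (2 * \<sigma>)))"
      by (rule ennreal_leI)
    also have "\<dots> = ennreal (\<sigma> / 2) * ennreal (d w) + ennreal ((\<beta> / (2 * \<sigma>)) * U w + 1 / (2 * \<sigma>))"
      using \<sigma> d0[OF w] U0[OF w] st by (subst ennreal_mult[symmetric]) (auto intro!: ennreal_plus)
    finally show "ennreal (sqrt (d w * (1 + \<beta> * U w))) \<le> \<dots>" .
  qed
  also have "\<dots> \<le> ennreal (\<sigma> / 2) * (pair_op ^^ n) (\<lambda>z. ennreal (d z)) z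
      + ennreal ((\<beta> / (2 * \<sigma>)) * (l ^ n * U z + K * (\<Sum>j<n. l ^ j)) + 1 / (2 * \<sigma>))"
    using \<sigma> st by (intro pair_op_pow_affine[OF U U0 UT] z) auto
  also have "\<dots> \<le> ennreal (\<sigma> / 2) * ennreal D + ennreal (B / (2 * \<sigma>))"
    using D(2) by (intro add_mono mult_left_mono ennreal_leI) (auto simp: B_def add_divide_distrib)
  also have "\<dots> = ennreal (\<sigma> / 2 * D + B / (2 * \<sigma>))"
    using \<sigma> D(1) \<open>B \<ge> 1\<close> by (subst ennreal_mult[symmetric]) (auto intro!: ennreal_plus[symmetric])
  also have "\<sigma> / 2 * D + B / (2 * \<sigma>) = sqrt (D * B)"
  proof -
    have "sqrt B * sqrt B = B" "sqrt D * sqrt D = D" using D(1) \<open>B \<ge> 1\<close> by auto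
    then have "sqrt B / sqrt D * D = sqrt B * sqrt D" "B / (sqrt B / sqrt D) = sqrt B * sqrt D"
      using D(1) \<open>B \<ge> 1\<close> by (auto simp: field_simps)
    then have "\<sigma> * D = sqrt B * sqrt D" "B / \<sigma> = sqrt B * sqrt D"
      by (simp_all add: \<sigma>_def real_sqrt_divide)
    moreover have "\<sigma> / 2 * D + B / (2 * \<sigma>) = (\<sigma> * D + B / \<sigma>) / 2" by (simp add: add_divide_distrib)
    ultimately have "\<sigma> / 2 * D + B / (2 * \<sigma>) = (sqrt B * sqrt D + sqrt B * sqrt D) / 2" by (simp only:)
    then show ?thesis by (simp add: real_sqrt_mult)
  qed
  finally show ?thesis by (simp add: B_def)
qed

text \<open>
  The factor \<open>\<beta>\<close> in front of the Lyapunov function is what allows the contraction of \<open>d\<close> to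
  absorb the additive constant of the drift condition.
\<close>

lemma weak_harris:
  assumes U: "U \<in> borel_measurable (\<gamma> \<Otimes>\<^sub>M \<gamma>)" and U0: "\<And>z. z \<in> S \<times> S \<Longrightarrow> 0 \<le> U z"
    and UT: "\<And>z. z \<in> S \<times> S \<Longrightarrow> pair_op (\<lambda>z. ennreal (U z)) z \<le> ennreal (l * U z + K)"
    and d01: "\<And>z. z \<in> S \<times> S \<Longrightarrow> 0 \<le> d z" "\<And>z. z \<in> S \<times> S \<Longrightarrow> d z \<le> 1"
    and dT: "\<And>z. z \<in> S \<times> S \<Longrightarrow> d z < 1 \<Longrightarrow> pair_op (\<lambda>z. ennreal (d z)) z \<le> ennreal ((1 - \<theta>1) * d z)"
    and l: "0 \<le> l" "l < 1" "0 \<le> K" and A: "A = K / (1 - l) + 1"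
    and N: "N \<ge> 1" "l ^ N \<le> 1 / 4"
    and small: "\<And>z. z \<in> S \<times> S \<Longrightarrow> U z \<le> 4 * A \<Longrightarrow> (pair_op ^^ N) (\<lambda>z. ennreal (d z)) z \<le> ennreal (1 - \<theta>2)"
    and \<theta>: "0 < \<theta>1" "\<theta>1 < 1" "0 < \<theta>2" "\<theta>2 < 1"
    and \<beta>: "0 < \<beta>" "\<beta> * A \<le> \<theta>1 / 2" "\<beta> * A \<le> \<theta>2 / 2"
    and \<alpha>: "(1 + 2 * \<beta> * A) / (1 + 4 * \<beta> * A) \<le> \<alpha>" "1 - \<theta>1 / 2 \<le> \<alpha>" "1 - \<theta>2 / 2 \<le> \<alpha>"
    and z: "z \<in> S \<times> S"
  shows "(pair_op ^^ N) (\<lambda>z. ennreal (sqrt (d z * (1 + \<beta> * U z)))) z \<le> ennreal (sqrt \<alpha> * sqrt (d z * (1 + \<beta> * U z)))"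
proof -
  let ?d = "\<lambda>z. ennreal (d z)"
  have A1: "A \<ge> 1" using l A by simp
  have one_le: "pair_op ?d w \<le> 1" if "w \<in> S \<times> S" for w
  proof -
    interpret prob_space "coupling w" by (rule coupling_prob[OF that])
    have "pair_op ?d w \<le> (\<integral>\<^sup>+w. 1 \<partial>coupling w)"
      unfolding pair_op_def using d01(2) by (intro nn_integral_mono) (auto simp: space_coupling)
    then show ?thesis by (simp add: emeasure_space_1)
  qed
  have d_le: "pair_op ?d w \<le> ?d w" if w: "w \<in> S \<times> S" for w
  proof (cases "d w < 1")
    case True
    have "(1 - \<theta>1) * d w \<le> d w" using d01(1)[OF w] \<theta> by (simp add: mult_left_le_one_le)
    then show ?thesis by (rule order_trans[OF dT[OF w True] ennreal_leI])
  next
    case False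
    then have "d w = 1" using d01(2)[OF w] by linarith
    then show ?thesis using one_le[OF w] by simp
  qed
  have pow_d: "(pair_op ^^ n) ?d w \<le> ?d w" if "w \<in> S \<times> S" for n w
    using that
  proof (induction n)
    case (Suc n)
    have "(pair_op ^^ Suc n) ?d w = (pair_op ^^ n) (pair_op ?d) w" by (simp add: funpow_swap1)
    also have "\<dots> \<le> (pair_op ^^ n) ?d w" using d_le Suc.prems by (intro pair_op_iter_mono)
    finally show ?case using Suc by simp
  qed simp
  define B where "B = 1 + \<beta> * (l ^ N * U z + K * (\<Sum>j<N. l ^ j))"
  define C where "C = 1 + \<beta> * U z"
  have Uz: "0 \<le> U z" by (rule U0[OF z])
  have C1: "1 \<le> C" using \<beta> Uz by (simp add: C_def)
  \<comment> \<open>The factor in front of \<open>U\<close> has dropped to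
    \<open>l ^ N \<le> 1 / 4\<close>, and the additive terms sum to at most a geometric series,
    which \<open>A\<close> dominates.\<close>
  have BA: "B \<le> 1 + \<beta> * (U z / 4 + A)"
  proof -
    have "(\<Sum>j<N. l ^ j) \<le> 1 / (1 - l)" using l by (subst sum_gp_strict) (auto intro!: divide_right_mono)
    then have "K * (\<Sum>j<N. l ^ j) \<le> K * (1 / (1 - l))" using l by (intro mult_left_mono) auto
    then have "K * (\<Sum>j<N. l ^ j) \<le> A" by (simp add: A)
    moreover have "l ^ N * U z \<le> 1 / 4 * U z" using N Uz by (intro mult_right_mono)
    ultimately show ?thesis unfolding B_def using \<beta> by (intro add_left_mono mult_left_mono) auto
  qed
  have B0: "0 \<le> B" unfolding B_def using l Uz \<beta> by (auto intro!: add_nonneg_nonneg mult_nonneg_nonneg sum_nonneg)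
  have BA2: "B \<le> (1 + \<beta> * A) * C"
  proof -
    have "0 \<le> \<beta> * A * (\<beta> * U z)" "0 \<le> \<beta> * U z" using \<beta> A1 Uz by auto
    then have "1 + \<beta> * (U z / 4 + A) \<le> (1 + \<beta> * A) * C"
      unfolding C_def by (simp add: algebra_simps)
    then show ?thesis using BA by linarith
  qed
  have main: "(pair_op ^^ N) (\<lambda>z. ennreal (sqrt (d z * (1 + \<beta> * U z)))) z \<le> ennreal (sqrt (D * B))"
    if "0 < D" "(pair_op ^^ N) ?d z \<le> ennreal D" for D
    unfolding B_def using \<beta> l d01(1) that by (intro pair_op_pow_sqrt[OF U U0 UT] z) auto
  \<comment> \<open>The gain \<open>\<theta>\<close> in the distance pays for the additive constant
    of the drift, as
    \<open>(1 - \<theta>) * (1 + \<theta> / 2) \<le> 1 - \<theta> / 2\<close>.\<close>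
  have shrink: "(1 - \<theta>) * B \<le> \<alpha> * C" if "0 < \<theta>" "\<theta> < 1" "\<beta> * A \<le> \<theta> / 2" "1 - \<theta> / 2 \<le> \<alpha>" for \<theta>
  proof -
    have "(1 - \<theta>) * B \<le> (1 - \<theta>) * ((1 + \<beta> * A) * C)" using BA2 that by (intro mult_left_mono) auto
    also have "\<dots> = ((1 - \<theta>) * (1 + \<beta> * A)) * C" by simp
    also have "\<dots> \<le> \<alpha> * C"
    proof (intro mult_right_mono)
      have "(1 - \<theta>) * (1 + \<beta> * A) \<le> (1 - \<theta>) * (1 + \<theta> / 2)" using that by (intro mult_left_mono) auto
      also have "\<dots> \<le> 1 - \<theta> / 2" using that(1) by (simp add: algebra_simps)
      finally show "(1 - \<theta>) * (1 + \<beta> * A) \<le> \<alpha>" using that by simp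
    qed (use C1 in auto)
    finally show ?thesis .
  qed
  \<comment> \<open>Three regimes: below \<open>1\<close> the distance itself contracts; at distance
    \<open>1\<close> with small \<open>U\<close> the hypothesis on bounded sets gives the gain after
    \<open>N\<close> steps; at distance \<open>1\<close> with large \<open>U\<close> the gain comes
    from the drift alone.\<close>
  have "\<exists>D\<ge>0. (pair_op ^^ N) ?d z \<le> ennreal D \<and> D * B \<le> \<alpha> * (d z * C)"
  proof (cases "d z < 1")
    case True
    obtain n where n: "N = Suc n" using N(1) by (cases N) auto
    have "(pair_op ^^ N) ?d z = (pair_op) ((pair_op ^^ n) ?d) z" by (simp add: n)
    also have "\<dots> \<le> pair_op ?d z" using pow_d by (rule pair_op_mono)
    also have "\<dots> \<le> ennreal ((1 - \<theta>1) * d z)" by (rule dT[OF z True])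
    finally have "(pair_op ^^ N) ?d z \<le> ennreal ((1 - \<theta>1) * d z)" .
    moreover have "((1 - \<theta>1) * d z) * B \<le> \<alpha> * (d z * C)"
      using mult_left_mono[OF shrink[OF \<theta>(1,2) \<beta>(2) \<alpha>(2)] d01(1)[OF z]] by (simp add: mult_ac)
    ultimately show ?thesis using d01(1)[OF z] \<theta> by (intro exI[of _ "(1 - \<theta>1) * d z"]) auto
  next
    case False
    then have d1: "d z = 1" using d01(2)[OF z] by simp
    show ?thesis
    proof (cases "U z \<le> 4 * A")
      case True
      then show ?thesis using small[OF z True] shrink[OF \<theta>(3,4) \<beta>(3) \<alpha>(3)] \<theta> d1
        by (intro exI[of _ "1 - \<theta>2"]) auto
    next
      case False
      \<comment> \<open>The quotient
        \<open>(1 + \<beta> * (U z / 4 + A)) / (1 + \<beta> * U z)\<close> decreases in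
        \<open>U z\<close>; its value at the threshold \<open>4 * A\<close> is the fraction in the
        hypothesis on \<open>\<alpha>\<close>.\<close>
      have "(1 + \<beta> * (U z / 4 + A)) * (1 + 4 * \<beta> * A) \<le> (1 + 2 * \<beta> * A) * C"
      proof -
        have "\<beta> * (4 * A) \<le> \<beta> * U z" using False \<beta> by (intro mult_left_mono) auto
        moreover from this have "(\<beta> * A) * (\<beta> * (4 * A)) \<le> (\<beta> * A) * (\<beta> * U z)" using A1 \<beta> by (intro mult_left_mono) auto
        ultimately show ?thesis unfolding C_def by (simp add: algebra_simps)
      qed
      then have "1 + \<beta> * (U z / 4 + A) \<le> (1 + 2 * \<beta> * A) / (1 + 4 * \<beta> * A) * C"
        using \<beta> A1 by (simp add: pos_le_divide_eq add_pos_nonneg)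
      also have "\<dots> \<le> \<alpha> * C" using \<alpha>(1) C1 by (intro mult_right_mono) auto
      finally show ?thesis using BA pow_d[OF z, of N] d1 by (intro exI[of _ 1]) auto
    qed
  qed
  then obtain D where D: "D \<ge> 0" "(pair_op ^^ N) ?d z \<le> ennreal D" "D * B \<le> \<alpha> * (d z * C)" by blast
  \<comment> \<open>The estimate is available for positive bounds only; a vanishing bound is reached
    by letting \<open>t\<close> tend to zero from the right.\<close>
  have lim: "((\<lambda>t. ennreal (sqrt ((D + t) * B))) \<longlongrightarrow> ennreal (sqrt ((D + 0) * B))) (at_right 0)"
    by (intro tendsto_intros)
  have "(pair_op ^^ N) (\<lambda>z. ennreal (sqrt (d z * (1 + \<beta> * U z)))) z \<le> ennreal (sqrt ((D + 0) * B))"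
  proof (rule tendsto_lowerbound[OF lim])
    show "eventually (\<lambda>t. (pair_op ^^ N) (\<lambda>z. ennreal (sqrt (d z * (1 + \<beta> * U z)))) z \<le> ennreal (sqrt ((D + t) * B))) (at_right 0)"
    proof (rule eventually_mono[OF eventually_at_right_less])
      fix t :: real assume "0 < t"
      then show "(pair_op ^^ N) (\<lambda>z. ennreal (sqrt (d z * (1 + \<beta> * U z)))) z \<le> ennreal (sqrt ((D + t) * B))"
        using D(1) by (intro main order_trans[OF D(2) ennreal_leI]) auto
    qed
  qed simp
  also have "\<dots> \<le> ennreal (sqrt (\<alpha> * (d z * C)))" using D(3) by (intro ennreal_leI) simp
  finally show ?thesis by (simp add: C_def real_sqrt_mult)
qed

lemma pair_op_pow_cmult:
  assumes "0 \<le> c" "z \<in> S \<times> S"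
  shows "(pair_op ^^ n) (\<lambda>z. ennreal c * g z) z \<le> ennreal c * (pair_op ^^ n) g z"
  using assms(2)
proof (induction n arbitrary: z)
  case (Suc n)
  have "(pair_op ^^ Suc n) (\<lambda>z. ennreal c * g z) z \<le> pair_op (\<lambda>z. ennreal c * (pair_op ^^ n) g z) z"
    unfolding pair_op_pow_Suc by (rule pair_op_mono) (rule Suc.IH)
  also have "\<dots> \<le> ennreal c * pair_op ((pair_op ^^ n) g) z" by (rule pair_op_cmult) fact
  finally show ?case by simp
qed simp

lemma pair_op_pow_contract:
  assumes step: "\<And>z. z \<in> S \<times> S \<Longrightarrow> (pair_op ^^ N) f z \<le> ennreal \<alpha> * f z" and "0 \<le> \<alpha>" and z: "z \<in> S \<times> S"
  shows "(pair_op ^^ (k * N)) f z \<le> ennreal (\<alpha> ^ k) * f z"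
  using z
proof (induction k arbitrary: z)
  case (Suc k)
  have "(pair_op ^^ (Suc k * N)) f z = (pair_op ^^ N) ((pair_op ^^ (k * N)) f) z"
    by (simp add: funpow_add)
  also have "\<dots> \<le> (pair_op ^^ N) (\<lambda>z. ennreal (\<alpha> ^ k) * f z) z"
    using Suc by (intro pair_op_iter_mono) auto
  also have "\<dots> \<le> ennreal (\<alpha> ^ k) * (pair_op ^^ N) f z" using Suc.prems assms(2) by (intro pair_op_pow_cmult) auto
  also have "\<dots> \<le> ennreal (\<alpha> ^ k) * (ennreal \<alpha> * f z)" using step[OF Suc.prems] by (intro mult_left_mono) auto
  finally show ?case using assms(2) by (simp add: ennreal_mult mult_ac)
qed simp

end

section \<open>One step of the coupled chain\<close>

text \<open>The bound \<open>E\<close> is a parameter and not computed from \<open>\<gamma>\<close>: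
  the same function can be supplied for all projected measures, and constants built from it are
  common to them.\<close>

locale pcn_moment_chain = pcn_chain \<Phi> \<delta> \<rho> R \<alpha>\<^sub>l r a S \<gamma>
  for \<Phi> :: "'a::{real_inner, complete_space, second_countable_topology} \<Rightarrow> real"
    and \<delta> \<rho> R \<alpha>\<^sub>l r a :: real and S :: "'a set" and \<gamma> :: "'a measure" +
  fixes E :: "real \<Rightarrow> real"
  assumes moment: "\<And>v. (\<integral>\<^sup>+\<xi>. ennreal (exp (v * norm \<xi>)) \<partial>\<gamma>) \<le> ennreal (E v)"
begin

lemma integrable_exp_norm: "integrable \<gamma> (\<lambda>\<xi>. exp (v * norm \<xi>))"
  using moment[of v] by (intro integrableI_nonneg) (auto simp: order_le_less_trans)

lemma integral_exp_norm_pos: "0 < (LINT \<xi>|\<gamma>. exp (v * norm \<xi>))"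
proof -
  have "(LINT \<xi>|\<gamma>. 0) < (LINT \<xi>|\<gamma>. exp (v * norm \<xi>))"
    by (rule noise.integral_less_AE_space) (auto intro: integrable_exp_norm simp: noise.emeasure_space_1)
  then show ?thesis by simp
qed

lemma integral_exp_norm_le: "(LINT \<xi>|\<gamma>. exp (v * norm \<xi>)) \<le> E v"
proof -
  have "ennreal (LINT \<xi>|\<gamma>. exp (v * norm \<xi>)) = (\<integral>\<^sup>+\<xi>. ennreal (exp (v * norm \<xi>)) \<partial>\<gamma>)"
    by (rule nn_integral_eq_integral[OF integrable_exp_norm, symmetric]) simp
  also have "\<dots> \<le> ennreal (E v)" by (rule moment)
  finally show ?thesis using integral_exp_norm_pos[of v] by (simp add: ennreal_le_iff2)
qed

lemma E_pos: "0 < E v"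
  using integral_exp_norm_pos[of v] integral_exp_norm_le[of v] by simp

text \<open>Markov's inequality for \<open>exp (norm \<xi>)\<close>.\<close>

lemma prob_norm_le:
  assumes "exp (- k) * E 1 \<le> 1 / 2"
  shows "1 / 2 \<le> noise.prob {\<xi> \<in> space \<gamma>. norm \<xi> \<le> k}"
proof -
  have "noise.prob {\<xi> \<in> space \<gamma>. \<not> norm \<xi> \<le> k} = (LINT \<xi>|\<gamma>. indicator {\<xi> \<in> space \<gamma>. \<not> norm \<xi> \<le> k} \<xi>)"
    by (subst Bochner_Integration.integral_indicator) (auto intro!: arg_cong[where f=noise.prob])
  also have "\<dots> \<le> (LINT \<xi>|\<gamma>. exp (- k) * exp (1 * norm \<xi>))"
  proof (rule integral_mono)
    show "integrable \<gamma> (indicator {\<xi> \<in> space \<gamma>. \<not> norm \<xi> \<le> k} :: _ \<Rightarrow> real)"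
      by (intro integrable_real_indicator) (auto simp: noise.emeasure_eq_measure)
    show "integrable \<gamma> (\<lambda>\<xi>. exp (- k) * exp (1 * norm \<xi>))" by (intro integrable_mult_right integrable_exp_norm)
  qed (auto simp: indicator_def exp_add[symmetric])
  also have "\<dots> = exp (- k) * (LINT \<xi>|\<gamma>. exp (1 * norm \<xi>))" by simp
  also have "\<dots> \<le> exp (- k) * E 1" by (intro mult_left_mono integral_exp_norm_le) auto
  finally have "noise.prob {\<xi> \<in> space \<gamma>. \<not> norm \<xi> \<le> k} \<le> 1 / 2" using assms by simp
  moreover have "noise.prob {\<xi> \<in> space \<gamma>. \<not> norm \<xi> \<le> k} = 1 - noise.prob {\<xi> \<in> space \<gamma>. norm \<xi> \<le> k}"
    by (rule noise.prob_neg) measurable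
  ultimately show ?thesis by simp
qed

text \<open>When \<open>p\<close> bounds the acceptance probability of all states from below for
  noise of norm at most \<open>k\<close>, every copy accepts on this event. Being a product, it has
  probability at least \<open>p / 2\<close> as soon as the noise is bounded by \<open>k\<close> with
  probability at least one half.\<close>

definition accept_event :: "real \<Rightarrow> real \<Rightarrow> ('a \<times> real) set" where
  "accept_event k p = {\<xi> \<in> space \<gamma>. norm \<xi> \<le> k} \<times> {..p}"

lemma accept_event_measurable [measurable]: "accept_event k p \<in> sets driver"
  unfolding accept_event_def by (intro pair_measureI) auto

lemma distr_fst_noise: "distr driver \<gamma> fst = \<gamma>"
  by (rule unif.distr_pair_fst)

text \<open>The common shape of the one-step bounds: a gain \<open>b\<close> on the acceptance event
  and an error with exponential moment. The contraction on bounded sets, the drift and the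
  contraction of the distance all integrate a bound of this form.\<close>

lemma nn_integral_noise_unif_le:
  assumes c: "0 \<le> c" and b: "0 \<le> b" "b \<le> 1" and t: "0 \<le> t" and p: "0 \<le> p" "p \<le> 1"
    and k: "exp (- k) * E 1 \<le> 1 / 2"
  shows "(\<integral>\<^sup>+\<omega>. ennreal (c * (1 - b * indicator (accept_event k p) \<omega> + t * exp (v * norm (fst \<omega>)))) \<partial>driver)
     \<le> ennreal (c * (1 - b * (p / 2) + t * E v))"
proof -
    have i1: "integrable driver (indicator (accept_event k p) :: _ \<Rightarrow> real)"
    by (rule integrable_real_indicator[OF accept_event_measurable]) (simp add: noise_unif.emeasure_eq_measure)
  have i2: "integrable driver (\<lambda>\<omega>. exp (v * norm (fst \<omega>)))"
    using integrable_exp_norm[of v] distr_fst_noise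
    by (subst integrable_distr_eq[of fst driver \<gamma> "\<lambda>\<xi>. exp (v * norm \<xi>)", symmetric]) auto
  have e2: "(LINT \<omega>|driver. exp (v * norm (fst \<omega>))) \<le> E v"
    using integral_exp_norm_le[of v] distr_fst_noise
    by (subst integral_distr[of fst driver \<gamma> "\<lambda>\<xi>. exp (v * norm \<xi>)", symmetric]) auto
  have "measure driver (accept_event k p) = noise.prob {\<xi> \<in> space \<gamma>. norm \<xi> \<le> k} * p"
    unfolding accept_event_def using p
    by (simp add: measure_def unif.emeasure_pair_measure_Times enn2real_mult emeasure_unif_atMost)
  moreover have "\<dots> \<ge> 1 / 2 * p" using prob_norm_le[OF k] p by (intro mult_right_mono) auto
  ultimately have m: "p / 2 \<le> measure driver (accept_event k p)" by simp
  define J :: "'a \<times> real \<Rightarrow> real" where "J = indicator (accept_event k p)"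
  have J01: "0 \<le> J \<omega>" "J \<omega> \<le> 1" for \<omega> by (auto simp: J_def indicator_def)
  have iJ: "integrable driver J" using i1 by (simp add: J_def)
  have mJ: "(LINT \<omega>|driver. J \<omega>) = measure driver (accept_event k p)"
    unfolding J_def using sets.sets_into_space[OF accept_event_measurable, of k p]
    by (subst Bochner_Integration.integral_indicator) (simp add: Int_absorb2)
  have "(\<integral>\<^sup>+\<omega>. ennreal (c * (1 - b * J \<omega> + t * exp (v * norm (fst \<omega>)))) \<partial>driver)
    = ennreal (LINT \<omega>|driver. c * (1 - b * J \<omega> + t * exp (v * norm (fst \<omega>))))"
  proof (rule nn_integral_eq_integral)
    show "integrable driver (\<lambda>\<omega>. c * (1 - b * J \<omega> + t * exp (v * norm (fst \<omega>))))"
      by (intro integrable_mult_right Bochner_Integration.integrable_add Bochner_Integration.integrable_diff iJ i2) simp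
    have "b * J \<omega> \<le> 1" for \<omega> using b J01[of \<omega>] by (simp add: mult_le_one)
    then show "AE \<omega> in driver. 0 \<le> c * (1 - b * J \<omega> + t * exp (v * norm (fst \<omega>)))"
      using c t by (intro AE_I2 mult_nonneg_nonneg add_nonneg_nonneg) auto
  qed
  also have "(LINT \<omega>|driver. c * (1 - b * J \<omega> + t * exp (v * norm (fst \<omega>))))
     = c * (1 - b * measure driver (accept_event k p) + t * (LINT \<omega>|driver. exp (v * norm (fst \<omega>))))"
    using iJ i2 by (simp add: mJ noise_unif.prob_space)
  also have "ennreal \<dots> \<le> ennreal (c * (1 - b * (p / 2) + t * E v))"
    using m e2 c b t by (intro ennreal_leI mult_left_mono add_mono diff_mono) auto
  finally show ?thesis by (simp only: J_def)
qed

lemma step_eq: "step x \<omega> = (let p = (1 - \<rho>) *\<^sub>R x + sqrt (2 * \<delta>) *\<^sub>R fst \<omega>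
    in if snd \<omega> \<le> accept_prob \<Phi> x p then p else x)"
  by (simp add: pcn_step_def sqrt_eq)

lemma norm_noise_le: "norm (sqrt (2 * \<delta>) *\<^sub>R \<xi>) \<le> norm (\<xi> :: 'a)"
  using delta by (simp add: mult_left_le_one_le real_sqrt_le_1_iff)

lemma step_accept_event:
  assumes p: "\<And>x z. norm (z - (1 - \<rho>) *\<^sub>R x) \<le> k \<Longrightarrow> p \<le> accept_prob \<Phi> x z"
    and \<omega>: "\<omega> \<in> accept_event k p"
  shows "step x \<omega> = (1 - \<rho>) *\<^sub>R x + sqrt (2 * \<delta>) *\<^sub>R fst \<omega>"
proof -
  let ?z = "(1 - \<rho>) *\<^sub>R x + sqrt (2 * \<delta>) *\<^sub>R fst \<omega>"
  have "norm (fst \<omega>) \<le> k" "snd \<omega> \<le> p" using \<omega> by (auto simp: accept_event_def)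
  then have "norm (?z - (1 - \<rho>) *\<^sub>R x) \<le> k" using norm_noise_le[of "fst \<omega>"] by simp
  then have "snd \<omega> \<le> accept_prob \<Phi> x ?z" using p \<open>snd \<omega> \<le> p\<close> by fastforce
  then show ?thesis by (simp add: step_eq)
qed

text \<open>On the acceptance event both states move by the same affine map: norms stay below
  \<open>s\<close>, because \<open>s\<close> is invariant under contraction plus noise
  \<open>k\<close>, and the separation shrinks by the factor \<open>1 - \<rho>\<close>. Off the
  event only \<open>g \<le> 1\<close> is used.\<close>

lemma pair_op_small:
  assumes p: "\<And>x z. norm (z - (1 - \<rho>) *\<^sub>R x) \<le> k \<Longrightarrow> p \<le> accept_prob \<Phi> x z" "0 \<le> p" "p \<le> 1"
    and k: "exp (- k) * E 1 \<le> 1 / 2" and s: "(1 - \<rho>) * s + k \<le> s" and c: "0 \<le> c" "c \<le> 1"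
    and g: "\<And>z. z \<in> S \<times> S \<Longrightarrow> g z \<le> 1"
      "\<And>x y. x \<in> S \<Longrightarrow> y \<in> S \<Longrightarrow> norm x \<le> s \<Longrightarrow> norm y \<le> s \<Longrightarrow> norm (x - y) \<le> (1 - \<rho>) * b \<Longrightarrow> g (x, y) \<le> ennreal (1 - c)"
    and xy: "x \<in> S" "y \<in> S" "norm x \<le> s" "norm y \<le> s" "norm (x - y) \<le> b"
  shows "pair_op g (x, y) \<le> ennreal (1 - c * (p / 2))"
proof -
  have "pair_op g (x, y) \<le> (\<integral>\<^sup>+\<omega>. g (step x \<omega>, step y \<omega>) \<partial>driver)"
    using pair_op_step_le[of "(x, y)" g] xy by simp
  also have "\<dots> \<le> (\<integral>\<^sup>+\<omega>. ennreal (1 * (1 - c * indicator (accept_event k p) \<omega> + 0 * exp (0 * norm (fst \<omega>)))) \<partial>driver)"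
  proof (rule nn_integral_mono)
    fix \<omega> assume "\<omega> \<in> space driver"
    then have f: "fst \<omega> \<in> S" by (auto simp: space_pair_measure space_noise)
    have st: "step x \<omega> \<in> S" "step y \<omega> \<in> S" using step_in f xy by auto
    show "g (step x \<omega>, step y \<omega>) \<le> ennreal (1 * (1 - c * indicator (accept_event k p) \<omega> + 0 * exp (0 * norm (fst \<omega>))))"
    proof (cases "\<omega> \<in> accept_event k p")
      case True
      have sg: "step w \<omega> = (1 - \<rho>) *\<^sub>R w + sqrt (2 * \<delta>) *\<^sub>R fst \<omega>" for w
        by (rule step_accept_event[OF _ True]) (rule p(1))
      have n: "norm (step w \<omega>) \<le> s" if "norm w \<le> s" for w
      proof -
        have "norm (step w \<omega>) \<le> (1 - \<rho>) * norm w + norm (fst \<omega>)"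
          unfolding sg using norm_noise_le[of "fst \<omega>"] rho_bounds by (intro norm_triangle_le add_mono) auto
        also have "\<dots> \<le> (1 - \<rho>) * s + k" using that True rho_bounds by (intro add_mono mult_left_mono) (auto simp: accept_event_def)
        finally show ?thesis using s by simp
      qed
      have "norm (step x \<omega> - step y \<omega>) = (1 - \<rho>) * norm (x - y)"
        unfolding sg using rho_bounds by (simp add: scaleR_diff_right[symmetric])
      also have "\<dots> \<le> (1 - \<rho>) * b" using xy rho_bounds by (intro mult_left_mono) auto
      finally show ?thesis using g(2)[OF st n n] xy True by simp
    qed (use g(1) st in simp)
  qed
  also have "\<dots> \<le> ennreal (1 * (1 - c * (p / 2) + 0 * E 0))"
    by (rule nn_integral_noise_unif_le) (use p k c in auto)
  finally show ?thesis by simp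
qed

text \<open>All of \<open>n\<close> consecutive steps are accepted jointly with probability at least
  \<open>(p / 2) ^ n\<close>, and the function is then at most \<open>1 / 2\<close>. The separation
  \<open>b\<close> is rescaled along the induction.\<close>

lemma pair_op_pow_small:
  assumes p: "\<And>x z. norm (z - (1 - \<rho>) *\<^sub>R x) \<le> k \<Longrightarrow> p \<le> accept_prob \<Phi> x z" "0 \<le> p" "p \<le> 1"
    and k: "exp (- k) * E 1 \<le> 1 / 2" and s: "(1 - \<rho>) * s + k \<le> s"
    and f: "\<And>z. z \<in> S \<times> S \<Longrightarrow> f z \<le> 1"
      "\<And>x y. x \<in> S \<Longrightarrow> y \<in> S \<Longrightarrow> norm x \<le> s \<Longrightarrow> norm y \<le> s \<Longrightarrow> norm (x - y) \<le> (1 - \<rho>) ^ n * b \<Longrightarrow> f (x, y) \<le> ennreal (1 / 2)"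
    and xy: "x \<in> S" "y \<in> S" "norm x \<le> s" "norm y \<le> s" "norm (x - y) \<le> b"
  shows "(pair_op ^^ n) f (x, y) \<le> ennreal (1 - 1 / 2 * (p / 2) ^ n)"
  using f(2) xy
proof (induction n arbitrary: x y b)
  case (Suc n)
  have p2: "0 \<le> p / 2" "p / 2 \<le> 1" using p by auto
  have "pair_op ((pair_op ^^ n) f) (x, y) \<le> ennreal (1 - (1 / 2 * (p / 2) ^ n) * (p / 2))"
  proof (rule pair_op_small[OF p k s])
    show "0 \<le> 1 / 2 * (p / 2) ^ n" "1 / 2 * (p / 2) ^ n \<le> 1"
      using p2 power_le_one[OF p2, of n] by auto
    show "(pair_op ^^ n) f (x', y') \<le> ennreal (1 - 1 / 2 * (p / 2) ^ n)"
      if "x' \<in> S" "y' \<in> S" "norm x' \<le> s" "norm y' \<le> s" "norm (x' - y') \<le> (1 - \<rho>) * b" for x' y'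
      using Suc.prems(1) by (intro Suc.IH[of "(1 - \<rho>) * b"] that) (auto simp: mult_ac)
  qed (use pair_op_pow_le_1[OF f(1)] Suc.prems in auto)
  then show ?case by (simp add: mult_ac)
qed (simp add: f)

text \<open>For a distant state and moderate noise, an accepted proposal lowers the profile to at
  most \<open>q\<close> times its value and a rejection leaves it unchanged. For noise beyond
  \<open>k\<close> the growth \<open>exp (v * norm \<xi>)\<close> is at most
  \<open>exp (- k) * exp ((v + 1) * norm \<xi>)\<close>, a small error. A state within
  \<open>R1\<close> is covered by the additive constant.\<close>

lemma step_lyapunov:
  assumes W: "lyapunov_profile W v q \<rho>"
    and far: "\<And>x z. norm x \<ge> R1 \<Longrightarrow> norm (z - (1 - \<rho>) *\<^sub>R x) \<le> k \<Longrightarrow>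
      p \<le> accept_prob \<Phi> x z \<and> norm z \<le> (1 - \<rho> / 2) * norm x" and p: "0 \<le> p" "p \<le> 1" and R1: "R1 \<ge> 1"
    and k: "exp (- k) * E 1 \<le> 1 / 2" and x: "x \<in> S"
  shows "(\<integral>\<^sup>+\<omega>. ennreal (W (norm (step x \<omega>))) \<partial>driver)
    \<le> ennreal ((1 - (1 - q) * (p / 2) + exp (- k) * E (v + 1)) * W (norm x) + W R1 * E v)"
proof -
  interpret W: lyapunov_profile W v q \<rho> by fact
  have rb: "0 \<le> 1 - \<rho> / 2" "1 - \<rho> / 2 \<le> 1" using rho_bounds by auto
  have Wx: "0 \<le> W (norm y)" for y :: 'a by (rule W.profile_nonneg) simp
  have st: "norm (step x \<omega>) \<le> norm x + norm (fst \<omega>)" for \<omega>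
  proof -
    have "norm ((1 - \<rho>) *\<^sub>R x + sqrt (2 * \<delta>) *\<^sub>R fst \<omega>) \<le> (1 - \<rho>) * norm x + norm (fst \<omega>)"
      using norm_noise_le[of "fst \<omega>"] rho_bounds by (intro norm_triangle_le add_mono) auto
    also have "(1 - \<rho>) * norm x \<le> norm x" using rho_bounds by (simp add: mult_left_le_one_le)
    finally show ?thesis by (simp add: step_eq Let_def)
  qed
  have l0: "0 \<le> 1 - (1 - q) * (p / 2) + exp (- k) * E (v + 1)"
  proof -
    have "(1 - q) * (p / 2) \<le> 1 * 1" using W.profile_const p by (intro mult_mono) auto
    then show ?thesis using E_pos[of "v + 1"] by (simp add: add_nonneg_nonneg)
  qed
  show ?thesis
  proof (cases "norm x \<ge> R1")
    case True
    have pt: "W (norm (step x \<omega>)) \<le> W (norm x) * (1 - (1 - q) * indicator (accept_event k p) \<omega> + exp (- k) * exp ((v + 1) * norm (fst \<omega>)))"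
      if "\<omega> \<in> space driver" for \<omega>
    proof (cases "norm (fst \<omega>) \<le> k")
      case k: True
      let ?z = "(1 - \<rho>) *\<^sub>R x + sqrt (2 * \<delta>) *\<^sub>R fst \<omega>"
      have z: "p \<le> accept_prob \<Phi> x ?z" "norm ?z \<le> (1 - \<rho> / 2) * norm x"
        using far[OF True, of ?z] norm_noise_le[of "fst \<omega>"] k by auto
      have Wz: "W (norm ?z) \<le> q * W (norm x)"
        using W.profile_mono[of "norm ?z" "(1 - \<rho> / 2) * norm x"] z(2) W.profile_contract[of "norm x"] True R1 by simp
      have "W (norm (step x \<omega>)) \<le> W (norm x) * (1 - (1 - q) * indicator (accept_event k p) \<omega>)"
      proof (cases "\<omega> \<in> accept_event k p")
        case True
        then have "step x \<omega> = ?z" using z(1) by (auto simp: step_eq Let_def accept_event_def)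
        then show ?thesis using Wz True by (simp add: mult.commute)
      next
        case False
        have "q * W (norm x) \<le> W (norm x)" using W.profile_const Wx by (simp add: mult_left_le_one_le)
        then show ?thesis using Wz False by (simp add: step_eq Let_def)
      qed
      also have "\<dots> \<le> W (norm x) * (1 - (1 - q) * indicator (accept_event k p) \<omega> + exp (- k) * exp ((v + 1) * norm (fst \<omega>)))"
        using Wx by (intro mult_left_mono) auto
      finally show ?thesis .
    next
      case False
      then have ng: "\<omega> \<notin> accept_event k p" by (auto simp: accept_event_def)
      have "W (norm (step x \<omega>)) \<le> W (norm x + norm (fst \<omega>))" using st by (intro W.profile_mono) auto
      also have "\<dots> \<le> W (norm x) * exp (v * norm (fst \<omega>))" using True R1 by (intro W.profile_growth) auto
      also have "\<dots> \<le> W (norm x) * (1 + exp (- k) * exp ((v + 1) * norm (fst \<omega>)))"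
      proof (intro mult_left_mono Wx)
        have "exp (v * norm (fst \<omega>)) \<le> exp (- k) * exp ((v + 1) * norm (fst \<omega>))"
          using False by (simp add: exp_add[symmetric] distrib_right)
        then show "exp (v * norm (fst \<omega>)) \<le> 1 + exp (- k) * exp ((v + 1) * norm (fst \<omega>))" by simp
      qed
      finally show ?thesis using ng by simp
    qed
    have "(\<integral>\<^sup>+\<omega>. ennreal (W (norm (step x \<omega>))) \<partial>driver)
       \<le> (\<integral>\<^sup>+\<omega>. ennreal (W (norm x) * (1 - (1 - q) * indicator (accept_event k p) \<omega> + exp (- k) * exp ((v + 1) * norm (fst \<omega>)))) \<partial>driver)"
      using pt by (intro nn_integral_mono ennreal_leI)
    also have "\<dots> \<le> ennreal (W (norm x) * (1 - (1 - q) * (p / 2) + exp (- k) * E (v + 1)))"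
      by (rule nn_integral_noise_unif_le) (use Wx W.profile_const p k in auto)
    also have "\<dots> \<le> ennreal ((1 - (1 - q) * (p / 2) + exp (- k) * E (v + 1)) * W (norm x) + W R1 * E v)"
      using W.profile_nonneg[of R1] R1 E_pos[of v] by (intro ennreal_leI) (simp add: mult.commute)
    finally show ?thesis .
  next
    case False
    have W1: "0 \<le> W R1" using R1 by (intro W.profile_nonneg) auto
    have "(\<integral>\<^sup>+\<omega>. ennreal (W (norm (step x \<omega>))) \<partial>driver)
       \<le> (\<integral>\<^sup>+\<omega>. ennreal (W R1) * ennreal (exp (v * norm (fst \<omega>))) \<partial>driver)"
    proof (rule nn_integral_mono)
      fix \<omega>
      have "W (norm (step x \<omega>)) \<le> W (R1 + norm (fst \<omega>))" using st[of \<omega>] False by (intro W.profile_mono) auto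
      also have "\<dots> \<le> W R1 * exp (v * norm (fst \<omega>))" using R1 by (intro W.profile_growth) auto
      finally show "ennreal (W (norm (step x \<omega>))) \<le> ennreal (W R1) * ennreal (exp (v * norm (fst \<omega>)))"
        using W1 by (simp add: ennreal_mult[symmetric] ennreal_leI)
    qed
    also have "\<dots> = ennreal (W R1) * (\<integral>\<^sup>+\<omega>. ennreal (exp (v * norm (fst \<omega>))) \<partial>driver)"
      by (rule nn_integral_cmult) measurable
    also have "(\<integral>\<^sup>+\<omega>. ennreal (exp (v * norm (fst \<omega>))) \<partial>driver) = (\<integral>\<^sup>+\<xi>. ennreal (exp (v * norm \<xi>)) \<partial>\<gamma>)"
      by (subst (2) distr_fst_noise[symmetric], subst nn_integral_distr) auto
    also have "ennreal (W R1) * \<dots> \<le> ennreal (W R1) * ennreal (E v)" using moment by (intro mult_left_mono) auto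
    also have "\<dots> = ennreal (W R1 * E v)" using W1 E_pos[of v] by (simp add: ennreal_mult)
    also have "\<dots> \<le> ennreal ((1 - (1 - q) * (p / 2) + exp (- k) * E (v + 1)) * W (norm x) + W R1 * E v)"
      using l0 Wx by (intro ennreal_leI) simp
    finally show ?thesis .
  qed
qed

lemma pair_op_path_dist:
  assumes \<eta>: "0 < \<eta>" "\<eta> \<le> 1" and \<epsilon>: "0 < \<epsilon>" "\<epsilon> \<le> 1" and u: "norm (u :: 'a) = 1"
    and p: "\<And>x z. norm (z - (1 - \<rho>) *\<^sub>R x) \<le> k \<Longrightarrow> p \<le> accept_prob \<Phi> x z" "0 \<le> p" "p \<le> 1"
    and k: "exp (- k) * E 1 \<le> 1 / 2"
    and M: "0 \<le> M" "\<And>x y z. \<bar>accept_prob \<Phi> x ((1 - \<rho>) *\<^sub>R x + z) - accept_prob \<Phi> y ((1 - \<rho>) *\<^sub>R y + z)\<bar>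
     \<le> M * (norm (x - y) * exp (\<eta> * max (norm x) (norm y))) * exp (\<eta> * norm z)"
    and xy: "x \<in> S" "y \<in> S" and less: "path_dist \<eta> \<epsilon> x y < 1"
  shows "pair_op (\<lambda>(x, y). ennreal (path_dist \<eta> \<epsilon> x y)) (x, y)
     \<le> ennreal ((1 - \<rho> * (p / 2) + \<eta> * E 1 + M * \<epsilon> * exp \<eta> * E 1) * path_dist \<eta> \<epsilon> x y)"
proof -
    let ?d = "path_dist \<eta> \<epsilon>"
  define d where "d = ?d x y"
  have \<eta>0: "0 \<le> \<eta>" using \<eta> by simp
  have d0: "0 \<le> d" unfolding d_def by (rule path_dist_nonneg[OF \<eta>0 \<epsilon>(1) u])
  define prp where "prp x \<xi> = (1 - \<rho>) *\<^sub>R x + sqrt (2 * \<delta>) *\<^sub>R \<xi>" for x \<xi> :: 'a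
  define acc where "acc x \<xi> = accept_prob \<Phi> x (prp x \<xi>)" for x \<xi>
  have st: "step x \<omega> = (if snd \<omega> \<le> acc x (fst \<omega>) then prp x (fst \<omega>) else x)" for x \<omega>
    by (simp add: step_eq Let_def acc_def prp_def)
  \<comment> \<open>On this event the copies decide differently, and the distance is only estimated
    by \<open>1\<close>.\<close>
  define H where "H = {\<omega> \<in> space driver. (snd \<omega> \<le> acc x (fst \<omega>)) \<noteq> (snd \<omega> \<le> acc y (fst \<omega>))}"
  have acc_b: "acc x \<in> borel_measurable borel" for x
    unfolding acc_def prp_def accept_prob_def by measurable
  have acc_m: "(\<lambda>\<omega>. acc x (fst \<omega>)) \<in> borel_measurable driver" for x
    by (rule measurable_compose[OF measurable_fst noise_from_borel[OF acc_b]])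
  have "snd \<in> borel_measurable driver"
    using measurable_snd[of \<gamma> unif] by (simp add: measurable_cong_sets[OF refl sets_unif])
  then have acc_s: "{\<omega> \<in> space driver. snd \<omega> \<le> acc x (fst \<omega>)} \<in> sets driver" for x
    by (rule borel_measurable_le[OF _ acc_m])
  have "H = {\<omega> \<in> space driver. snd \<omega> \<le> acc x (fst \<omega>)} - {\<omega> \<in> space driver. snd \<omega> \<le> acc y (fst \<omega>)}
      \<union> ({\<omega> \<in> space driver. snd \<omega> \<le> acc y (fst \<omega>)} - {\<omega> \<in> space driver. snd \<omega> \<le> acc x (fst \<omega>)})"
    by (auto simp: H_def)
  then have H: "H \<in> sets driver" using acc_s by (simp only: sets.Un sets.Diff)
  \<comment> \<open>By convexity the weight exceeds \<open>1\<close> by at most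
    \<open>\<eta>\<close> times a fixed exponential, so the loss is small for small
    \<open>\<eta>\<close>.\<close>
  have expb: "exp (\<eta> * t) \<le> 1 + \<eta> * exp t" if "0 \<le> t" for t
  proof -
    have "exp ((1 - \<eta>) *\<^sub>R 0 + \<eta> *\<^sub>R t) \<le> (1 - \<eta>) * exp 0 + \<eta> * exp t"
      using \<eta> by (intro convex_onD[OF exp_convex]) auto
    then show ?thesis using \<eta> by simp
  qed
  have pt: "ennreal (?d (step x \<omega>) (step y \<omega>))
      \<le> ennreal (d * (1 - \<rho> * indicator (accept_event k p) \<omega> + \<eta> * exp (1 * norm (fst \<omega>)))) + indicator H \<omega>"
    if \<omega>: "\<omega> \<in> space driver" for \<omega>
  proof (cases "\<omega> \<in> H")
    case True
    then have "ennreal (?d (step x \<omega>) (step y \<omega>)) \<le> indicator H \<omega>" using path_dist_le_1 by simp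
    then show ?thesis by (rule order_trans) simp
  next
    case False
    have "?d (step x \<omega>) (step y \<omega>) \<le> d * (1 - \<rho> * indicator (accept_event k p) \<omega> + \<eta> * exp (1 * norm (fst \<omega>)))"
    proof (cases "snd \<omega> \<le> acc x (fst \<omega>)")
      case True
      then have "snd \<omega> \<le> acc y (fst \<omega>)" using False \<omega> by (auto simp: H_def)
      then have "?d (step x \<omega>) (step y \<omega>) = ?d (prp x (fst \<omega>)) (prp y (fst \<omega>))" using True by (simp add: st)
      also have "\<dots> \<le> (1 - \<rho>) * exp (\<eta> * norm (sqrt (2 * \<delta>) *\<^sub>R fst \<omega>)) * d"
        unfolding prp_def d_def using rho_bounds less by (intro path_dist_affine[OF \<eta>0 \<epsilon>(1) u]) auto
      also have "\<dots> \<le> (1 - \<rho> * indicator (accept_event k p) \<omega> + \<eta> * exp (1 * norm (fst \<omega>))) * d"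
      proof (intro mult_right_mono d0)
        have "exp (\<eta> * norm (sqrt (2 * \<delta>) *\<^sub>R fst \<omega>)) \<le> exp (\<eta> * norm (fst \<omega>))"
          using norm_noise_le[of "fst \<omega>"] \<eta> by (simp del: norm_scaleR)
        also have "\<dots> \<le> 1 + \<eta> * exp (norm (fst \<omega>))" by (rule expb) simp
        finally have "(1 - \<rho>) * exp (\<eta> * norm (sqrt (2 * \<delta>) *\<^sub>R fst \<omega>)) \<le> (1 - \<rho>) * (1 + \<eta> * exp (norm (fst \<omega>)))"
          using rho_bounds by (intro mult_left_mono) auto
        also have "\<dots> \<le> (1 - \<rho>) + \<eta> * exp (norm (fst \<omega>))"
          using rho_bounds \<eta> by (simp add: distrib_left mult_left_le_one_le)
        also have "\<dots> \<le> 1 - \<rho> * indicator (accept_event k p) \<omega> + \<eta> * exp (1 * norm (fst \<omega>))"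
          using rho_bounds by (auto simp: indicator_def)
        finally show "(1 - \<rho>) * exp (\<eta> * norm (sqrt (2 * \<delta>) *\<^sub>R fst \<omega>)) \<le> \<dots>" .
      qed
      finally show ?thesis by (simp add: mult.commute)
    next
      case nacc: False
      then have "\<not> snd \<omega> \<le> acc y (fst \<omega>)" using False \<omega> by (auto simp: H_def)
      then have "?d (step x \<omega>) (step y \<omega>) = d" using nacc by (simp add: st d_def)
      \<comment> \<open>When both copies reject there is no contraction to claim: on the acceptance
        event both would have accepted.\<close>
      moreover have "\<omega> \<notin> accept_event k p"
      proof
        assume g: "\<omega> \<in> accept_event k p"
        then have "norm (prp x (fst \<omega>) - (1 - \<rho>) *\<^sub>R x) \<le> k"
          using norm_noise_le[of "fst \<omega>"] by (auto simp: prp_def accept_event_def)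
        then have "p \<le> acc x (fst \<omega>)" unfolding acc_def by (rule p(1))
        then show False using g nacc by (auto simp: accept_event_def)
      qed
      moreover have "d * 1 \<le> d * (1 + \<eta> * exp (1 * norm (fst \<omega>)))"
        using d0 \<eta> by (intro mult_left_mono) auto
      ultimately show ?thesis by simp
    qed
    then show ?thesis using False by (simp add: ennreal_leI)
  qed
  have "pair_op (\<lambda>(x, y). ennreal (?d x y)) (x, y) \<le> (\<integral>\<^sup>+\<omega>. ennreal (?d (step x \<omega>) (step y \<omega>)) \<partial>driver)"
    using pair_op_step_le[of "(x, y)" "\<lambda>(x, y). ennreal (?d x y)"] xy by simp
  also have "\<dots> \<le> (\<integral>\<^sup>+\<omega>. ennreal (d * (1 - \<rho> * indicator (accept_event k p) \<omega> + \<eta> * exp (1 * norm (fst \<omega>)))) + indicator H \<omega> \<partial>driver)"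
    by (rule nn_integral_mono) (rule pt)
  also have "\<dots> = (\<integral>\<^sup>+\<omega>. ennreal (d * (1 - \<rho> * indicator (accept_event k p) \<omega> + \<eta> * exp (1 * norm (fst \<omega>)))) \<partial>driver) + emeasure driver H"
    unfolding nn_integral_indicator[OF H, symmetric]
    by (rule nn_integral_add[OF _ borel_measurable_indicator[OF H]]) measurable
  also have "\<dots> \<le> ennreal (d * (1 - \<rho> * (p / 2) + \<eta> * E 1)) + ennreal (M * \<epsilon> * exp \<eta> * E 1 * d)"
  proof (rule add_mono)
    show "(\<integral>\<^sup>+\<omega>. ennreal (d * (1 - \<rho> * indicator (accept_event k p) \<omega> + \<eta> * exp (1 * norm (fst \<omega>)))) \<partial>driver) \<le> ennreal (d * (1 - \<rho> * (p / 2) + \<eta> * E 1))"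
      by (rule nn_integral_noise_unif_le) (use d0 rho_bounds \<eta> p k in auto)
    \<comment> \<open>Fubini: for fixed noise the decisions differ on an interval between the two
      acceptance probabilities, whose length the local Lipschitz bound and the lower bound for the
      path distance control by a multiple of \<open>\<epsilon> * d\<close>.\<close>
    have "emeasure driver H = (\<integral>\<^sup>+\<xi>. emeasure unif (Pair \<xi> -` H) \<partial>\<gamma>)"
      by (rule unif.emeasure_pair_measure_alt[OF H])
    also have "\<dots> \<le> (\<integral>\<^sup>+\<xi>. ennreal (M * \<epsilon> * exp \<eta> * d) * ennreal (exp (1 * norm \<xi>)) \<partial>\<gamma>)"
    proof (rule nn_integral_mono)
      fix \<xi> assume \<xi>: "\<xi> \<in> space \<gamma>"
      have "Pair \<xi> -` H = {u. (u \<le> acc x \<xi>) \<noteq> (u \<le> acc y \<xi>)}"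
        using \<xi> by (auto simp: H_def space_pair_measure)
      then have "emeasure unif (Pair \<xi> -` H) \<le> ennreal \<bar>acc x \<xi> - acc y \<xi>\<bar>"
        using emeasure_unif_between_le[of "acc x \<xi>" "acc y \<xi>"] by (simp add: acc_def)
      also have "\<dots> \<le> ennreal (M * \<epsilon> * exp \<eta> * d * exp (1 * norm \<xi>))"
      proof (rule ennreal_leI)
        have "\<bar>acc x \<xi> - acc y \<xi>\<bar> \<le> M * (norm (x - y) * exp (\<eta> * max (norm x) (norm y))) * exp (\<eta> * norm (sqrt (2 * \<delta>) *\<^sub>R \<xi>))"
          unfolding acc_def prp_def by (rule M(2))
        also have "\<dots> \<le> M * (\<epsilon> * exp \<eta> * d) * exp (1 * norm \<xi>)"
        proof (rule mult_mono)
          show "M * (norm (x - y) * exp (\<eta> * max (norm x) (norm y))) \<le> M * (\<epsilon> * exp \<eta> * d)"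
            unfolding d_def by (rule mult_left_mono[OF norm_le_path_dist[OF \<eta>0 \<epsilon>(1) u \<epsilon>(2) less] M(1)])
          have "\<eta> * norm (sqrt (2 * \<delta>) *\<^sub>R \<xi>) \<le> 1 * norm \<xi>"
            using \<eta> norm_noise_le[of \<xi>] by (intro mult_mono) auto
          then show "exp (\<eta> * norm (sqrt (2 * \<delta>) *\<^sub>R \<xi>)) \<le> exp (1 * norm \<xi>)" by simp
        qed (use M d0 \<epsilon> in auto)
        finally show "\<bar>acc x \<xi> - acc y \<xi>\<bar> \<le> M * \<epsilon> * exp \<eta> * d * exp (1 * norm \<xi>)" by (simp add: mult_ac)
      qed
      also have "\<dots> = ennreal (M * \<epsilon> * exp \<eta> * d) * ennreal (exp (1 * norm \<xi>))"
        using M(1) \<epsilon> d0 by (intro ennreal_mult) auto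
      finally show "emeasure unif (Pair \<xi> -` H) \<le> \<dots>" .
    qed
    also have "\<dots> = ennreal (M * \<epsilon> * exp \<eta> * d) * (\<integral>\<^sup>+\<xi>. ennreal (exp (1 * norm \<xi>)) \<partial>\<gamma>)"
      by (rule nn_integral_cmult) measurable
    also have "\<dots> \<le> ennreal (M * \<epsilon> * exp \<eta> * d) * ennreal (E 1)" by (intro mult_left_mono moment) auto
    also have "\<dots> = ennreal (M * \<epsilon> * exp \<eta> * E 1 * d)"
      using M(1) \<epsilon> d0 E_pos[of 1] by (subst ennreal_mult[symmetric]) (auto simp: mult_ac)
    finally show "emeasure driver H \<le> ennreal (M * \<epsilon> * exp \<eta> * E 1 * d)" .
  qed
  also have "\<dots> = ennreal ((1 - \<rho> * (p / 2) + \<eta> * E 1 + M * \<epsilon> * exp \<eta> * E 1) * d)"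
  proof -
    have "\<rho> * (p / 2) \<le> 1 * 1" using rho_bounds p by (intro mult_mono) auto
    then have "0 \<le> d * (1 - \<rho> * (p / 2) + \<eta> * E 1)" using \<eta> E_pos[of 1] d0 by (intro mult_nonneg_nonneg add_nonneg_nonneg) auto
    then show ?thesis using M(1) \<epsilon> d0 E_pos[of 1]
      by (subst ennreal_plus[symmetric]) (auto simp: algebra_simps)
  qed
  finally show ?thesis by (simp add: d_def)
qed

end

section \<open>Uniqueness of the invariant measure\<close>

lemma abs_diff_le_of_deriv:
  fixes f f' :: "real \<Rightarrow> real"
  assumes "\<And>x. (f has_real_derivative f' x) (at x)" "\<And>x. \<bar>f' x\<bar> \<le> 1"
  shows "\<bar>f x - f y\<bar> \<le> \<bar>x - y\<bar>"
  using field_differentiable_bound[of UNIV f f' 1 x y] assms by simp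

lemma abs_cos_diff_le: "\<bar>cos x - cos y\<bar> \<le> \<bar>x - y\<bar>" for x y :: real
  by (rule abs_diff_le_of_deriv[of cos "\<lambda>x. - sin x"]) (auto intro!: derivative_eq_intros)

lemma abs_sin_diff_le: "\<bar>sin x - sin y\<bar> \<le> \<bar>x - y\<bar>" for x y :: real
  by (rule abs_diff_le_of_deriv[of sin cos]) (auto intro!: derivative_eq_intros)

context pcn_moment_chain
begin

text \<open>The noise radius \<open>k\<close> is large enough for the error to consume at most half
  of the gain \<open>(1 - q) * (p / 2)\<close>.\<close>

lemma pair_op_lyapunov:
  assumes W: "lyapunov_profile W v q \<rho>"
    and far: "\<And>x z. norm x \<ge> R1 \<Longrightarrow> norm (z - (1 - \<rho>) *\<^sub>R x) \<le> k \<Longrightarrow>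
      p \<le> accept_prob \<Phi> x z \<and> norm z \<le> (1 - \<rho> / 2) * norm x" and p: "0 \<le> p" "p \<le> 1" and R1: "R1 \<ge> 1"
    and k: "exp (- k) * E 1 \<le> 1 / 2" "exp (- k) * E (v + 1) \<le> (1 - q) * p / 4"
    and z: "z \<in> S \<times> S"
  shows "pair_op (\<lambda>z. ennreal (W (norm (fst z)) + W (norm (snd z)))) z
    \<le> ennreal ((1 - (1 - q) * p / 4) * (W (norm (fst z)) + W (norm (snd z))) + 2 * (W R1 * E v))"
proof -
  interpret W: lyapunov_profile W v q \<rho> by fact
  have Wx: "0 \<le> W (norm y)" for y :: 'a by (rule W.profile_nonneg) simp
  have W1: "0 \<le> W R1 * E v" using R1 E_pos[of v] by (intro mult_nonneg_nonneg W.profile_nonneg) auto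
  define l where "l = 1 - (1 - q) * p / 4"
  have l0: "0 \<le> l"
  proof -
    have "(1 - q) * p \<le> 1 * 1" using W.profile_const p by (intro mult_mono) auto
    then show ?thesis by (simp add: l_def)
  qed
  have one: "(\<integral>\<^sup>+\<omega>. ennreal (W (norm (step x \<omega>))) \<partial>driver) \<le> ennreal (l * W (norm x) + W R1 * E v)"
    if "x \<in> S" for x
  proof -
    have "(\<integral>\<^sup>+\<omega>. ennreal (W (norm (step x \<omega>))) \<partial>driver)
      \<le> ennreal ((1 - (1 - q) * (p / 2) + exp (- k) * E (v + 1)) * W (norm x) + W R1 * E v)"
      by (rule step_lyapunov[OF W far p R1 k(1) that])
    also have "\<dots> \<le> ennreal (l * W (norm x) + W R1 * E v)"
      using k(2) Wx by (intro ennreal_leI add_right_mono mult_right_mono) (auto simp: l_def)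
    finally show ?thesis .
  qed
  have xy: "fst z \<in> S" "snd z \<in> S" using z by auto
  have [measurable]: "fst z \<in> space \<gamma>" "snd z \<in> space \<gamma>" using xy by (simp_all add: space_noise)
  have "pair_op (\<lambda>z. ennreal (W (norm (fst z)) + W (norm (snd z)))) z
      \<le> (\<integral>\<^sup>+\<omega>. ennreal (W (norm (step (fst z) \<omega>))) + ennreal (W (norm (step (snd z) \<omega>))) \<partial>driver)"
    using pair_op_step_le[OF z, of "\<lambda>z. ennreal (W (norm (fst z)) + W (norm (snd z)))"] Wx by simp
  also have "\<dots> = (\<integral>\<^sup>+\<omega>. ennreal (W (norm (step (fst z) \<omega>))) \<partial>driver) + (\<integral>\<^sup>+\<omega>. ennreal (W (norm (step (snd z) \<omega>))) \<partial>driver)"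
    by (rule nn_integral_add) measurable
  also have "\<dots> \<le> ennreal (l * W (norm (fst z)) + W R1 * E v) + ennreal (l * W (norm (snd z)) + W R1 * E v)"
    by (intro add_mono one xy)
  also have "\<dots> = ennreal (l * (W (norm (fst z)) + W (norm (snd z))) + 2 * (W R1 * E v))"
    using l0 Wx W1 by (subst ennreal_plus[symmetric]) (auto simp: algebra_simps)
  finally show ?thesis by (simp add: l_def)
qed

end

context pcn_chain
begin

lemma kernel_iterate_invariant:
  assumes "invariant_measure \<gamma> transition \<mu>"
  shows "kernel_iterate transition n \<mu> = \<mu>"
  using assms by (induction n) (simp_all add: kernel_iterate_Suc kernel_iterate_0 invariant_measure_def)

text \<open>The product coupling of two invariant measures is moved by the coupled chain. It keeps
  its marginals, while the mean of the truncated distance tends to zero, so bounded Lipschitz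
  functions, in particular sines and cosines of linear functionals, have equal integrals. The
  truncation at \<open>1\<close> matters: \<open>g\<close> need not be integrable, as nothing is
  known about moments of the invariant measures.\<close>

lemma invariant_unique:
  assumes f: "\<And>z. z \<in> S \<times> S \<Longrightarrow> (pair_op ^^ n) f z \<le> ennreal (1 / 2) * f z"
    and lower: "\<And>z. z \<in> S \<times> S \<Longrightarrow> ennreal (min 1 (norm (fst z - snd z))) \<le> f z"
    and upper: "\<And>z. z \<in> S \<times> S \<Longrightarrow> f z \<le> ennreal (g z)"
    and g: "g \<in> borel_measurable (\<gamma> \<Otimes>\<^sub>M \<gamma>)" "\<And>z. 0 \<le> g z"
    and \<mu>: "invariant_measure \<gamma> transition \<mu>" and \<nu>: "invariant_measure \<gamma> transition \<nu>"
  shows "\<mu> = \<nu>"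
proof -
  have s: "sets \<mu> = sets \<gamma>" "sets \<nu> = sets \<gamma>" and p\<mu>: "prob_space \<mu>" and p\<nu>: "prob_space \<nu>"
    using \<mu> \<nu> by (auto simp: invariant_measure_def space_prob_algebra)
  interpret \<mu>: prob_space \<mu> by fact
  interpret \<nu>: prob_space \<nu> by fact
  interpret pair_prob_space \<mu> \<nu> ..
  let ?h = "\<lambda>z :: 'a \<times> 'a. min 1 (norm (fst z - snd z))"
  let ?\<pi> = "\<mu> \<Otimes>\<^sub>M \<nu>"
  have s\<pi>: "sets ?\<pi> = sets (\<gamma> \<Otimes>\<^sub>M \<gamma>)" by (rule sets_pair_measure_cong[OF s])
  then have sp: "space ?\<pi> = S \<times> S"
    using sets_eq_imp_space_eq[OF s\<pi>] by (simp add: space_pair_measure space_noise)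
  have \<pi>: "?\<pi> \<in> space (prob_algebra (\<gamma> \<Otimes>\<^sub>M \<gamma>))"
    using s\<pi> prob_space_axioms by (simp add: space_prob_algebra)
  have m: "distr ?\<pi> \<gamma> fst = \<mu>" "distr ?\<pi> \<gamma> snd = \<nu>"
  proof -
    have "distr ?\<pi> \<gamma> fst = distr ?\<pi> \<mu> fst" by (rule distr_cong) (simp_all add: s)
    then show "distr ?\<pi> \<gamma> fst = \<mu>" using \<nu>.distr_pair_fst by simp
    have "distr ?\<pi> \<gamma> snd = distr ?\<pi> \<nu> snd" by (rule distr_cong) (simp_all add: s)
    also have "\<dots> = distr (distr (\<nu> \<Otimes>\<^sub>M \<mu>) ?\<pi> (\<lambda>(x, y). (y, x))) \<nu> snd"
      by (subst distr_pair_swap) simp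
    also have "\<dots> = distr (\<nu> \<Otimes>\<^sub>M \<mu>) \<nu> fst"
      by (subst distr_distr) (auto intro!: distr_cong simp: o_def split: prod.split)
    finally show "distr ?\<pi> \<gamma> snd = \<nu>" using \<mu>.distr_pair_fst by simp
  qed
  define \<pi>k where "\<pi>k k = kernel_iterate coupling (k * n) ?\<pi>" for k
  have \<pi>k: "\<pi>k k \<in> space (prob_algebra (\<gamma> \<Otimes>\<^sub>M \<gamma>))" "distr (\<pi>k k) \<gamma> fst = \<mu>" "distr (\<pi>k k) \<gamma> snd = \<nu>" for k
    unfolding \<pi>k_def using kernel_iterate_coupling[OF \<pi>, of "k * n"] m
      kernel_iterate_invariant[OF \<mu>] kernel_iterate_invariant[OF \<nu>] by auto
  have [measurable]: "g \<in> borel_measurable ?\<pi>" using g(1) by (simp add: measurable_cong_sets[OF s\<pi> refl])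
  have bound: "(\<integral>\<^sup>+z. ennreal (?h z) \<partial>\<pi>k k) \<le> ennreal (LINT z|?\<pi>. min 1 ((1 / 2) ^ k * g z))" for k
  proof -
    have "(\<integral>\<^sup>+z. ennreal (?h z) \<partial>\<pi>k k) \<le> (\<integral>\<^sup>+z. (pair_op ^^ (k * n)) (\<lambda>z. ennreal (?h z)) z \<partial>?\<pi>)"
      unfolding \<pi>k_def by (rule nn_integral_kernel_iterate_le[OF \<pi>])
    also have "\<dots> \<le> (\<integral>\<^sup>+z. ennreal (min 1 ((1 / 2) ^ k * g z)) \<partial>?\<pi>)"
    proof (rule nn_integral_mono)
      fix z assume "z \<in> space ?\<pi>"
      then have z: "z \<in> S \<times> S" by (simp add: sp)
      have 1: "(pair_op ^^ (k * n)) (\<lambda>z. ennreal (?h z)) z \<le> 1" by (rule pair_op_pow_le_1[OF _ z]) simp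
      have "(pair_op ^^ (k * n)) (\<lambda>z. ennreal (?h z)) z \<le> (pair_op ^^ (k * n)) f z"
        by (rule pair_op_iter_mono[OF lower z])
      also have "\<dots> \<le> ennreal ((1 / 2) ^ k) * f z" by (rule pair_op_pow_contract[OF f _ z]) auto
      also have "\<dots> \<le> ennreal ((1 / 2) ^ k) * ennreal (g z)" using upper[OF z] by (intro mult_left_mono) auto
      also have "\<dots> = ennreal ((1 / 2) ^ k * g z)" using g(2) by (subst ennreal_mult) auto
      finally show "(pair_op ^^ (k * n)) (\<lambda>z. ennreal (?h z)) z \<le> ennreal (min 1 ((1 / 2) ^ k * g z))"
        using 1 by (auto simp: min_def)
    qed
    also have "\<dots> = ennreal (LINT z|?\<pi>. min 1 ((1 / 2) ^ k * g z))"
      using g(2) by (intro nn_integral_eq_integral integrable_const_bound[where B=1]) auto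
    finally show ?thesis .
  qed
  have lim: "(\<lambda>k. LINT z|?\<pi>. min 1 ((1 / 2) ^ k * g z)) \<longlonglongrightarrow> 0"
  proof -
    have "(\<lambda>k. LINT z|?\<pi>. min 1 ((1 / 2) ^ k * g z)) \<longlonglongrightarrow> (LINT z|?\<pi>. 0)"
    proof (rule integral_dominated_convergence[where w="\<lambda>_. 1"])
      show "AE z in ?\<pi>. (\<lambda>k. min 1 ((1 / 2) ^ k * g z)) \<longlonglongrightarrow> 0"
      proof (rule AE_I2)
        fix z
        have "(\<lambda>k. min 1 ((1 / 2) ^ k * g z)) \<longlonglongrightarrow> min 1 (0 * g z)"
          by (intro tendsto_intros LIMSEQ_realpow_zero) auto
        then show "(\<lambda>k. min 1 ((1 / 2) ^ k * g z)) \<longlonglongrightarrow> 0" by simp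
      qed
      show "AE z in ?\<pi>. norm (min 1 ((1 / 2) ^ k * g z)) \<le> 1" for k using g(2) by (intro AE_I2) auto
    qed auto
    then show ?thesis by simp
  qed
  have lip: "(LINT x|\<mu>. F x) = (LINT x|\<nu>. F x)"
    if F: "F \<in> borel_measurable borel" "\<And>x. \<bar>F x\<bar> \<le> 1" "\<And>x y. \<bar>F x - F y\<bar> \<le> c * norm (x - y)" and c: "0 \<le> c"
    for F :: "'a \<Rightarrow> real" and c
  proof -
    have F\<gamma>: "F \<in> borel_measurable \<gamma>" using F(1) by (rule noise_from_borel)
    have le: "\<bar>(LINT x|\<mu>. F x) - (LINT x|\<nu>. F x)\<bar> \<le> (2 + c) * (LINT z|?\<pi>. min 1 ((1 / 2) ^ k * g z))" for k
    proof -
      have [measurable_cong]: "sets (\<pi>k k) = sets (\<gamma> \<Otimes>\<^sub>M \<gamma>)" and "prob_space (\<pi>k k)"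
        using \<pi>k(1) by (auto simp: space_prob_algebra)
      then interpret K: prob_space "\<pi>k k" by simp
      have mf[measurable]: "fst \<in> \<pi>k k \<rightarrow>\<^sub>M \<gamma>" "snd \<in> \<pi>k k \<rightarrow>\<^sub>M \<gamma>" by measurable
      note mb[measurable] = mf[THEN noise_to_borel]
      have Ff: "(\<lambda>z. F (fst z)) \<in> borel_measurable (\<pi>k k)" "(\<lambda>z. F (snd z)) \<in> borel_measurable (\<pi>k k)"
        by (rule measurable_compose[OF mf(1) F\<gamma>], rule measurable_compose[OF mf(2) F\<gamma>])
      have i: "integrable (\<pi>k k) (\<lambda>z. F (fst z))" "integrable (\<pi>k k) (\<lambda>z. F (snd z))"
        using F(2) Ff by (auto intro!: K.integrable_const_bound[where B=1])
      have ih: "integrable (\<pi>k k) ?h" by (intro K.integrable_const_bound[where B=1]) auto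
      have "(LINT x|\<mu>. F x) - (LINT x|\<nu>. F x) = (LINT z|\<pi>k k. F (fst z)) - (LINT z|\<pi>k k. F (snd z))"
        using \<pi>k(2,3)[of k] integral_distr[OF mf(1) F\<gamma>] integral_distr[OF mf(2) F\<gamma>] by simp
      also have "\<dots> = (LINT z|\<pi>k k. F (fst z) - F (snd z))" using i by simp
      \<comment> \<open>A function bounded by \<open>1\<close> with Lipschitz constant
        \<open>c\<close> varies by at most \<open>2\<close> and by at most \<open>c\<close> times
        the distance, hence by at most \<open>2 + c\<close> times the truncated distance.\<close>
      also have "\<bar>\<dots>\<bar> \<le> (LINT z|\<pi>k k. (2 + c) * ?h z)"
      proof (rule order_trans[OF integral_abs_bound integral_mono])
        fix z :: "'a \<times> 'a"
        have "\<bar>F (fst z) - F (snd z)\<bar> \<le> 2" using F(2)[of "fst z"] F(2)[of "snd z"] by linarith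
        moreover have "(2 + c) * ?h z = min (2 + c) ((2 + c) * norm (fst z - snd z))"
          using c by (simp add: min_mult_distrib_left)
        moreover have "c * norm (fst z - snd z) \<le> (2 + c) * norm (fst z - snd z)" by (intro mult_right_mono) auto
        ultimately show "\<bar>F (fst z) - F (snd z)\<bar> \<le> (2 + c) * ?h z" using F(3)[of "fst z" "snd z"] c by simp
      qed (use i ih in auto)
      also have "\<dots> = (2 + c) * (LINT z|\<pi>k k. ?h z)" by simp
      also have "\<dots> \<le> (2 + c) * (LINT z|?\<pi>. min 1 ((1 / 2) ^ k * g z))"
      proof (rule mult_left_mono)
        have "ennreal (LINT z|\<pi>k k. ?h z) = (\<integral>\<^sup>+z. ennreal (?h z) \<partial>\<pi>k k)"
          using ih by (intro nn_integral_eq_integral[symmetric]) auto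
        also note bound[of k]
        finally show "(LINT z|\<pi>k k. ?h z) \<le> (LINT z|?\<pi>. min 1 ((1 / 2) ^ k * g z))"
          using g(2) by (subst (asm) ennreal_le_iff) (auto intro!: integral_nonneg_AE)
      qed (use c in simp)
      finally show ?thesis .
    qed
    have "(\<lambda>k. (2 + c) * (LINT z|?\<pi>. min 1 ((1 / 2) ^ k * g z))) \<longlonglongrightarrow> (2 + c) * 0"
      by (intro tendsto_intros lim)
    then have "\<bar>(LINT x|\<mu>. F x) - (LINT x|\<nu>. F x)\<bar> \<le> (2 + c) * 0"
      by (rule tendsto_lowerbound) (use le in auto)
    then show ?thesis by simp
  qed
  have to_borel: "(\<lambda>x. x) \<in> \<mu> \<rightarrow>\<^sub>M borel" "(\<lambda>x. x) \<in> \<nu> \<rightarrow>\<^sub>M borel"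
    using noise_to_borel[of "\<lambda>x. x" \<gamma>] by (simp_all add: measurable_cong_sets[OF s(1) refl] measurable_cong_sets[OF s(2) refl])
  \<comment> \<open>The invariant measures live on the trace sigma-algebra of \<open>S\<close>; they
    are extended to the Borel sets of the whole space, where characteristic functionals determine
    them.\<close>
  have "distr \<mu> borel (\<lambda>x. x) = distr \<nu> borel (\<lambda>x. x)"
  proof (rule char_fun_uniqueness)
    show P: "prob_space (distr \<mu> borel (\<lambda>x. x))" "prob_space (distr \<nu> borel (\<lambda>x. x))"
      using \<mu>.prob_space_distr[OF to_borel(1)] \<nu>.prob_space_distr[OF to_borel(2)] by auto
    fix h :: 'a
    have c: "(LINT x|\<mu>. cos (h \<bullet> x)) = (LINT x|\<nu>. cos (h \<bullet> x))"
    proof (rule lip[of _ "norm h"])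
      fix x y
      have "\<bar>cos (h \<bullet> x) - cos (h \<bullet> y)\<bar> \<le> \<bar>h \<bullet> x - h \<bullet> y\<bar>"
        by (rule abs_cos_diff_le)
      also have "\<dots> \<le> norm h * norm (x - y)" unfolding inner_diff_right[symmetric] by (rule Cauchy_Schwarz_ineq2)
      finally show "\<bar>cos (h \<bullet> x) - cos (h \<bullet> y)\<bar> \<le> norm h * norm (x - y)" .
    qed auto
    have s': "(LINT x|\<mu>. sin (h \<bullet> x)) = (LINT x|\<nu>. sin (h \<bullet> x))"
    proof (rule lip[of _ "norm h"])
      fix x y
      have "\<bar>sin (h \<bullet> x) - sin (h \<bullet> y)\<bar> \<le> \<bar>h \<bullet> x - h \<bullet> y\<bar>"
        by (rule abs_sin_diff_le)
      also have "\<dots> \<le> norm h * norm (x - y)" unfolding inner_diff_right[symmetric] by (rule Cauchy_Schwarz_ineq2)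
      finally show "\<bar>sin (h \<bullet> x) - sin (h \<bullet> y)\<bar> \<le> norm h * norm (x - y)" .
    qed auto
    have d: "(LINT x|distr M borel (\<lambda>x. x). F (h \<bullet> x)) = (LINT x|M. F (h \<bullet> x))"
      if "(\<lambda>x. x) \<in> M \<rightarrow>\<^sub>M borel" "F \<in> borel_measurable borel" for M :: "'a measure" and F :: "real \<Rightarrow> real"
      using that by (subst integral_distr) auto
    show "char_fun (distr \<mu> borel (\<lambda>x. x)) h = char_fun (distr \<nu> borel (\<lambda>x. x)) h"
      using c s' by (subst (1 2) char_fun_eq_cos) (use P in \<open>auto simp: d[OF to_borel(1)] d[OF to_borel(2)]\<close>)
  qed auto
  then have e: "emeasure (distr \<mu> borel (\<lambda>x. x)) A = emeasure (distr \<nu> borel (\<lambda>x. x)) A" for A by simp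
  show ?thesis
  proof (rule measure_eqI)
    fix A assume "A \<in> sets \<mu>"
    then have "A \<in> sets \<gamma>" using s by simp
    then have "A \<in> sets borel" "A \<subseteq> space \<mu>" "A \<subseteq> space \<nu>"
      using sets_noise_iff[of A] sets_eq_imp_space_eq[OF s(1)] sets_eq_imp_space_eq[OF s(2)] by (auto simp: space_noise)
    then show "emeasure \<mu> A = emeasure \<nu> A"
      using e[of A] emeasure_distr[OF to_borel(1), of A] emeasure_distr[OF to_borel(2), of A] by (simp add: Int_absorb2)
  qed (use s in simp)
qed

end

section \<open>Contraction with uniform constants\<close>

context pcn_moment_chain
begin

text \<open>All constants enter as hypotheses, so that they can be fixed before \<open>S\<close> and
  \<open>\<gamma>\<close>. The weak Harris step contracts the distance with \<open>\<beta>\<close>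
  in front of the Lyapunov function; comparing it with the weight \<open>1\<close> costs a factor
  \<open>1 / sqrt \<beta>\<close>, which \<open>K\<close> rounds of contraction make up for.\<close>

lemma weighted_contraction:
  assumes W: "lyapunov_profile W v q \<rho>"
    and far: "\<And>x z. norm x \<ge> R1 \<Longrightarrow> norm (z - (1 - \<rho>) *\<^sub>R x) \<le> k \<Longrightarrow>
      p1 \<le> accept_prob \<Phi> x z \<and> norm z \<le> (1 - \<rho> / 2) * norm x" and p1: "0 < p1" "p1 \<le> 1" and R1: "R1 \<ge> 1"
    and p: "\<And>x z. norm (z - (1 - \<rho>) *\<^sub>R x) \<le> k \<Longrightarrow> p \<le> accept_prob \<Phi> x z" "0 < p" "p \<le> 1"
    and k: "exp (- k) * E 1 \<le> 1 / 2" "exp (- k) * E (v + 1) \<le> (1 - q) * p1 / 4"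
    and \<eta>: "0 < \<eta>" "\<eta> \<le> 1" and \<epsilon>: "0 < \<epsilon>" "\<epsilon> \<le> 1" and u: "norm (u :: 'a) = 1"
    and M: "0 \<le> M" "\<And>x y z. \<bar>accept_prob \<Phi> x ((1 - \<rho>) *\<^sub>R x + z) - accept_prob \<Phi> y ((1 - \<rho>) *\<^sub>R y + z)\<bar>
     \<le> M * (norm (x - y) * exp (\<eta> * max (norm x) (norm y))) * exp (\<eta> * norm z)"
    and \<theta>1: "\<theta>1 = \<rho> * p / 4" "\<eta> * E 1 \<le> \<rho> * p / 8" "M * \<epsilon> * exp \<eta> * E 1 \<le> \<rho> * p / 8"
    and l: "l = 1 - (1 - q) * p1 / 4" and A: "A = 2 * (W R1 * E v) / (1 - l) + 1"
    and N: "N \<ge> 1" "l ^ N \<le> 1 / 4"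
    and s: "(1 - \<rho>) * s + k \<le> s" "\<And>t. 0 \<le> t \<Longrightarrow> W t \<le> 4 * A \<Longrightarrow> t \<le> s"
    and Ns: "1 / \<epsilon> * ((1 - \<rho>) ^ N * (2 * s) * exp (\<eta> * s)) \<le> 1 / 2"
    and \<theta>2: "\<theta>2 = 1 / 2 * (p / 2) ^ N"
    and \<beta>: "0 < \<beta>" "\<beta> \<le> 1" "\<beta> * A \<le> \<theta>1 / 2" "\<beta> * A \<le> \<theta>2 / 2"
    and \<alpha>: "(1 + 2 * \<beta> * A) / (1 + 4 * \<beta> * A) \<le> \<alpha>" "1 - \<theta>1 / 2 \<le> \<alpha>" "1 - \<theta>2 / 2 \<le> \<alpha>"
    and K: "sqrt \<alpha> ^ K \<le> sqrt \<beta> / 2"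
    and z: "z \<in> S \<times> S"
  shows "(pair_op ^^ (K * N)) (\<lambda>(x, y). ennreal (weighted_dist \<eta> \<epsilon> (\<lambda>x. W (norm x)) x y)) z
     \<le> ennreal (1 / 2) * (\<lambda>(x, y). ennreal (weighted_dist \<eta> \<epsilon> (\<lambda>x. W (norm x)) x y)) z"
proof -
  interpret W: lyapunov_profile W v q \<rho> by fact
  have Wx: "0 \<le> W (norm y)" for y :: 'a by (rule W.profile_nonneg) simp
  define U where "U z = W (norm (fst z)) + W (norm (snd z))" for z :: "'a \<times> 'a"
  define d where "d z = path_dist \<eta> \<epsilon> (fst z) (snd z)" for z :: "'a \<times> 'a"
  have \<eta>0: "0 \<le> \<eta>" using \<eta> by simp
  have d0: "0 \<le> d z" "d z \<le> 1" for z
    unfolding d_def by (rule path_dist_nonneg[OF \<eta>0 \<epsilon>(1) u], rule path_dist_le_1)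
  have U0: "0 \<le> U z" for z unfolding U_def using Wx by (intro add_nonneg_nonneg)
  have W1: "0 \<le> 2 * (W R1 * E v)"
    using R1 E_pos[of v] by (intro mult_nonneg_nonneg W.profile_nonneg) auto
  have l01: "0 \<le> l" "l < 1"
  proof -
    have "(1 - q) * p1 \<le> 1 * 1" using W.profile_const p1 by (intro mult_mono) auto
    then show "0 \<le> l" by (simp add: l)
    show "l < 1" using W.profile_const p1 by (simp add: l)
  qed
  have A1: "A \<ge> 1" using W1 l01 by (simp add: A)
  have th1: "0 < \<theta>1" "\<theta>1 < 1"
  proof -
    show "0 < \<theta>1" using rho_bounds p by (simp add: \<theta>1)
    have "\<rho> * p \<le> 1 * 1" using rho_bounds p by (intro mult_mono) auto
    then show "\<theta>1 < 1" by (simp add: \<theta>1)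
  qed
  have th2: "0 < \<theta>2" "\<theta>2 < 1"
  proof -
    show "0 < \<theta>2" using p by (simp add: \<theta>2)
    have "(p / 2) ^ N \<le> 1" using p by (intro power_le_one) auto
    then show "\<theta>2 < 1" by (simp add: \<theta>2)
  qed
  have mU: "U \<in> borel_measurable (\<gamma> \<Otimes>\<^sub>M \<gamma>)" unfolding U_def[abs_def] by measurable
  have UT: "pair_op (\<lambda>z. ennreal (U z)) z \<le> ennreal (l * U z + 2 * (W R1 * E v))" if "z \<in> S \<times> S" for z
    unfolding U_def l by (rule pair_op_lyapunov[OF W far _ p1(2) R1 k that]) (use p1 in auto)
  have dT: "pair_op (\<lambda>z. ennreal (d z)) z \<le> ennreal ((1 - \<theta>1) * d z)" if z: "z \<in> S \<times> S" and dz: "d z < 1" for z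
  proof -
    have "pair_op (\<lambda>(x, y). ennreal (path_dist \<eta> \<epsilon> x y)) (fst z, snd z)
      \<le> ennreal ((1 - \<rho> * (p / 2) + \<eta> * E 1 + M * \<epsilon> * exp \<eta> * E 1) * path_dist \<eta> \<epsilon> (fst z) (snd z))"
      by (rule pair_op_path_dist[OF \<eta> \<epsilon> u p(1) _ p(3) k(1) M]) (use z dz p in \<open>auto simp: d_def\<close>)
    also have "\<dots> \<le> ennreal ((1 - \<theta>1) * d z)"
      unfolding d_def[symmetric] using \<theta>1 d0 by (intro ennreal_leI mult_right_mono) auto
    finally show ?thesis by (simp add: d_def split_def)
  qed
  \<comment> \<open>The sublevel set of \<open>U\<close> lies in the ball of radius
    \<open>s\<close>, so the initial separation is at most \<open>2 * s\<close>; after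
    \<open>N\<close> joint acceptances it is so small that the segment between the states shows the
    path distance to be at most \<open>1 / 2\<close>.\<close>
  have small: "(pair_op ^^ N) (\<lambda>z. ennreal (d z)) z \<le> ennreal (1 - \<theta>2)" if z: "z \<in> S \<times> S" and Uz: "U z \<le> 4 * A" for z
  proof -
    have n: "norm (fst z) \<le> s" "norm (snd z) \<le> s"
      using Uz Wx[of "fst z"] Wx[of "snd z"] by (auto intro!: s(2) simp: U_def)
    have s0: "0 \<le> s" using n(1) norm_ge_zero order_trans by blast
    have "(pair_op ^^ N) (\<lambda>z. ennreal (d z)) (fst z, snd z) \<le> ennreal (1 - 1 / 2 * (p / 2) ^ N)"
    proof (rule pair_op_pow_small[where k=k and s=s and b="2 * s", OF p(1)])
      show "norm (fst z - snd z) \<le> 2 * s" using norm_triangle_ineq4[of "fst z" "snd z"] n by simp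
      fix x y :: 'a assume xy: "norm x \<le> s" "norm y \<le> s" "norm (x - y) \<le> (1 - \<rho>) ^ N * (2 * s)"
      have "path_dist \<eta> \<epsilon> x y \<le> 1 / \<epsilon> * (norm (x - y) * exp (\<eta> * max (norm x) (norm y)))"
        by (rule path_dist_segment[OF \<eta>0 \<epsilon>(1) u])
      also have "\<dots> \<le> 1 / \<epsilon> * ((1 - \<rho>) ^ N * (2 * s) * exp (\<eta> * s))"
        using xy \<eta> \<epsilon> s0 rho_bounds by (intro mult_left_mono mult_mono) auto
      finally show "ennreal (d (x, y)) \<le> ennreal (1 / 2)" using Ns by (intro ennreal_leI) (simp add: d_def)
    qed (use p k s n z d0 in auto)
    then show ?thesis by (simp add: \<theta>2)
  qed
  have harris: "(pair_op ^^ N) (\<lambda>z. ennreal (sqrt (d z * (1 + \<beta> * U z)))) z \<le> ennreal (sqrt \<alpha>) * ennreal (sqrt (d z * (1 + \<beta> * U z)))"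
    if "z \<in> S \<times> S" for z
  proof -
    have "(pair_op ^^ N) (\<lambda>z. ennreal (sqrt (d z * (1 + \<beta> * U z)))) z \<le> ennreal (sqrt \<alpha> * sqrt (d z * (1 + \<beta> * U z)))"
      by (rule weak_harris[OF mU U0 UT d0 dT l01 W1 A N small th1 th2 \<beta>(1,3,4) \<alpha> that])
    then show ?thesis using d0 U0 \<beta> th1 \<alpha>(2) by (subst ennreal_mult[symmetric]) auto
  qed
  have le: "sqrt \<beta> * sqrt (d w * (1 + U w)) \<le> sqrt (d w * (1 + \<beta> * U w))" for w
  proof -
    have "\<beta> * (d w * (1 + U w)) \<le> d w * (1 + \<beta> * U w)"
    proof -
      have "\<beta> * (1 + U w) \<le> 1 + \<beta> * U w" using \<beta> by (simp add: distrib_left)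
      from mult_left_mono[OF this d0(1)[of w]] show ?thesis by (simp add: mult_ac)
    qed
    then show ?thesis by (simp add: real_sqrt_mult[symmetric])
  qed
  have le2: "sqrt (d w * (1 + \<beta> * U w)) \<le> sqrt (d w * (1 + U w))" for w
    using \<beta> U0 d0 by (intro real_sqrt_le_mono mult_left_mono add_left_mono) (auto simp: mult_left_le_one_le)
  have \<alpha>0: "0 \<le> \<alpha>" using \<alpha>(2) th1 by simp
  have wd: "(\<lambda>(x, y). ennreal (weighted_dist \<eta> \<epsilon> (\<lambda>x. W (norm x)) x y)) = (\<lambda>z. ennreal (sqrt (d z * (1 + U z))))"
    by (auto simp: weighted_dist_def d_def U_def add.assoc)
  have "(pair_op ^^ (K * N)) (\<lambda>z. ennreal (sqrt (d z * (1 + U z)))) z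
      \<le> (pair_op ^^ (K * N)) (\<lambda>z. ennreal (1 / sqrt \<beta>) * ennreal (sqrt (d z * (1 + \<beta> * U z)))) z"
  proof (rule pair_op_iter_mono[OF _ z])
    fix w
    have "sqrt (d w * (1 + U w)) \<le> 1 / sqrt \<beta> * sqrt (d w * (1 + \<beta> * U w))"
      using le[of w] \<beta>(1) by (simp add: pos_le_divide_eq mult.commute)
    then show "ennreal (sqrt (d w * (1 + U w))) \<le> ennreal (1 / sqrt \<beta>) * ennreal (sqrt (d w * (1 + \<beta> * U w)))"
      using \<beta> d0 U0 by (subst ennreal_mult[symmetric]) (auto intro!: ennreal_leI)
  qed
  also have "\<dots> \<le> ennreal (1 / sqrt \<beta>) * (pair_op ^^ (K * N)) (\<lambda>z. ennreal (sqrt (d z * (1 + \<beta> * U z)))) z"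
    using \<beta> by (intro pair_op_pow_cmult z) auto
  also have "\<dots> \<le> ennreal (1 / sqrt \<beta>) * (ennreal (sqrt \<alpha> ^ K) * ennreal (sqrt (d z * (1 + \<beta> * U z))))"
    by (intro mult_left_mono pair_op_pow_contract[OF harris _ z]) (use \<alpha>0 in auto)
  also have "\<dots> = ennreal (1 / sqrt \<beta> * (sqrt \<alpha> ^ K * sqrt (d z * (1 + \<beta> * U z))))"
  proof -
    have "0 \<le> sqrt (d z * (1 + \<beta> * U z))"
      using \<beta> d0 U0 by (intro real_sqrt_ge_zero mult_nonneg_nonneg add_nonneg_nonneg) auto
    moreover have "0 \<le> sqrt \<alpha> ^ K" "0 \<le> 1 / sqrt \<beta>" using \<beta> \<alpha>0 by auto
    ultimately show ?thesis by (simp only: ennreal_mult[symmetric] mult_nonneg_nonneg)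
  qed
  also have "\<dots> \<le> ennreal (1 / 2 * sqrt (d z * (1 + U z)))"
  proof (rule ennreal_leI)
    have "1 / sqrt \<beta> * (sqrt \<alpha> ^ K * sqrt (d z * (1 + \<beta> * U z))) \<le> 1 / sqrt \<beta> * (sqrt \<beta> / 2 * sqrt (d z * (1 + U z)))"
      using K le2[of z] \<beta> d0 U0 by (intro mult_left_mono mult_mono) auto
    then show "1 / sqrt \<beta> * (sqrt \<alpha> ^ K * sqrt (d z * (1 + \<beta> * U z))) \<le> 1 / 2 * sqrt (d z * (1 + U z))"
      using \<beta>(1) by simp
  qed
  also have "\<dots> = ennreal (1 / 2) * ennreal (sqrt (d z * (1 + U z)))"
    using d0 U0 by (intro ennreal_mult) auto
  finally show ?thesis unfolding wd .
qed

lemma contraction_conclusions: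
  assumes W: "lyapunov_profile W v q \<rho>" and \<eta>: "0 < \<eta>" and \<epsilon>: "0 < \<epsilon>" "\<epsilon> \<le> 1" and u: "norm (u :: 'a) = 1"
    and contr: "\<And>z. z \<in> S \<times> S \<Longrightarrow> (pair_op ^^ n) (\<lambda>(x, y). ennreal (weighted_dist \<eta> \<epsilon> (\<lambda>x. W (norm x)) x y)) z
     \<le> ennreal (1 / 2) * (\<lambda>(x, y). ennreal (weighted_dist \<eta> \<epsilon> (\<lambda>x. W (norm x)) x y)) z"
  shows "\<nu>1 \<in> space (prob_algebra \<gamma>) \<Longrightarrow> \<nu>2 \<in> space (prob_algebra \<gamma>) \<Longrightarrow>
      transport_cost (weighted_dist \<eta> \<epsilon> (\<lambda>x. W (norm x))) (kernel_iterate transition n \<nu>1) (kernel_iterate transition n \<nu>2)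
      \<le> 1 / 2 * transport_cost (weighted_dist \<eta> \<epsilon> (\<lambda>x. W (norm x))) \<nu>1 \<nu>2"
    and "invariant_measure \<gamma> transition \<mu> \<Longrightarrow> invariant_measure \<gamma> transition \<nu> \<Longrightarrow> \<mu> = \<nu>"
proof -
  interpret W: lyapunov_profile W v q \<rho> by fact
  have Wx: "0 \<le> W (norm y)" for y :: 'a by (rule W.profile_nonneg) simp
  show "\<nu>1 \<in> space (prob_algebra \<gamma>) \<Longrightarrow> \<nu>2 \<in> space (prob_algebra \<gamma>) \<Longrightarrow>
      transport_cost (weighted_dist \<eta> \<epsilon> (\<lambda>x. W (norm x))) (kernel_iterate transition n \<nu>1) (kernel_iterate transition n \<nu>2)
      \<le> 1 / 2 * transport_cost (weighted_dist \<eta> \<epsilon> (\<lambda>x. W (norm x))) \<nu>1 \<nu>2"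
    by (rule transport_cost_le[OF contr])
  assume inv: "invariant_measure \<gamma> transition \<mu>" "invariant_measure \<gamma> transition \<nu>"
  show "\<mu> = \<nu>"
  proof (rule invariant_unique[OF contr _ _ _ _ inv])
    fix z :: "'a \<times> 'a"
    have d: "0 \<le> path_dist \<eta> \<epsilon> (fst z) (snd z)" "path_dist \<eta> \<epsilon> (fst z) (snd z) \<le> 1"
      using path_dist_nonneg[OF less_imp_le[OF \<eta>] \<epsilon>(1) u] path_dist_le_1 by auto
    let ?g = "\<lambda>z :: 'a \<times> 'a. sqrt (1 + W (norm (fst z)) + W (norm (snd z)))"
    let ?w = "weighted_dist \<eta> \<epsilon> (\<lambda>x. W (norm x)) (fst z) (snd z)"
    show "0 \<le> ?g z" using Wx[of "fst z"] Wx[of "snd z"] by simp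
    have "?w \<le> sqrt (1 * (1 + W (norm (fst z)) + W (norm (snd z))))"
      unfolding weighted_dist_def using d Wx[of "fst z"] Wx[of "snd z"] by (intro real_sqrt_le_mono mult_right_mono) auto
    then show "(\<lambda>(x, y). ennreal (weighted_dist \<eta> \<epsilon> (\<lambda>x. W (norm x)) x y)) z \<le> ennreal (?g z)"
      by (simp add: split_def ennreal_leI)
    \<comment> \<open>A number \<open>d\<close> between \<open>0\<close> and \<open>1\<close>
      satisfies \<open>d\<^sup>2 \<le> d * (1 + V x + V y)\<close>.\<close>
    have "path_dist \<eta> \<epsilon> (fst z) (snd z) \<le> ?w"
    proof -
      have "path_dist \<eta> \<epsilon> (fst z) (snd z) * path_dist \<eta> \<epsilon> (fst z) (snd z) \<le> path_dist \<eta> \<epsilon> (fst z) (snd z) * (1 + W (norm (fst z)) + W (norm (snd z)))"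
        using d Wx[of "fst z"] Wx[of "snd z"] by (intro mult_left_mono) auto
      then show ?thesis unfolding weighted_dist_def by (intro real_le_rsqrt) (simp add: power2_eq_square)
    qed
    then show "ennreal (min 1 (norm (fst z - snd z))) \<le> (\<lambda>(x, y). ennreal (weighted_dist \<eta> \<epsilon> (\<lambda>x. W (norm x)) x y)) z"
      using path_dist_ge_norm[OF less_imp_le[OF \<eta>] \<epsilon>(1) u \<epsilon>(2), of "fst z" "snd z"] by (simp add: split_def ennreal_leI)
    show "?g \<in> borel_measurable (\<gamma> \<Otimes>\<^sub>M \<gamma>)" by measurable
  qed
qed

end

lemma exp_decay_le:
  assumes "0 \<le> c" "0 < s"
  obtains k :: real where "\<And>t. t \<ge> k \<Longrightarrow> exp (- t) * c \<le> s"
proof -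
  have "exp (- t) * c \<le> s" if "t \<ge> c / s" for t
  proof -
    have "c \<le> s * t" using that assms by (simp add: pos_divide_le_eq mult.commute)
    also have "\<dots> \<le> s * exp t" using assms exp_ge_add_one_self[of t] by (intro mult_left_mono) linarith+
    finally show ?thesis by (simp add: exp_minus field_simps)
  qed
  then show ?thesis using that by blast
qed

locale pcn_lyapunov = pcn_potential \<Phi> \<delta> \<rho> R \<alpha>\<^sub>l r a + lyapunov_profile W v q \<rho>
  for \<Phi> :: "'a::{real_inner, complete_space, second_countable_topology} \<Rightarrow> real"
    and \<delta> \<rho> R \<alpha>\<^sub>l r a :: real and W :: "real \<Rightarrow> real" and v q :: real
begin

text \<open>The state space and the noise are quantified inside, after \<open>\<eta>\<close>,
  \<open>\<epsilon>\<close> and \<open>n\<close>; this is the independence of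
  \<open>m\<close>.\<close>

definition contracts :: "(real \<Rightarrow> real) \<Rightarrow> real \<Rightarrow> real \<Rightarrow> nat \<Rightarrow> bool" where
  "contracts E \<eta> \<epsilon> n \<longleftrightarrow> (\<forall>S \<gamma>. pcn_moment_chain \<Phi> \<delta> \<rho> R \<alpha>\<^sub>l r a S \<gamma> E \<longrightarrow>
     (\<forall>\<nu>1 \<in> space (prob_algebra \<gamma>). \<forall>\<nu>2 \<in> space (prob_algebra \<gamma>).
        transport_cost (weighted_dist \<eta> \<epsilon> (\<lambda>x. W (norm x)))
          (kernel_iterate (pcn_kernel \<delta> \<Phi> \<gamma>) n \<nu>1) (kernel_iterate (pcn_kernel \<delta> \<Phi> \<gamma>) n \<nu>2)
        \<le> 1 / 2 * transport_cost (weighted_dist \<eta> \<epsilon> (\<lambda>x. W (norm x))) \<nu>1 \<nu>2) \<and>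
     (\<forall>\<mu> \<nu>. invariant_measure \<gamma> (pcn_kernel \<delta> \<Phi> \<gamma>) \<mu> \<longrightarrow> invariant_measure \<gamma> (pcn_kernel \<delta> \<Phi> \<gamma>) \<nu> \<longrightarrow> \<mu> = \<nu>))"

text \<open>\<open>E\<close> is an arbitrary function until a chain is given, hence the absolute
  values and the maximum in \<open>A'\<close>; for an actual chain \<open>E\<close> is positive and
  they disappear.\<close>

theorem uniform_contraction:
  assumes u: "norm (u :: 'a) = 1"
  shows "\<exists>\<eta>\<^sub>0>0. \<forall>\<eta>. 0 < \<eta> \<and> \<eta> \<le> \<eta>\<^sub>0 \<longrightarrow>
       (\<exists>\<epsilon>\<^sub>0>0. \<forall>\<epsilon>. 0 < \<epsilon> \<and> \<epsilon> \<le> \<epsilon>\<^sub>0 \<longrightarrow> (\<exists>n\<ge>1. contracts E \<eta> \<epsilon> n))"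
proof -
  define p1 where "p1 = min 1 (exp \<alpha>\<^sub>l)"
  have p1: "0 < p1" "p1 \<le> 1" by (auto simp: p1_def)
  obtain k1 where k1: "\<And>t. t \<ge> k1 \<Longrightarrow> exp (- t) * \<bar>E 1\<bar> \<le> 1 / 2"
    using exp_decay_le[of "\<bar>E 1\<bar>" "1 / 2"] by auto
  obtain k2 where k2: "\<And>t. t \<ge> k2 \<Longrightarrow> exp (- t) * \<bar>E (v + 1)\<bar> \<le> (1 - q) * p1 / 4"
    using exp_decay_le[of "\<bar>E (v + 1)\<bar>" "(1 - q) * p1 / 4"] p1 profile_const by auto
  define k where "k = max k1 k2"
  have k: "exp (- k) * \<bar>E 1\<bar> \<le> 1 / 2" "exp (- k) * \<bar>E (v + 1)\<bar> \<le> (1 - q) * p1 / 4"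
    using k1 k2 by (auto simp: k_def)
  obtain R1 where R1: "R1 \<ge> 1" and far: "\<And>x z. norm x \<ge> R1 \<Longrightarrow> norm (z - (1 - \<rho>) *\<^sub>R x) \<le> k \<Longrightarrow>
      p1 \<le> accept_prob \<Phi> x z \<and> norm z \<le> (1 - \<rho> / 2) * norm x"
    using accept_prob_far unfolding p1_def by blast
  obtain p where p: "0 < p" "p \<le> 1" and near: "\<And>x z. norm (z - (1 - \<rho>) *\<^sub>R x) \<le> k \<Longrightarrow> p \<le> accept_prob \<Phi> x z"
    using accept_prob_lower by blast
  have rp: "0 < \<rho> * p" using rho_bounds p by simp
  define l where "l = 1 - (1 - q) * p1 / 4"
  have l01: "0 \<le> l" "l < 1"
  proof -
    have "(1 - q) * p1 \<le> 1 * 1" using profile_const p1 by (intro mult_mono) auto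
    then show "0 \<le> l" by (simp add: l_def)
    show "l < 1" using profile_const p1 by (simp add: l_def)
  qed
  define A where "A = 2 * (W R1 * E v) / (1 - l) + 1"
  obtain s0 where s0: "\<And>t. 0 \<le> t \<Longrightarrow> W t \<le> 4 * A \<Longrightarrow> t \<le> s0" using profile_coercive[of "4 * A"] by blast
  \<comment> \<open>Large enough to contain the sublevel set of the profile at \<open>4 * A\<close>,
    and for the ball of radius \<open>s\<close> to be invariant under contraction by
    \<open>1 - \<rho>\<close> followed by noise of norm at most \<open>k\<close>.\<close>
  define s where "s = max s0 (k / \<rho>)"
  have s: "(1 - \<rho>) * s + k \<le> s" "\<And>t. 0 \<le> t \<Longrightarrow> W t \<le> 4 * A \<Longrightarrow> t \<le> s"
  proof -
    have "k / \<rho> \<le> s" by (simp add: s_def)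
    then have "k \<le> \<rho> * s" using rho_bounds by (simp add: divide_le_eq mult.commute)
    then show "(1 - \<rho>) * s + k \<le> s" by (simp add: algebra_simps)
    show "t \<le> s" if "0 \<le> t" "W t \<le> 4 * A" for t using s0[OF that] by (simp add: s_def)
  qed
  \<comment> \<open>Joint acceptance gains \<open>\<rho> * p / 2\<close>; the path weight and the
    differing decisions may each spend \<open>\<rho> * p / 8\<close> of it.\<close>
  define \<theta>1 where "\<theta>1 = \<rho> * p / 4"
  have th1: "0 < \<theta>1" "\<theta>1 < 1"
  proof -
    show "0 < \<theta>1" using rp by (simp add: \<theta>1_def)
    have "\<rho> * p \<le> 1 * 1" using rho_bounds p by (intro mult_mono) auto
    then show "\<theta>1 < 1" by (simp add: \<theta>1_def)
  qed
  define \<eta>\<^sub>0 where "\<eta>\<^sub>0 = min 1 (\<rho> * p / (8 * (\<bar>E 1\<bar> + 1)))"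
  show ?thesis
  proof (rule exI[of _ \<eta>\<^sub>0], intro conjI allI impI)
    show "0 < \<eta>\<^sub>0" using rp by (simp add: \<eta>\<^sub>0_def add_nonneg_pos)
    fix \<eta> assume \<eta>: "0 < \<eta> \<and> \<eta> \<le> \<eta>\<^sub>0"
    have small_coeff: "t * \<bar>E 1\<bar> \<le> \<rho> * p / 8" if "0 \<le> t" "t \<le> \<rho> * p / (8 * (\<bar>E 1\<bar> + 1))" for t
    proof -
      have "t * \<bar>E 1\<bar> \<le> t * (\<bar>E 1\<bar> + 1)" using that by (intro mult_left_mono) auto
      also have "\<dots> \<le> \<rho> * p / 8" using that(2) by (simp add: pos_le_divide_eq add_nonneg_pos mult_ac)
      finally show ?thesis .
    qed
    have \<eta>E: "\<eta> \<le> 1" "\<eta> * \<bar>E 1\<bar> \<le> \<rho> * p / 8" using \<eta> small_coeff[of \<eta>] by (auto simp: \<eta>\<^sub>0_def)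
    have \<eta>p: "\<eta> > 0" using \<eta> by simp
    \<comment> \<open>This constant depends on \<open>\<eta>\<close> and may grow without bound as
      \<open>\<eta>\<close> tends to zero, which is why \<open>\<epsilon>\<close> is chosen after
      \<open>\<eta>\<close>.\<close>
    obtain M where M: "0 \<le> M" "\<And>x y z. \<bar>accept_prob \<Phi> x ((1 - \<rho>) *\<^sub>R x + z) - accept_prob \<Phi> y ((1 - \<rho>) *\<^sub>R y + z)\<bar>
     \<le> M * (norm (x - y) * exp (\<eta> * max (norm x) (norm y))) * exp (\<eta> * norm z)"
      using accept_prob_diff[OF \<eta>p] by blast
    define \<epsilon>\<^sub>0 where "\<epsilon>\<^sub>0 = min 1 (\<rho> * p / (8 * (\<bar>E 1\<bar> + 1)) / (M * exp \<eta> + 1))"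
    show "\<exists>\<epsilon>\<^sub>0>0. \<forall>\<epsilon>. 0 < \<epsilon> \<and> \<epsilon> \<le> \<epsilon>\<^sub>0 \<longrightarrow> (\<exists>n\<ge>1. contracts E \<eta> \<epsilon> n)"
    proof (intro exI[of _ \<epsilon>\<^sub>0] conjI allI impI)
      show "0 < \<epsilon>\<^sub>0" using rp M(1) by (simp add: \<epsilon>\<^sub>0_def add_nonneg_pos)
      fix \<epsilon> assume "0 < \<epsilon> \<and> \<epsilon> \<le> \<epsilon>\<^sub>0"
      then have \<epsilon>: "0 < \<epsilon>" "\<epsilon> \<le> 1" and \<epsilon>2: "\<epsilon> \<le> \<rho> * p / (8 * (\<bar>E 1\<bar> + 1)) / (M * exp \<eta> + 1)" by (auto simp: \<epsilon>\<^sub>0_def)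
      have Mpos: "0 < M * exp \<eta> + 1" using M(1) by (simp add: add_nonneg_pos)
      have "M * \<epsilon> * exp \<eta> \<le> \<epsilon> * (M * exp \<eta> + 1)" using \<epsilon> by (simp add: algebra_simps)
      also have "\<dots> \<le> \<rho> * p / (8 * (\<bar>E 1\<bar> + 1))" using \<epsilon>2 by (subst (asm) pos_le_divide_eq[OF Mpos])
      finally have ME: "M * \<epsilon> * exp \<eta> * \<bar>E 1\<bar> \<le> \<rho> * p / 8" using M(1) \<epsilon> by (intro small_coeff) auto
      \<comment> \<open>One number \<open>N\<close> of steps has to bring the drift factor below
        \<open>1 / 4\<close> and the separation of states in the ball below the scale set by
        \<open>\<epsilon>\<close>.\<close>
      have "eventually (\<lambda>N. l ^ N < 1 / 4) sequentially"
        using l01 by (intro order_tendstoD(2)[OF LIMSEQ_realpow_zero]) auto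
      moreover have "(\<lambda>N. 1 / \<epsilon> * ((1 - \<rho>) ^ N * (2 * s) * exp (\<eta> * s))) \<longlonglongrightarrow> 1 / \<epsilon> * (0 * (2 * s) * exp (\<eta> * s))"
        using rho_bounds by (intro tendsto_intros LIMSEQ_realpow_zero) auto
      then have "eventually (\<lambda>N. 1 / \<epsilon> * ((1 - \<rho>) ^ N * (2 * s) * exp (\<eta> * s)) < 1 / 2) sequentially"
        by (rule order_tendstoD) simp
      ultimately have "eventually (\<lambda>N. l ^ N < 1 / 4 \<and> 1 / \<epsilon> * ((1 - \<rho>) ^ N * (2 * s) * exp (\<eta> * s)) < 1 / 2 \<and> N \<ge> 1) sequentially"
        using eventually_ge_at_top[of "1::nat"] by eventually_elim auto
      then obtain N where N: "N \<ge> 1" "l ^ N \<le> 1 / 4" "1 / \<epsilon> * ((1 - \<rho>) ^ N * (2 * s) * exp (\<eta> * s)) \<le> 1 / 2"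
        unfolding eventually_sequentially by (metis order_less_imp_le order_refl)
      define \<theta>2 where "\<theta>2 = 1 / 2 * (p / 2) ^ N"
      have th2: "0 < \<theta>2" "\<theta>2 < 1"
      proof -
        show "0 < \<theta>2" using p by (simp add: \<theta>2_def)
        have "(p / 2) ^ N \<le> 1" using p by (intro power_le_one) auto
        then show "\<theta>2 < 1" by (simp add: \<theta>2_def)
      qed
      define A' where "A' = max A 1"
      define \<beta> where "\<beta> = min \<theta>1 \<theta>2 / (2 * A')"
      have \<beta>A': "\<beta> * A' = min \<theta>1 \<theta>2 / 2" by (simp add: \<beta>_def A'_def)
      have \<beta>: "0 < \<beta>" "\<beta> \<le> 1"
      proof -
        show "0 < \<beta>" using th1 th2 by (simp add: \<beta>_def A'_def)
        then have "\<beta> * 1 \<le> \<beta> * A'" by (intro mult_left_mono) (auto simp: A'_def)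
        then show "\<beta> \<le> 1" using \<beta>A' th1 by (simp add: min_def split: if_splits)
      qed
      have \<beta>A: "\<beta> * A \<le> \<theta>1 / 2" "\<beta> * A \<le> \<theta>2 / 2"
      proof -
        have "\<beta> * A \<le> \<beta> * A'" using \<beta> by (intro mult_left_mono) (auto simp: A'_def)
        then have "\<beta> * A \<le> min \<theta>1 \<theta>2 / 2" by (simp only: \<beta>A')
        then show "\<beta> * A \<le> \<theta>1 / 2" "\<beta> * A \<le> \<theta>2 / 2" by auto
      qed
      define \<alpha> where "\<alpha> = max (max ((1 + 2 * \<beta> * A') / (1 + 4 * \<beta> * A')) (1 - \<theta>1 / 2)) (1 - \<theta>2 / 2)"
      have bA: "0 < \<beta> * A'" "0 < A' * \<beta>" using \<beta> by (simp_all add: A'_def)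
      have \<alpha>: "0 \<le> \<alpha>" "\<alpha> < 1" using th1 th2 bA by (auto simp: \<alpha>_def divide_less_eq)
      have "(\<lambda>K. sqrt \<alpha> ^ K) \<longlonglongrightarrow> 0" using \<alpha> by (intro LIMSEQ_realpow_zero) auto
      then have "eventually (\<lambda>K. sqrt \<alpha> ^ K < sqrt \<beta> / 2) sequentially" using \<beta> by (intro order_tendstoD) auto
      then have "eventually (\<lambda>K. sqrt \<alpha> ^ K < sqrt \<beta> / 2 \<and> K \<ge> 1) sequentially"
        using eventually_ge_at_top[of "1::nat"] by eventually_elim auto
      then obtain K where K: "K \<ge> 1" "sqrt \<alpha> ^ K \<le> sqrt \<beta> / 2"
        unfolding eventually_sequentially by (metis order_less_imp_le order_refl)
      show "\<exists>n\<ge>1. contracts E \<eta> \<epsilon> n"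
      proof (rule exI[of _ "K * N"], rule conjI)
        show "1 \<le> K * N" using K N by (cases K; cases N) auto
        show "contracts E \<eta> \<epsilon> (K * N)"
          unfolding contracts_def
        proof (intro allI impI, goal_cases)
          case (1 S \<gamma>)
          then interpret C: pcn_moment_chain \<Phi> \<delta> \<rho> R \<alpha>\<^sub>l r a S \<gamma> E .
          have E0: "\<bar>E x\<bar> = E x" for x using C.E_pos[of x] by simp
          have "0 \<le> 2 * (W R1 * E v) / (1 - l)"
            using l01 R1 C.E_pos[of v] by (intro divide_nonneg_pos mult_nonneg_nonneg profile_nonneg) auto
          then have AA: "A' = A" by (simp add: A'_def A_def)
          have contr: "(C.pair_op ^^ (K * N)) (\<lambda>(x, y). ennreal (weighted_dist \<eta> \<epsilon> (\<lambda>x. W (norm x)) x y)) z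
            \<le> ennreal (1 / 2) * (\<lambda>(x, y). ennreal (weighted_dist \<eta> \<epsilon> (\<lambda>x. W (norm x)) x y)) z"
            if "z \<in> S \<times> S" for z
            by (rule C.weighted_contraction[OF lyapunov_profile_axioms far p1 R1 near p k[unfolded E0] \<eta>p \<eta>E(1) \<epsilon> u M
                \<theta>1_def \<eta>E(2)[unfolded E0] ME[unfolded E0] l_def A_def N(1,2) s N(3) \<theta>2_def \<beta> \<beta>A _ _ _ K(2) that])
              (auto simp: \<alpha>_def AA)
          show ?case
            using C.contraction_conclusions[OF lyapunov_profile_axioms \<eta>p \<epsilon> u contr] by blast
        qed
      qed
    qed
  qed
qed

end

section \<open>Reversibility\<close>

context pcn_chain
begin

lemma emeasure_transition:
  assumes x: "x \<in> S" and A: "A \<in> sets \<gamma>"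
  shows "emeasure (transition x) A = (\<integral>\<^sup>+\<xi>. ennreal (accept_prob \<Phi> x (pcn_proposal \<delta> x \<xi>)) * indicator A (pcn_proposal \<delta> x \<xi>)
      + ennreal (1 - accept_prob \<Phi> x (pcn_proposal \<delta> x \<xi>)) * indicator A x \<partial>\<gamma>)"
proof -
  have xs[measurable]: "x \<in> space \<gamma>" using x by (simp add: space_noise)
  have m: "step x \<in> driver \<rightarrow>\<^sub>M \<gamma>" by measurable
  have "emeasure (transition x) A = emeasure driver (step x -` A \<inter> space driver)"
    unfolding transition_eq_distr[OF x] by (rule emeasure_distr[OF m A])
  also have "\<dots> = (\<integral>\<^sup>+\<xi>. emeasure unif (Pair \<xi> -` (step x -` A \<inter> space driver)) \<partial>\<gamma>)"
    by (rule unif.emeasure_pair_measure_alt[OF measurable_sets[OF m A]])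
  also have "\<dots> = (\<integral>\<^sup>+\<xi>. emeasure unif ((\<lambda>u. step x (\<xi>, u)) -` A) \<partial>\<gamma>)"
    by (intro nn_integral_cong arg_cong[where f="emeasure unif"]) (auto simp: space_pair_measure)
  also have "\<dots> = (\<integral>\<^sup>+\<xi>. ennreal (accept_prob \<Phi> x (pcn_proposal \<delta> x \<xi>)) * indicator A (pcn_proposal \<delta> x \<xi>)
      + ennreal (1 - accept_prob \<Phi> x (pcn_proposal \<delta> x \<xi>)) * indicator A x \<partial>\<gamma>)"
    using x by (intro nn_integral_cong emeasure_step) (auto simp: space_noise)
  finally show ?thesis .
qed

text \<open>
  Detailed balance: \<open>exp (- \<Phi> x) \<cdot> accept_prob \<Phi> x y = min (exp (- \<Phi> x)) (exp (- \<Phi> y))\<close> is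
  symmetric, and so is the joint law of the state and the proposal under the noise measure.
\<close>

lemma invariant_target:
  assumes sym: "\<And>f. f \<in> borel_measurable (borel \<Otimes>\<^sub>M borel) \<Longrightarrow>
      (\<integral>\<^sup>+z. f (fst z, pcn_proposal \<delta> (fst z) (snd z)) \<partial>(\<gamma> \<Otimes>\<^sub>M \<gamma>)) = (\<integral>\<^sup>+z. f (pcn_proposal \<delta> (fst z) (snd z), fst z) \<partial>(\<gamma> \<Otimes>\<^sub>M \<gamma>))"
    and int: "integrable \<gamma> (\<lambda>x. exp (- \<Phi> x))"
  shows "invariant_measure \<gamma> transition (target_measure \<Phi> \<gamma>)"
proof -
  define Z where "Z = (LINT x|\<gamma>. exp (- \<Phi> x))"
  have Z: "0 < Z"
  proof -
    have "(LINT x|\<gamma>. 0) < Z" unfolding Z_def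
      by (rule noise.integral_less_AE_space) (use int in \<open>auto simp: noise.emeasure_space_1\<close>)
    then show ?thesis by simp
  qed
  define w where "w x = ennreal (exp (- \<Phi> x) / Z)" for x
  have wm[measurable]: "w \<in> borel_measurable borel" unfolding w_def[abs_def] by measurable
  have wm': "w \<in> borel_measurable \<gamma>" by (rule noise_from_borel) measurable
  have \<mu>: "target_measure \<Phi> \<gamma> = density \<gamma> w" by (simp add: target_measure_def w_def[abs_def] Z_def)
  interpret \<mu>: prob_space "density \<gamma> w"
  proof
    have "emeasure (density \<gamma> w) (space \<gamma>) = (\<integral>\<^sup>+x. w x \<partial>\<gamma>)"
      using wm' by (subst emeasure_density) (auto intro!: nn_integral_cong)
    also have "\<dots> = ennreal (LINT x|\<gamma>. exp (- \<Phi> x) / Z)"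
      unfolding w_def using int Z by (intro nn_integral_eq_integral) auto
    also have "\<dots> = 1" using Z by (simp add: Z_def[symmetric])
    finally show "emeasure (density \<gamma> w) (space (density \<gamma> w)) = 1" by simp
  qed
  \<comment> \<open>As functions of state and proposal, \<open>m\<close> is the density of accepted
    moves and \<open>s\<close> that of rejected ones; together they give the density of the target
    at the state.\<close>
  define m where "m z = w (fst z) * ennreal (accept_prob \<Phi> (fst z) (snd z))" for z
  define s where "s z = w (fst z) * ennreal (1 - accept_prob \<Phi> (fst z) (snd z))" for z
  have am: "(\<lambda>z. accept_prob \<Phi> (fst z) (snd z)) \<in> borel_measurable (borel \<Otimes>\<^sub>M borel)"
    unfolding accept_prob_def by measurable
  have mm[measurable]: "m \<in> borel_measurable (borel \<Otimes>\<^sub>M borel)" "s \<in> borel_measurable (borel \<Otimes>\<^sub>M borel)"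
    unfolding m_def[abs_def] s_def[abs_def] using am by measurable
  have m_sym: "m (x, y) = m (y, x)" for x y
  proof -
    have "exp (- \<Phi> x) * min 1 (exp (\<Phi> x - \<Phi> y)) = exp (- \<Phi> y) * min 1 (exp (\<Phi> y - \<Phi> x))"
      by (auto simp: min_def exp_add[symmetric])
    then show ?thesis using Z by (simp add: m_def w_def accept_prob_def ennreal_mult[symmetric])
  qed
  have ms: "m z + s z = w (fst z)" for z
  proof -
    have "m z + s z = w (fst z) * (ennreal (accept_prob \<Phi> (fst z) (snd z)) + ennreal (1 - accept_prob \<Phi> (fst z) (snd z)))"
      by (simp add: m_def s_def distrib_left)
    also have "ennreal (accept_prob \<Phi> (fst z) (snd z)) + ennreal (1 - accept_prob \<Phi> (fst z) (snd z)) = 1"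
      by (subst ennreal_plus[symmetric]) auto
    finally show ?thesis by simp
  qed
  let ?q = "\<lambda>z. (fst z, pcn_proposal \<delta> (fst z) (snd z))"
  have qm: "?q \<in> \<gamma> \<Otimes>\<^sub>M \<gamma> \<rightarrow>\<^sub>M borel \<Otimes>\<^sub>M borel"
  proof -
    have [measurable]: "fst \<in> \<gamma> \<Otimes>\<^sub>M \<gamma> \<rightarrow>\<^sub>M borel" "snd \<in> \<gamma> \<Otimes>\<^sub>M \<gamma> \<rightarrow>\<^sub>M borel"
      by (rule noise_to_borel[OF measurable_fst], rule noise_to_borel[OF measurable_snd])
    show ?thesis by measurable
  qed
  have "density \<gamma> w \<bind> transition = density \<gamma> w"
  proof (rule measure_eqI)
    have K: "transition \<in> density \<gamma> w \<rightarrow>\<^sub>M subprob_algebra \<gamma>"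
      using measurable_prob_algebraD[OF transition_measurable] by simp
    show sets: "sets (density \<gamma> w \<bind> transition) = sets (density \<gamma> w)"
      using sets_bind_measurable[OF K \<mu>.not_empty] by simp
    fix A assume "A \<in> sets (density \<gamma> w \<bind> transition)"
    then have A: "A \<in> sets \<gamma>" using sets by simp
    then have [measurable]: "A \<in> sets borel" by (simp add: sets_noise_iff)
    have f1: "(\<lambda>z. m z * indicator A (snd z)) \<in> borel_measurable (borel \<Otimes>\<^sub>M borel)"
      and f2: "(\<lambda>z. s z * indicator A (fst z)) \<in> borel_measurable (borel \<Otimes>\<^sub>M borel)"
      and f3: "(\<lambda>z. m z * indicator A (fst z)) \<in> borel_measurable (borel \<Otimes>\<^sub>M borel)" by measurable
    note q1 = measurable_compose[OF qm f1] and q2 = measurable_compose[OF qm f2] and q3 = measurable_compose[OF qm f3]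
    have "emeasure (density \<gamma> w \<bind> transition) A = (\<integral>\<^sup>+x. emeasure (transition x) A \<partial>density \<gamma> w)"
      by (rule emeasure_bind[OF \<mu>.not_empty K A])
    also have "\<dots> = (\<integral>\<^sup>+x. w x * emeasure (transition x) A \<partial>\<gamma>)"
      using measurable_compose[OF measurable_prob_algebraD[OF transition_measurable] measurable_emeasure_subprob_algebra[OF A]]
      by (rule nn_integral_density[OF wm'])
    also have "\<dots> = (\<integral>\<^sup>+x. (\<integral>\<^sup>+\<xi>. m (?q (x, \<xi>)) * indicator A (snd (?q (x, \<xi>))) + s (?q (x, \<xi>)) * indicator A (fst (?q (x, \<xi>))) \<partial>\<gamma>) \<partial>\<gamma>)"
    proof (rule nn_integral_cong)
      fix x assume "x \<in> space \<gamma>"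
      then have x: "x \<in> S" by (simp add: space_noise)
      have pm[measurable]: "(\<lambda>\<xi>. pcn_proposal \<delta> x \<xi>) \<in> borel \<rightarrow>\<^sub>M borel" by measurable
      have "(\<lambda>\<xi>. ennreal (accept_prob \<Phi> x (pcn_proposal \<delta> x \<xi>)) * indicator A (pcn_proposal \<delta> x \<xi>)
         + ennreal (1 - accept_prob \<Phi> x (pcn_proposal \<delta> x \<xi>)) * indicator A x) \<in> borel_measurable borel"
        unfolding accept_prob_def by measurable
      note this[THEN noise_from_borel]
      then have "w x * emeasure (transition x) A = (\<integral>\<^sup>+\<xi>. w x * (ennreal (accept_prob \<Phi> x (pcn_proposal \<delta> x \<xi>)) * indicator A (pcn_proposal \<delta> x \<xi>)
         + ennreal (1 - accept_prob \<Phi> x (pcn_proposal \<delta> x \<xi>)) * indicator A x) \<partial>\<gamma>)"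
        unfolding emeasure_transition[OF x A] by (rule nn_integral_cmult[symmetric])
      also have "\<dots> = (\<integral>\<^sup>+\<xi>. m (?q (x, \<xi>)) * indicator A (snd (?q (x, \<xi>))) + s (?q (x, \<xi>)) * indicator A (fst (?q (x, \<xi>))) \<partial>\<gamma>)"
        by (simp add: m_def s_def distrib_left mult.assoc)
      finally show "w x * emeasure (transition x) A = \<dots>" .
    qed
    also have "\<dots> = (\<integral>\<^sup>+z. m (?q z) * indicator A (snd (?q z)) + s (?q z) * indicator A (fst (?q z)) \<partial>(\<gamma> \<Otimes>\<^sub>M \<gamma>))"
      by (rule noise.nn_integral_fst[OF borel_measurable_add[OF q1 q2]])
    also have "\<dots> = (\<integral>\<^sup>+z. m (?q z) * indicator A (snd (?q z)) \<partial>(\<gamma> \<Otimes>\<^sub>M \<gamma>)) + (\<integral>\<^sup>+z. s (?q z) * indicator A (fst (?q z)) \<partial>(\<gamma> \<Otimes>\<^sub>M \<gamma>))"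
      by (rule nn_integral_add[OF q1 q2])
    \<comment> \<open>The symmetric joint law exchanges state and proposal, and the symmetry of
      \<open>m\<close> restores its arguments. Only the position of the indicator changes, so that
      accepted and rejected part carry the same indicator and add up.\<close>
    also have "(\<integral>\<^sup>+z. m (?q z) * indicator A (snd (?q z)) \<partial>(\<gamma> \<Otimes>\<^sub>M \<gamma>)) = (\<integral>\<^sup>+z. m (?q z) * indicator A (fst (?q z)) \<partial>(\<gamma> \<Otimes>\<^sub>M \<gamma>))"
      using sym[OF f1] m_sym by simp
    also have "(\<integral>\<^sup>+z. m (?q z) * indicator A (fst (?q z)) \<partial>(\<gamma> \<Otimes>\<^sub>M \<gamma>)) + (\<integral>\<^sup>+z. s (?q z) * indicator A (fst (?q z)) \<partial>(\<gamma> \<Otimes>\<^sub>M \<gamma>))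
      = (\<integral>\<^sup>+z. m (?q z) * indicator A (fst (?q z)) + s (?q z) * indicator A (fst (?q z)) \<partial>(\<gamma> \<Otimes>\<^sub>M \<gamma>))"
      by (rule nn_integral_add[OF q3 q2, symmetric])
    also have "\<dots> = (\<integral>\<^sup>+z. w (fst z) * indicator A (fst z) \<partial>(\<gamma> \<Otimes>\<^sub>M \<gamma>))"
      by (intro nn_integral_cong) (simp add: distrib_right[symmetric] ms)
    also have "\<dots> = (\<integral>\<^sup>+x. (\<integral>\<^sup>+\<xi>. w x * indicator A x \<partial>\<gamma>) \<partial>\<gamma>)"
    proof -
      have "(\<lambda>z. w (fst z) * indicator A (fst z)) \<in> borel_measurable (\<gamma> \<Otimes>\<^sub>M \<gamma>)"
        by (intro borel_measurable_times_ennreal measurable_compose[OF measurable_fst wm'] measurable_compose[OF measurable_fst borel_measurable_indicator[OF A]])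
      from noise.nn_integral_fst[OF this] show ?thesis by simp
    qed
    also have "\<dots> = (\<integral>\<^sup>+x. w x * indicator A x \<partial>\<gamma>)" by (simp add: noise.emeasure_space_1)
    also have "\<dots> = emeasure (density \<gamma> w) A" using wm' A by (simp add: emeasure_density)
    finally show "emeasure (density \<gamma> w \<bind> transition) A = emeasure (density \<gamma> w) A" .
  qed
  then show ?thesis
    unfolding invariant_measure_def \<mu> using \<mu>.prob_space_axioms by (simp add: space_prob_algebra)
qed

text \<open>The joint characteristic functional of state and proposal is symmetric in its arguments,
  because the weights \<open>1 - 2 * \<delta>\<close> and \<open>2 * \<delta>\<close> of the two
  variances add up to \<open>1\<close>. The covariance enters as an abstract quadratic form, to
  treat \<open>\<gamma>\<close> and the projected noise alike.\<close>

lemma proposal_reversible: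
  assumes char: "\<And>h. (CLINT x|\<gamma>. iexp (h \<bullet> x)) = complex_of_real (exp (- q h / 2))"
    and quad: "\<And>h k c. q (h + c *\<^sub>R k) = q h + 2 * c * B h k + c\<^sup>2 * q k" "\<And>h k. B h k = B k h"
    and scale: "\<And>h c. q (c *\<^sub>R h) = c\<^sup>2 * q h"
    and f: "f \<in> borel_measurable (borel \<Otimes>\<^sub>M borel)"
  shows "(\<integral>\<^sup>+z. f (fst z, pcn_proposal \<delta> (fst z) (snd z)) \<partial>(\<gamma> \<Otimes>\<^sub>M \<gamma>)) = (\<integral>\<^sup>+z. f (pcn_proposal \<delta> (fst z) (snd z), fst z) \<partial>(\<gamma> \<Otimes>\<^sub>M \<gamma>))"
proof -
  interpret pair_prob_space \<gamma> \<gamma> ..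
  let ?L = "\<gamma> \<Otimes>\<^sub>M \<gamma>"
  let ?p = "\<lambda>z. pcn_proposal \<delta> (fst z) (snd z)"
  have mb[measurable]: "fst \<in> ?L \<rightarrow>\<^sub>M borel" "snd \<in> ?L \<rightarrow>\<^sub>M borel"
    by (rule noise_to_borel[OF measurable_fst], rule noise_to_borel[OF measurable_snd])
  have pm[measurable]: "?p \<in> ?L \<rightarrow>\<^sub>M borel" by measurable
  have qm: "(\<lambda>z. (fst z, ?p z)) \<in> ?L \<rightarrow>\<^sub>M borel \<Otimes>\<^sub>M borel" "(\<lambda>z. (?p z, fst z)) \<in> ?L \<rightarrow>\<^sub>M borel \<Otimes>\<^sub>M borel"
    by measurable
  note qm' = qm[unfolded borel_prod]
  have im: "(\<lambda>x. iexp (h \<bullet> x)) \<in> borel_measurable \<gamma>" for h :: 'a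
    by (rule noise_from_borel) measurable
  have prod: "(CLINT z|?L. iexp (h \<bullet> fst z) * iexp (k \<bullet> snd z)) = complex_of_real (exp (- (q h + q k) / 2))" for h k
  proof -
    have i: "integrable ?L (\<lambda>z. iexp (h \<bullet> fst z) * iexp (k \<bullet> snd z))"
      by (intro integrable_const_bound[where B=1] borel_measurable_times
          measurable_compose[OF measurable_fst im] measurable_compose[OF measurable_snd im]) (simp add: norm_mult)
    have "(CLINT z|?L. iexp (h \<bullet> fst z) * iexp (k \<bullet> snd z)) = (CLINT x|\<gamma>. (CLINT \<xi>|\<gamma>. iexp (h \<bullet> x) * iexp (k \<bullet> \<xi>)))"
      using integral_fst'[OF i] by simp
    also have "\<dots> = (CLINT x|\<gamma>. iexp (h \<bullet> x)) * (CLINT \<xi>|\<gamma>. iexp (k \<bullet> \<xi>))" by simp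
    also have "\<dots> = complex_of_real (exp (- (q h + q k) / 2))"
      unfolding char of_real_mult[symmetric] exp_add[symmetric] by (simp add: add_divide_distrib)
    finally show ?thesis .
  qed
  have ab: "(sqrt (1 - 2 * \<delta>))\<^sup>2 = 1 - 2 * \<delta>" "(sqrt (2 * \<delta>))\<^sup>2 = 2 * \<delta>" using delta by auto
  have c1: "(CLINT z|?L. iexp (h \<bullet> fst z + k \<bullet> ?p z)) = complex_of_real (exp (- (q h + q k + 2 * sqrt (1 - 2 * \<delta>) * B h k) / 2))" for h k
  proof -
    have "iexp (h \<bullet> fst z + k \<bullet> ?p z) = iexp ((h + sqrt (1 - 2 * \<delta>) *\<^sub>R k) \<bullet> fst z) * iexp ((sqrt (2 * \<delta>) *\<^sub>R k) \<bullet> snd z)" for z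
      by (simp add: exp_add[symmetric] inner_add_left inner_add_right algebra_simps)
    then have "(CLINT z|?L. iexp (h \<bullet> fst z + k \<bullet> ?p z)) = complex_of_real (exp (- (q (h + sqrt (1 - 2 * \<delta>) *\<^sub>R k) + q (sqrt (2 * \<delta>) *\<^sub>R k)) / 2))"
      by (simp only: prod)
    also have "q (h + sqrt (1 - 2 * \<delta>) *\<^sub>R k) + q (sqrt (2 * \<delta>) *\<^sub>R k) = q h + q k + 2 * sqrt (1 - 2 * \<delta>) * B h k"
      unfolding quad(1) scale ab by (simp add: algebra_simps)
    finally show ?thesis .
  qed
  have "distr ?L borel (\<lambda>z. (fst z, ?p z)) = distr ?L borel (\<lambda>z. (?p z, fst z))"
  proof (rule char_fun_uniqueness)
    show "prob_space (distr ?L borel (\<lambda>z. (fst z, ?p z)))" "prob_space (distr ?L borel (\<lambda>z. (?p z, fst z)))"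
      by (intro prob_space_distr qm')+
    fix hk :: "'a \<times> 'a"
    obtain h k where hk: "hk = (h, k)" by fastforce
    have pair_iexp: "(\<lambda>z. iexp (fst (h, k) \<bullet> fst z + snd (h, k) \<bullet> snd z)) \<in> borel_measurable (borel :: ('a \<times> 'a) measure)"
      by (intro borel_measurable_continuous_onI continuous_intros)
    have "char_fun (distr ?L borel (\<lambda>z. (fst z, ?p z))) hk = (CLINT z|?L. iexp (h \<bullet> fst z + k \<bullet> ?p z))"
      unfolding char_fun_def hk inner_prod_def by (subst integral_distr[OF qm'(1) pair_iexp]) simp
    also have "\<dots> = (CLINT z|?L. iexp (k \<bullet> fst z + h \<bullet> ?p z))"
      unfolding c1 quad(2)[of h k] by (simp add: add.commute)
    also have "\<dots> = char_fun (distr ?L borel (\<lambda>z. (?p z, fst z))) hk"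
      unfolding char_fun_def hk inner_prod_def by (subst integral_distr[OF qm'(2) pair_iexp]) (simp add: add.commute)
    finally show "char_fun (distr ?L borel (\<lambda>z. (fst z, ?p z))) hk = char_fun (distr ?L borel (\<lambda>z. (?p z, fst z))) hk" .
  qed auto
  then have "(\<integral>\<^sup>+y. f y \<partial>distr ?L borel (\<lambda>z. (fst z, ?p z))) = (\<integral>\<^sup>+y. f y \<partial>distr ?L borel (\<lambda>z. (?p z, fst z)))" by simp
  then show ?thesis
    using f by (simp add: nn_integral_distr[OF qm'(1)] nn_integral_distr[OF qm'(2)] borel_prod)
qed

end

text \<open>The potential is bounded below by an affine function of the norm, and the noise has all
  exponential moments; this yields the normalising constants on all state spaces at once.\<close>

lemma (in pcn_moment_chain) integrable_exp_potential: "integrable \<gamma> (\<lambda>x. exp (- \<Phi> x))"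
proof -
  obtain A B where AB: "\<And>x. - \<Phi> x \<le> A + B * norm x" using potential_lower by blast
  have "integrable \<gamma> (\<lambda>x. exp A * exp (B * norm x))" by (intro integrable_mult_right integrable_exp_norm)
  then show ?thesis
  proof (rule Bochner_Integration.integrable_bound)
    show "(\<lambda>x. exp (- \<Phi> x)) \<in> borel_measurable \<gamma>" by (rule noise_from_borel) measurable
    show "AE x in \<gamma>. norm (exp (- \<Phi> x)) \<le> norm (exp A * exp (B * norm x))"
      using AB by (intro AE_I2) (simp add: exp_add[symmetric])
  qed
qed

section \<open>The theorem\<close>

theorem theorem2p14:
  fixes \<gamma> :: "'a::{real_inner, complete_space, second_countable_topology} measure"
    and C :: "'a \<Rightarrow> 'a"
    and e :: "nat \<Rightarrow> 'a"
    and lam :: "nat \<Rightarrow> real"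
    and \<Phi> V :: "'a \<Rightarrow> real"
    and \<delta> \<rho> R \<alpha>\<^sub>l r a :: real
  assumes gaussian: "centred_gaussian \<gamma>"
    and covariance: "covariance_operator \<gamma> C"
    and basis: "orthonormal_basis e"
    and eigen: "\<And>n. C (e n) = (lam n)\<^sup>2 *\<^sub>R e n"
    and delta: "0 < \<delta>" "\<delta> \<le> 1 / 2"
    and rho: "\<rho> = 1 - sqrt (1 - 2 * \<delta>)"
    and integrable: "integrable \<gamma> (\<lambda>x. exp (- \<Phi> x))"
    and lipschitz: "\<And>\<kappa>. \<kappa> > 0 \<Longrightarrow>
      \<exists>M. \<forall>s>0. local_lipschitz_const \<Phi> s \<le> ereal (M * exp (\<kappa> * s))"
    and R: "R > 0"
    and r: "r > 0"
    and a: "1 / 2 < a" "a < 1"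
    and r_le: "\<And>s. s \<ge> R \<Longrightarrow> r * s powr a \<le> \<rho> / 2 * s"
    and acceptance: "\<And>x. x \<notin> ball 0 R \<Longrightarrow>
      (INF z \<in> ball ((1 - \<rho>) *\<^sub>R x) (r * norm x powr a). exp (- \<Phi> z + \<Phi> x)) > exp \<alpha>\<^sub>l"
    and V: "(\<exists>i::nat. i \<ge> 1 \<and> V = (\<lambda>x. norm x ^ i)) \<or>
            (\<exists>v>0. V = (\<lambda>x. exp (v * norm x)))"
  shows
    "unique_invariant_measure borel (pcn_kernel \<delta> \<Phi> \<gamma>) (target_measure \<Phi> \<gamma>) \<and>
     (\<forall>m\<ge>1. unique_invariant_measure (proj_space e m)
        (pcn_kernel \<delta> \<Phi> (gaussian_proj lam e m))
        (target_measure (\<lambda>x. \<Phi> (proj e m x)) (gaussian_proj lam e m))) \<and>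
     (\<exists>\<eta>\<^sub>0>0. \<forall>\<eta>. 0 < \<eta> \<and> \<eta> \<le> \<eta>\<^sub>0 \<longrightarrow>
       (\<exists>\<epsilon>\<^sub>0>0. \<forall>\<epsilon>. 0 < \<epsilon> \<and> \<epsilon> \<le> \<epsilon>\<^sub>0 \<longrightarrow>
         (\<exists>n::nat. n \<ge> 1 \<and>
           (\<forall>\<nu>1 \<in> space (prob_algebra borel). \<forall>\<nu>2 \<in> space (prob_algebra borel).
              transport_cost (weighted_dist \<eta> \<epsilon> V)
                (kernel_iterate (pcn_kernel \<delta> \<Phi> \<gamma>) n \<nu>1)
                (kernel_iterate (pcn_kernel \<delta> \<Phi> \<gamma>) n \<nu>2)
              \<le> 1 / 2 * transport_cost (weighted_dist \<eta> \<epsilon> V) \<nu>1 \<nu>2) \<and>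
           (\<forall>m\<ge>1. \<forall>\<nu>1 \<in> space (prob_algebra (proj_space e m)).
              \<forall>\<nu>2 \<in> space (prob_algebra (proj_space e m)).
              transport_cost (weighted_dist \<eta> \<epsilon> V)
                (kernel_iterate (pcn_kernel \<delta> \<Phi> (gaussian_proj lam e m)) n \<nu>1)
                (kernel_iterate (pcn_kernel \<delta> \<Phi> (gaussian_proj lam e m)) n \<nu>2)
              \<le> 1 / 2 * transport_cost (weighted_dist \<eta> \<epsilon> V) \<nu>1 \<nu>2))))"
proof -
  interpret pot: pcn_potential \<Phi> \<delta> \<rho> R \<alpha>\<^sub>l r a
    by unfold_locales (fact delta rho lipschitz R r r_le acceptance | use a in simp)+
  note [measurable_cong] = gaussian_prob(2)[OF gaussian]
  interpret G: prob_space \<gamma> by (rule gaussian_prob(1)[OF gaussian])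
  \<comment> \<open>A basis vector serves as the unit vector required for paths.\<close>
  have u: "norm (e 0) = 1" using basis by (simp add: orthonormal_basis_def norm_eq_1)
  obtain W v q where W: "lyapunov_profile W v q \<rho>" and V_eq: "V = (\<lambda>x. W (norm x))"
    using V lyapunov_profile_power[OF pot.rho_bounds] lyapunov_profile_exp[OF pot.rho_bounds] by metis
  obtain L where L: "L > 0" "\<And>v. (\<integral>\<^sup>+x. ennreal (exp (v * norm x)) \<partial>\<gamma>) \<le> ennreal (2 * exp (v\<^sup>2 * L))"
    using gaussian_exp_moment[OF gaussian covariance basis eigen] by blast
  define E where "E v = 2 * exp (v\<^sup>2 * L)" for v
  define chain where "chain S \<gamma>' \<longleftrightarrow> pcn_moment_chain \<Phi> \<delta> \<rho> R \<alpha>\<^sub>l r a S \<gamma>' E" for S \<gamma>'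
  interpret lyap: pcn_lyapunov \<Phi> \<delta> \<rho> R \<alpha>\<^sub>l r a W v q
    using pot.pcn_potential_axioms W by (simp add: pcn_lyapunov_def)
  let ?\<gamma>m = "gaussian_proj lam e"
  let ?d = "\<lambda>\<eta> \<epsilon>. weighted_dist \<eta> \<epsilon> V"
  let ?K = "pcn_kernel \<delta> \<Phi>"
  have chain: "chain UNIV \<gamma>"
    unfolding chain_def
    by unfold_locales (use gaussian_prob[OF gaussian] L(2) in \<open>auto simp: E_def\<close>)
  note gm = gaussian_proj_eq_distr[OF gaussian covariance basis eigen]
  have pm: "proj e m \<in> \<gamma> \<rightarrow>\<^sub>M proj_space e m" for m
    by measurable
  have chain_m: "chain (range (proj e m)) (?\<gamma>m m)" for m
    unfolding chain_def
  proof -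
    interpret M: prob_space "?\<gamma>m m" unfolding gm by (rule G.prob_space_distr[OF pm])
    show "pcn_moment_chain \<Phi> \<delta> \<rho> R \<alpha>\<^sub>l r a (range (proj e m)) (?\<gamma>m m) E"
    proof unfold_locales
      show "subspace (range (proj e m))"
        using subspace_UNIV linear_proj by (rule linear_subspace_image[rotated])
      show "closed (range (proj e m))" by (rule closed_range_proj[OF basis])
      show "sets (?\<gamma>m m) = sets (restrict_space borel (range (proj e m)))"
        by (simp add: gm proj_space_def)
      fix w :: real
      have nm: "(\<lambda>x. ennreal (exp (w * norm x))) \<in> borel_measurable (proj_space e m)"
        unfolding proj_space_def by (intro measurable_restrict_space1) measurable
      have "(\<integral>\<^sup>+x. ennreal (exp (w * norm x)) \<partial>?\<gamma>m m) = (\<integral>\<^sup>+x. ennreal (exp (w * norm (proj e m x))) \<partial>\<gamma>)"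
        unfolding gm using nm by (subst nn_integral_distr[OF pm]) simp_all
      also have "\<dots> \<le> ennreal (E w)"
      proof (cases "0 \<le> w")
        case True
        then have "(\<integral>\<^sup>+x. ennreal (exp (w * norm (proj e m x))) \<partial>\<gamma>) \<le> (\<integral>\<^sup>+x. ennreal (exp (w * norm x)) \<partial>\<gamma>)"
          using norm_proj_le[OF basis] by (intro nn_integral_mono ennreal_leI) (simp add: mult_left_mono)
        also note L(2)[of w]
        finally show ?thesis by (simp add: E_def)
      next
        \<comment> \<open>For negative exponents the norm bound for the projection points in the
          wrong direction; there the integrand is at most \<open>1\<close>, which \<open>E\<close>
          dominates.\<close>
        case False
        then have "(\<integral>\<^sup>+x. ennreal (exp (w * norm (proj e m x))) \<partial>\<gamma>) \<le> (\<integral>\<^sup>+x. 1 \<partial>\<gamma>)"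
          by (intro nn_integral_mono) (simp add: mult_nonpos_nonneg)
        also have "\<dots> \<le> ennreal (E w)"
        proof -
          have "1 \<le> exp (w\<^sup>2 * L)" using L(1) by simp
          then have "1 \<le> E w" unfolding E_def by linarith
          then show ?thesis using ennreal_leI[of 1 "E w"] by (simp add: G.emeasure_space_1)
        qed
        finally show ?thesis .
      qed
      finally show "(\<integral>\<^sup>+x. ennreal (exp (w * norm x)) \<partial>?\<gamma>m m) \<le> ennreal (E w)" .
    qed
  qed
  \<comment> \<open>\<open>T\<close> is the identity for \<open>\<gamma>\<close> and the projection
    for the projected noise; the covariance form is pulled back along it.\<close>
  have invariant: "invariant_measure \<gamma>' (?K \<gamma>') (target_measure \<Phi> \<gamma>')"
    if c: "chain S \<gamma>'" and char: "\<And>h. (CLINT x|\<gamma>'. iexp (h \<bullet> x)) = complex_of_real (exp (- (C (T h) \<bullet> T h) / 2))"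
      and T: "linear T" for S \<gamma>' and T :: "'a \<Rightarrow> 'a"
  proof -
    interpret C: pcn_moment_chain \<Phi> \<delta> \<rho> R \<alpha>\<^sub>l r a S \<gamma>' E using c by (simp add: chain_def)
    note quad = covariance_quadratic[OF covariance]
    have C0: "C h \<bullet> 0 = 0" "C 0 \<bullet> h = 0" for h
      using covariance_symmetric[OF covariance, of 0 h] by simp_all
    show ?thesis
    proof (rule C.invariant_target[OF C.proposal_reversible C.integrable_exp_potential])
      show "(CLINT x|\<gamma>'. iexp (h \<bullet> x)) = complex_of_real (exp (- (C (T h) \<bullet> T h) / 2))" for h by (rule char)
      show "C (T (h + c *\<^sub>R k)) \<bullet> T (h + c *\<^sub>R k) = C (T h) \<bullet> T h + 2 * c * (C (T h) \<bullet> T k) + c\<^sup>2 * (C (T k) \<bullet> T k)" for h k c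
        unfolding linear_add[OF T] linear_cmul[OF T] by (rule quad)
      show "C (T h) \<bullet> T k = C (T k) \<bullet> T h" for h k by (rule covariance_symmetric[OF covariance])
      show "C (T (c *\<^sub>R h)) \<bullet> T (c *\<^sub>R h) = c\<^sup>2 * (C (T h) \<bullet> T h)" for h c
        using quad[of 0 c "T h"] by (simp add: linear_cmul[OF T] C0)
    qed
  qed
  have inv: "invariant_measure \<gamma> (?K \<gamma>) (target_measure \<Phi> \<gamma>)"
    using char_fun_gaussian[OF gaussian covariance] by (intro invariant[OF chain, of id]) (auto simp: char_fun_def linear_id)
  have inv_m: "invariant_measure (?\<gamma>m m) (?K (?\<gamma>m m)) (target_measure \<Phi> (?\<gamma>m m))" for m
  proof (rule invariant[OF chain_m _ linear_proj])
    fix h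
    have im: "(\<lambda>x. iexp (h \<bullet> x)) \<in> borel_measurable (proj_space e m)"
      unfolding proj_space_def by (intro measurable_restrict_space1) measurable
    have "(CLINT x|?\<gamma>m m. iexp (h \<bullet> x)) = char_fun \<gamma> (proj e m h)"
      unfolding gm integral_distr[OF pm im] char_fun_def by (simp add: inner_proj_commute)
    then show "(CLINT x|?\<gamma>m m. iexp (h \<bullet> x)) = complex_of_real (exp (- (C (proj e m h) \<bullet> proj e m h) / 2))"
      by (simp add: char_fun_gaussian[OF gaussian covariance])
  qed
  have sets_m: "sets (?\<gamma>m m) = sets (proj_space e m)" for m by (simp add: gm)
  \<comment> \<open>On the range the projection is the identity, so the density may be written with
    \<open>\<Phi>\<close> in place of its composition with the projection.\<close>
  have target_m: "target_measure (\<lambda>x. \<Phi> (proj e m x)) (?\<gamma>m m) = target_measure \<Phi> (?\<gamma>m m)" for m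
  proof -
    have "proj e m x = x" if "x \<in> space (?\<gamma>m m)" for x
      using that proj_idem[OF basis] sets_eq_imp_space_eq[OF sets_m[of m]]
      by (auto simp: proj_space_def space_restrict_space)
    then have eq: "(LINT y|?\<gamma>m m. exp (- \<Phi> (proj e m y))) = (LINT y|?\<gamma>m m. exp (- \<Phi> y))"
      and *: "\<And>x. x \<in> space (?\<gamma>m m) \<Longrightarrow> \<Phi> (proj e m x) = \<Phi> x"
      by (auto intro!: Bochner_Integration.integral_cong)
    have meas: "f \<in> borel_measurable (?\<gamma>m m)" if "f \<in> borel_measurable borel" for f :: "'a \<Rightarrow> ennreal"
      using that by (simp add: measurable_cong_sets[OF sets_m refl] proj_space_def measurable_restrict_space1)
    have [measurable]: "(\<lambda>x. \<Phi> (proj e m x)) \<in> borel_measurable borel"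
      by (rule measurable_compose[OF proj_measurable pot.potential_measurable])
    show ?thesis unfolding target_measure_def eq
    proof (rule density_cong[OF meas meas AE_I2])
      fix x assume "x \<in> space (?\<gamma>m m)"
      then show "ennreal (exp (- \<Phi> (proj e m x)) / (LINT y|?\<gamma>m m. exp (- \<Phi> y))) = ennreal (exp (- \<Phi> x) / (LINT y|?\<gamma>m m. exp (- \<Phi> y)))"
        by (simp add: *)
    qed measurable
  qed
  obtain \<eta>\<^sub>0 where \<eta>\<^sub>0: "\<eta>\<^sub>0 > 0" and contraction: "\<And>\<eta>. 0 < \<eta> \<and> \<eta> \<le> \<eta>\<^sub>0 \<Longrightarrow>
       \<exists>\<epsilon>\<^sub>0>0. \<forall>\<epsilon>. 0 < \<epsilon> \<and> \<epsilon> \<le> \<epsilon>\<^sub>0 \<longrightarrow> (\<exists>n\<ge>1. lyap.contracts E \<eta> \<epsilon> n)"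
    using lyap.uniform_contraction[OF u, of E] by blast
  \<comment> \<open>Uniqueness does not mention \<open>\<eta>\<close> and \<open>\<epsilon>\<close>,
    so one admissible pair suffices.\<close>
  obtain \<epsilon>\<^sub>1 n\<^sub>1 where "lyap.contracts E \<eta>\<^sub>0 \<epsilon>\<^sub>1 n\<^sub>1"
    using contraction[of \<eta>\<^sub>0] \<eta>\<^sub>0 by auto
  then have unique: "\<mu> = \<nu>" if "chain S \<gamma>'" "invariant_measure \<gamma>' (?K \<gamma>') \<mu>" "invariant_measure \<gamma>' (?K \<gamma>') \<nu>" for S \<gamma>' \<mu> \<nu>
    using that unfolding lyap.contracts_def chain_def by metis
  have contractsD: "transport_cost (?d \<eta> \<epsilon>) (kernel_iterate (?K \<gamma>') n \<nu>1) (kernel_iterate (?K \<gamma>') n \<nu>2)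
      \<le> 1 / 2 * transport_cost (?d \<eta> \<epsilon>) \<nu>1 \<nu>2"
    if "lyap.contracts E \<eta> \<epsilon> n" "chain S \<gamma>'" "\<nu>1 \<in> space (prob_algebra \<gamma>')" "\<nu>2 \<in> space (prob_algebra \<gamma>')" for \<eta> \<epsilon> n S \<gamma>' \<nu>1 \<nu>2
    using that unfolding lyap.contracts_def chain_def V_eq by metis
  have inv_cong: "invariant_measure M K = invariant_measure N K" if "sets M = sets N" for M N :: "'a measure" and K
    using that by (intro ext) (simp add: invariant_measure_def space_prob_algebra)
  have alg_cong: "space (prob_algebra M) = space (prob_algebra N)" if "sets M = sets N" for M N :: "'a measure"
    using that by (simp add: space_prob_algebra)
  note sb = gaussian_prob(2)[OF gaussian]
  show ?thesis
  proof (intro conjI allI impI)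
    show "unique_invariant_measure borel (?K \<gamma>) (target_measure \<Phi> \<gamma>)"
      unfolding unique_invariant_measure_def inv_cong[OF sb, symmetric] using inv unique[OF chain] by blast
    show "unique_invariant_measure (proj_space e m) (?K (?\<gamma>m m)) (target_measure (\<lambda>x. \<Phi> (proj e m x)) (?\<gamma>m m))" for m
      unfolding unique_invariant_measure_def inv_cong[OF sets_m, symmetric] target_m using inv_m unique[OF chain_m] by blast
    show "\<exists>\<eta>\<^sub>0>0. \<forall>\<eta>. 0 < \<eta> \<and> \<eta> \<le> \<eta>\<^sub>0 \<longrightarrow>
       (\<exists>\<epsilon>\<^sub>0>0. \<forall>\<epsilon>. 0 < \<epsilon> \<and> \<epsilon> \<le> \<epsilon>\<^sub>0 \<longrightarrow>
         (\<exists>n::nat. n \<ge> 1 \<and>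
           (\<forall>\<nu>1 \<in> space (prob_algebra borel). \<forall>\<nu>2 \<in> space (prob_algebra borel).
              transport_cost (?d \<eta> \<epsilon>) (kernel_iterate (?K \<gamma>) n \<nu>1) (kernel_iterate (?K \<gamma>) n \<nu>2)
              \<le> 1 / 2 * transport_cost (?d \<eta> \<epsilon>) \<nu>1 \<nu>2) \<and>
           (\<forall>m\<ge>1. \<forall>\<nu>1 \<in> space (prob_algebra (proj_space e m)). \<forall>\<nu>2 \<in> space (prob_algebra (proj_space e m)).
              transport_cost (?d \<eta> \<epsilon>) (kernel_iterate (?K (?\<gamma>m m)) n \<nu>1) (kernel_iterate (?K (?\<gamma>m m)) n \<nu>2)
              \<le> 1 / 2 * transport_cost (?d \<eta> \<epsilon>) \<nu>1 \<nu>2)))"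
    proof (rule exI[of _ \<eta>\<^sub>0], intro conjI \<eta>\<^sub>0 allI impI)
      fix \<eta> assume "0 < \<eta> \<and> \<eta> \<le> \<eta>\<^sub>0"
      from contraction[OF this] obtain \<epsilon>\<^sub>0 where "\<epsilon>\<^sub>0 > 0"
        and c: "\<And>\<epsilon>. 0 < \<epsilon> \<and> \<epsilon> \<le> \<epsilon>\<^sub>0 \<Longrightarrow> \<exists>n::nat. n \<ge> 1 \<and> lyap.contracts E \<eta> \<epsilon> n"
        by blast
      have c': "\<exists>n::nat. n \<ge> 1 \<and>
           (\<forall>\<nu>1 \<in> space (prob_algebra borel). \<forall>\<nu>2 \<in> space (prob_algebra borel).
              transport_cost (?d \<eta> \<epsilon>) (kernel_iterate (?K \<gamma>) n \<nu>1) (kernel_iterate (?K \<gamma>) n \<nu>2)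
              \<le> 1 / 2 * transport_cost (?d \<eta> \<epsilon>) \<nu>1 \<nu>2) \<and>
           (\<forall>m\<ge>1. \<forall>\<nu>1 \<in> space (prob_algebra (proj_space e m)). \<forall>\<nu>2 \<in> space (prob_algebra (proj_space e m)).
              transport_cost (?d \<eta> \<epsilon>) (kernel_iterate (?K (?\<gamma>m m)) n \<nu>1) (kernel_iterate (?K (?\<gamma>m m)) n \<nu>2)
              \<le> 1 / 2 * transport_cost (?d \<eta> \<epsilon>) \<nu>1 \<nu>2)"
        if \<epsilon>: "0 < \<epsilon> \<and> \<epsilon> \<le> \<epsilon>\<^sub>0" for \<epsilon>
      proof -
        obtain n where "n \<ge> 1" and n: "lyap.contracts E \<eta> \<epsilon> n" using c[OF \<epsilon>] by blast
        then show ?thesis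
          unfolding alg_cong[OF sb, symmetric] alg_cong[OF sets_m, symmetric]
          by (intro exI[of _ n] conjI ballI allI impI contractsD[OF n chain] contractsD[OF n chain_m])
      qed
      show "\<exists>\<epsilon>\<^sub>0>0. \<forall>\<epsilon>. 0 < \<epsilon> \<and> \<epsilon> \<le> \<epsilon>\<^sub>0 \<longrightarrow>
         (\<exists>n::nat. n \<ge> 1 \<and>
           (\<forall>\<nu>1 \<in> space (prob_algebra borel). \<forall>\<nu>2 \<in> space (prob_algebra borel).
              transport_cost (?d \<eta> \<epsilon>) (kernel_iterate (?K \<gamma>) n \<nu>1) (kernel_iterate (?K \<gamma>) n \<nu>2)
              \<le> 1 / 2 * transport_cost (?d \<eta> \<epsilon>) \<nu>1 \<nu>2) \<and>
           (\<forall>m\<ge>1. \<forall>\<nu>1 \<in> space (prob_algebra (proj_space e m)). \<forall>\<nu>2 \<in> space (prob_algebra (proj_space e m)).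
              transport_cost (?d \<eta> \<epsilon>) (kernel_iterate (?K (?\<gamma>m m)) n \<nu>1) (kernel_iterate (?K (?\<gamma>m m)) n \<nu>2)
              \<le> 1 / 2 * transport_cost (?d \<eta> \<epsilon>) \<nu>1 \<nu>2))"
        by (rule exI[of _ \<epsilon>\<^sub>0], rule conjI, fact, intro allI impI, rule c')
    qed
  qed
qed

end
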